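(* Let $\mathcal{T}$ be a regular metric tree of infinite height with generating sequences $\{b_n\},\{\rho_n\}$ such that $\{b_n\}$ is nondecreasing and $\{\rho_n-\rho_{n-1}\}$ is nonincreasing. Let $u_0\in L^2(\mathcal{T})$ with $0\le u_0\le 1$ a.e. in $\mathcal{T}$. Let $f\in C^1([0,1])\cap C^\infty(0,1)$ satisfy $f(0)=f(1)=0$, $f(u)>0$ for all $u\in(0,1)$, and $M:=\sup_{u\in(0,1]}\frac{f(u)}{u}<\infty$. Let $u_0$ be suitably small, in the sense that $u_0(x)\le m(\rho(x))$ for any $x\in\mathcal{T}$, where $m=\sum_{n=1}^\infty m_n\chi_{I_n}$, $I_n:=(\rho_{n-1},\rho_n)$, is the function given by $m_1:=1$ in $I_1$ and, for $n\ge2$, $$m_n(\rho):=\frac{1}{\sqrt{b_0\cdots b_{n-1}}}\left(\frac{1}{\sqrt{b_0\cdots b_{n-2}}}-\kappa_n(\rho-\rho_{n-1})\right)\quad(\rho\in I_n),\qquad \kappa_n:=\frac{\frac{1}{\sqrt{b_0\cdots b_{n-2}}}-\frac{1}{\sqrt{b_0\cdots b_n}}}{\rho_n-\rho_{n-1}}.$$ Let $u$ be the corresponding solution of the problem $u_t=\Delta u+f(u)$ in $\mathcal{T}\times(0,\infty)$, $u=u_0$ in $\mathcal{T}\times\{0\}$. Then for any $y\in\mathcal{T}$ and for any $c>\hat c$, where $$\hat c:=M\rho_1\,\frac{b_1}{b_1-1},$$ there holds $$\lim_{t\to\infty}\ \sup_{\rho(x)\ge\rho(y)+ct}u(x,t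)=0.$$
   Context: Regular metric trees. A metric tree is a connected metric graph without cycles (countably many vertices; edges $e$ are intervals $I_e=(0,l_e)$ of finite length glued at vertices) with a singled-out boundary vertex $O$, the root. It is regular with generating sequences $\{b_n\}_{n\ge0}$, $\{\rho_n\}_{n\ge0}$ if $b_0=1$, $b_n\ge2$ are integers for $n\ge1$, $0=\rho_0<\rho_1<\rho_2<\dots$, $O$ is the only vertex of generation $0$, and from every vertex of generation $n$ there emanate exactly $b_n$ edges, each of length $\rho_{n+1}-\rho_n$, leading to vertices of generation $n+1$. Let $d$ be the path metric and $\rho(x):=d(x,O)$. Infinite height means $\sup_{x}\rho(x)=\infty$, i.e. $\rho_n\to\infty$. The measure $\mu$ on $\mathcal{T}$ is induced by Lebesgue measure on the edges. $\chi_I$ is the characteristic function of $I$; since $u_0$ is an $L^2$ function, the values of $m$ at the points $\rho_n$ are immaterial. A function $f$ on $\mathcal{T}$ is identified with the family $\{f_e\}$ of its restrictions to edges. $H^1(\mathcal{T})$ is the set of $f\in L^2(\mathcal{T})$ which are continuous on $\mathcal{T}$ with weak derivative (edgewise) $f'\in L^2(\mathcal{T})$. Neumann Laplacian. $D(\Delta)$ is the set of $f\in H^1(\mathcal{T})$ such that $f_e\in H^2(I_e)$ for every edge $e$, $\sum_e\int_0^{l_e}|f_e''|^2dx<\infty$, and $\sum_{e\ni v}\frac{df_e}{d\nu}(v)=0$ at every vertex $v$ ($\frac{d}{d\nu}$ is the outer derivative; at $O$ this is the homogeneous Neumann condition, elsewhere the Kirchhoff condition); $(\Delta f)_e:=f_e''$.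 Solution. A solution is a function $u\in C([0,\infty);L^2(\mathcal{T}))\cap C^1((0,\infty);L^2(\mathcal{T}))$ with $0\le u(\cdot,t)\le1$ a.e. in $\mathcal{T}$ for all $t\ge0$, $u(\cdot,t)\in D(\Delta)$ for $t>0$, $\Delta u\in C((0,\infty);L^2(\mathcal{T}))$, $u_t(\cdot,t)=\Delta u(\cdot,t)+f(u(\cdot,t))$ a.e. in $\mathcal{T}$ for all $t>0$, and $u(\cdot,0)=u_0$ a.e. A unique solution exists under the stated assumptions on $u_0$ and $f$. *)

theory Defs
  imports "HOL-Analysis.Analysis"
begin

section \<open>Metric trees\<close>

text \<open>
  Every edge \<open>e\<close> is a copy of the interval from \<open>0\<close> to \<open>len e\<close>, glued to the vertex \<open>src e\<close> at
  \<open>0\<close> and to \<open>dst e\<close> at \<open>len e\<close>. The graph is undirected: \<open>src\<close> and \<open>dst\<close> only record the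
  parametrization of the edge, which may run towards the base vertex or away from it.
\<close>

record ('v, 'e) metric_graph =
  verts :: "'v set"
  edges :: "'e set"
  src :: "'e \<Rightarrow> 'v"
  dst :: "'e \<Rightarrow> 'v"
  len :: "'e \<Rightarrow> real"
  base :: 'v

definition joins :: "('v, 'e) metric_graph \<Rightarrow> 'e \<Rightarrow> 'v \<Rightarrow> 'v \<Rightarrow> bool" where
  "joins T e v w \<longleftrightarrow>
     e \<in> edges T \<and> (src T e = v \<and> dst T e = w \<or> src T e = w \<and> dst T e = v)"

inductive walk :: "('v, 'e) metric_graph \<Rightarrow> 'v \<Rightarrow> 'e list \<Rightarrow> 'v \<Rightarrow> bool" for T where
  walk_Nil: "v \<in> verts T \<Longrightarrow> walk T v [] v"
| walk_Cons: "joins T e u v \<Longrightarrow> walk T v es w \<Longrightarrow> walk T u (e # es) w"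

text \<open>
  A graph has no cycles iff it has no nonempty closed walk with pairwise distinct edges; this also
  excludes loops and multiple edges.
\<close>

definition metric_tree :: "('v, 'e) metric_graph \<Rightarrow> bool" where
  "metric_tree T \<longleftrightarrow>
     countable (verts T) \<and> base T \<in> verts T \<and>
     (\<forall>e\<in>edges T. src T e \<in> verts T \<and> dst T e \<in> verts T \<and> 0 < len T e) \<and>
     (\<forall>v\<in>verts T. \<forall>w\<in>verts T. \<exists>es. walk T v es w) \<and>
     \<not> (\<exists>v es. walk T v es v \<and> es \<noteq> [] \<and> distinct es)"

definition generation :: "('v, 'e) metric_graph \<Rightarrow> 'v \<Rightarrow> nat" where
  "generation T v = (LEAST n. \<exists>es. walk T (base T) es v \<and> length es = n)"

text \<open>The edges that lead from \<open>v\<close> to a vertex of the next generation.\<close>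

definition emanating :: "('v, 'e) metric_graph \<Rightarrow> 'v \<Rightarrow> 'e set" where
  "emanating T v = {e. \<exists>w. joins T e v w \<and> generation T w = Suc (generation T v)}"

definition regular_metric_tree ::
  "('v, 'e) metric_graph \<Rightarrow> (nat \<Rightarrow> nat) \<Rightarrow> (nat \<Rightarrow> real) \<Rightarrow> bool" where
  "regular_metric_tree T b r \<longleftrightarrow>
     metric_tree T \<and> b 0 = 1 \<and> (\<forall>n\<ge>1. 2 \<le> b n) \<and> r 0 = 0 \<and> strict_mono r \<and>
     (\<forall>v\<in>verts T. generation T v = 0 \<longleftrightarrow> v = base T) \<and>
     (\<forall>v\<in>verts T. card (emanating T v) = b (generation T v) \<and>
        (\<forall>e\<in>emanating T v. len T e = r (Suc (generation T v)) - r (generation T v)))"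

subsection \<open>Points, path metric and measure\<close>

datatype ('v, 'e) point = Vertex 'v | Inner 'e real

definition points :: "('v, 'e) metric_graph \<Rightarrow> ('v, 'e) point set" where
  "points T = Vertex ` verts T \<union> {Inner e s |e s. e \<in> edges T \<and> 0 < s \<and> s < len T e}"

text \<open>The parametrization of the closed edge \<open>e\<close> over the interval from \<open>0\<close> to \<open>len e\<close>.\<close>

definition edge_point :: "('v, 'e) metric_graph \<Rightarrow> 'e \<Rightarrow> real \<Rightarrow> ('v, 'e) point" where
  "edge_point T e s =
     (if s = 0 then Vertex (src T e) else if s = len T e then Vertex (dst T e) else Inner e s)"

text \<open>Paths are concatenations of segments of closed edges.\<close>

inductive path_of_length ::
  "('v, 'e) metric_graph \<Rightarrow> ('v, 'e) point \<Rightarrow> ('v, 'e) point \<Rightarrow> real \<Rightarrow> bool" for T where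
  path_trivial: "x \<in> points T \<Longrightarrow> path_of_length T x x 0"
| path_segment:
    "path_of_length T x (edge_point T e s) a \<Longrightarrow> e \<in> edges T \<Longrightarrow>
     s \<in> {0..len T e} \<Longrightarrow> t \<in> {0..len T e} \<Longrightarrow>
     path_of_length T x (edge_point T e t) (a + \<bar>t - s\<bar>)"

definition path_dist ::
  "('v, 'e) metric_graph \<Rightarrow> ('v, 'e) point \<Rightarrow> ('v, 'e) point \<Rightarrow> real" where
  "path_dist T x y = Inf {a. path_of_length T x y a}"

definition depth :: "('v, 'e) metric_graph \<Rightarrow> ('v, 'e) point \<Rightarrow> real" where
  "depth T x = path_dist T x (Vertex (base T))"

definition infinite_height :: "('v, 'e) metric_graph \<Rightarrow> bool" where
  "infinite_height T \<longleftrightarrow> \<not> bdd_above (depth T ` points T)"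

definition continuous_on_tree :: "('v, 'e) metric_graph \<Rightarrow> (('v, 'e) point \<Rightarrow> real) \<Rightarrow> bool" where
  "continuous_on_tree T f \<longleftrightarrow>
     (\<forall>x\<in>points T. \<forall>\<epsilon>>0. \<exists>\<delta>>0. \<forall>y\<in>points T. path_dist T x y < \<delta> \<longrightarrow> \<bar>f y - f x\<bar> < \<epsilon>)"

definition open_edge :: "('v, 'e) metric_graph \<Rightarrow> 'e \<Rightarrow> real set" where
  "open_edge T e = {0<..<len T e}"

definition tree_sets :: "('v, 'e) metric_graph \<Rightarrow> ('v, 'e) point set set" where
  "tree_sets T =
     {A. A \<subseteq> points T \<and> (\<forall>e\<in>edges T. {s\<in>open_edge T e. Inner e s \<in> A} \<in> sets lebesgue)}"

definition tree_measure :: "('v, 'e) metric_graph \<Rightarrow> ('v, 'e) point measure" where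
  "tree_measure T = measure_of (points T) (tree_sets T)
     (\<lambda>A. \<integral>\<^sup>+ e. emeasure lebesgue {s\<in>open_edge T e. Inner e s \<in> A} \<partial>count_space (edges T))"

text \<open>The data passed to \<open>measure_of\<close> do form a measure space.\<close>

lemma sigma_algebra_tree_sets: "sigma_algebra (points T) (tree_sets T)"
proof (unfold sigma_algebra_iff2, intro conjI ballI allI impI)
  fix A assume A: "A \<in> tree_sets T"
  have "{s\<in>open_edge T e. Inner e s \<in> points T - A} \<in> sets lebesgue" if e: "e \<in> edges T" for e
  proof -
    have "{s\<in>open_edge T e. Inner e s \<in> points T - A} =
        open_edge T e - {s\<in>open_edge T e. Inner e s \<in> A}"
      using e by (auto simp: points_def open_edge_def)
    moreover have "open_edge T e \<in> sets lebesgue" by (simp add: open_edge_def)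
    ultimately show ?thesis using A e by (simp add: tree_sets_def sets.Diff)
  qed
  then show "points T - A \<in> tree_sets T" by (auto simp: tree_sets_def)
next
  fix A :: "nat \<Rightarrow> ('a, 'b) point set" assume A: "range A \<subseteq> tree_sets T"
  have "{s\<in>open_edge T e. Inner e s \<in> (\<Union>i. A i)} \<in> sets lebesgue" if e: "e \<in> edges T" for e
  proof -
    have "{s\<in>open_edge T e. Inner e s \<in> (\<Union>i. A i)} = (\<Union>i. {s\<in>open_edge T e. Inner e s \<in> A i})"
      by auto
    moreover have "{s\<in>open_edge T e. Inner e s \<in> A i} \<in> sets lebesgue" for i
      using A e by (auto simp: tree_sets_def subset_iff)
    ultimately show ?thesis by (simp add: sets.countable_UN)
  qed
  then show "(\<Union>i. A i) \<in> tree_sets T" using A by (auto simp: tree_sets_def)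
qed (auto simp: tree_sets_def)

lemma space_tree_measure: "space (tree_measure T) = points T"
  and sets_tree_measure: "sets (tree_measure T) = tree_sets T"
  unfolding tree_measure_def
  by (rule sigma_algebra.space_measure_of_eq[OF sigma_algebra_tree_sets]
    sigma_algebra.sets_measure_of_eq[OF sigma_algebra_tree_sets])+

lemma emeasure_tree_measure:
  assumes A: "A \<in> tree_sets T"
  shows "emeasure (tree_measure T) A =
    (\<integral>\<^sup>+ e. emeasure lebesgue {s\<in>open_edge T e. Inner e s \<in> A} \<partial>count_space (edges T))"
  unfolding tree_measure_def
proof (rule emeasure_measure_of_sigma[OF sigma_algebra_tree_sets _ _ A])
  show "positive (tree_sets T)
     (\<lambda>A. \<integral>\<^sup>+ e. emeasure lebesgue {s\<in>open_edge T e. Inner e s \<in> A} \<partial>count_space (edges T))"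
    by (simp add: positive_def)
  show "countably_additive (tree_sets T)
     (\<lambda>A. \<integral>\<^sup>+ e. emeasure lebesgue {s\<in>open_edge T e. Inner e s \<in> A} \<partial>count_space (edges T))"
  proof (rule countably_additiveI)
    fix A :: "nat \<Rightarrow> ('a, 'b) point set"
    assume A: "range A \<subseteq> tree_sets T" and disj: "disjoint_family A"
    have *: "emeasure lebesgue {s\<in>open_edge T e. Inner e s \<in> (\<Union>i. A i)} =
        (\<Sum>i. emeasure lebesgue {s\<in>open_edge T e. Inner e s \<in> A i})" if e: "e \<in> edges T" for e
    proof -
      have "{s\<in>open_edge T e. Inner e s \<in> (\<Union>i. A i)} =
          (\<Union>i. {s\<in>open_edge T e. Inner e s \<in> A i})" by auto
      moreover have "range (\<lambda>i. {s\<in>open_edge T e. Inner e s \<in> A i}) \<subseteq> sets lebesgue"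
        using A e by (auto simp: tree_sets_def subset_iff)
      moreover have "disjoint_family (\<lambda>i. {s\<in>open_edge T e. Inner e s \<in> A i})"
        using disj by (auto simp: disjoint_family_on_def)
      ultimately show ?thesis by (simp only: suminf_emeasure)
    qed
    have "(\<Sum>i. \<integral>\<^sup>+ e. emeasure lebesgue {s\<in>open_edge T e. Inner e s \<in> A i} \<partial>count_space (edges T))
       = (\<integral>\<^sup>+ e. (\<Sum>i. emeasure lebesgue {s\<in>open_edge T e. Inner e s \<in> A i}) \<partial>count_space (edges T))"
      by (rule nn_integral_suminf[symmetric]) simp
    also have "\<dots> = (\<integral>\<^sup>+ e. emeasure lebesgue {s\<in>open_edge T e. Inner e s \<in> (\<Union>i. A i)}
        \<partial>count_space (edges T))"
      by (rule nn_integral_cong) (simp only: * space_count_space)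
    finally show "(\<Sum>i. \<integral>\<^sup>+ e. emeasure lebesgue {s\<in>open_edge T e. Inner e s \<in> A i}
        \<partial>count_space (edges T)) =
      (\<integral>\<^sup>+ e. emeasure lebesgue {s\<in>open_edge T e. Inner e s \<in> (\<Union>i. A i)} \<partial>count_space (edges T))" .
  qed
qed

section \<open>Function spaces\<close>

definition L2 :: "'a measure \<Rightarrow> ('a \<Rightarrow> real) set" where
  "L2 M = {f \<in> borel_measurable M. integrable M (\<lambda>x. (f x)\<^sup>2)}"

definition L2_norm :: "'a measure \<Rightarrow> ('a \<Rightarrow> real) \<Rightarrow> real" where
  "L2_norm M f = sqrt (\<integral>x. (f x)\<^sup>2 \<partial>M)"

definition L2_continuous_on :: "'a measure \<Rightarrow> real set \<Rightarrow> (real \<Rightarrow> 'a \<Rightarrow> real) \<Rightarrow> bool" where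
  "L2_continuous_on M J u \<longleftrightarrow>
     (\<forall>t\<in>J. u t \<in> L2 M \<and>
        ((\<lambda>s. L2_norm M (\<lambda>x. u s x - u t x)) \<longlongrightarrow> 0) (at t within J))"

text \<open>
  \<open>u'\<close> is the derivative of the curve \<open>u\<close> in \<open>L2 M\<close>, and \<open>u\<close> is continuously differentiable. Only
  used for open \<open>J\<close>.
\<close>

definition L2_C1_deriv ::
  "'a measure \<Rightarrow> real set \<Rightarrow> (real \<Rightarrow> 'a \<Rightarrow> real) \<Rightarrow> (real \<Rightarrow> 'a \<Rightarrow> real) \<Rightarrow> bool" where
  "L2_C1_deriv M J u u' \<longleftrightarrow>
     (\<forall>t\<in>J. u t \<in> L2 M) \<and> L2_continuous_on M J u' \<and>
     (\<forall>t\<in>J. ((\<lambda>s. L2_norm M (\<lambda>x. (u s x - u t x) / (s - t) - u' t x)) \<longlongrightarrow> 0)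
        (at t within J))"

text \<open>For an open set \<open>U\<close>.\<close>

definition smooth_on :: "real set \<Rightarrow> (real \<Rightarrow> real) \<Rightarrow> bool" where
  "smooth_on U f \<longleftrightarrow> (\<forall>n. \<forall>x\<in>U. (deriv ^^ n) f differentiable (at x))"

definition C1_on :: "real set \<Rightarrow> (real \<Rightarrow> real) \<Rightarrow> bool" where
  "C1_on S f \<longleftrightarrow>
     (\<exists>f'. continuous_on S f' \<and> (\<forall>x\<in>S. (f has_real_derivative f' x) (at x within S)))"

definition test_functions :: "real set \<Rightarrow> (real \<Rightarrow> real) set" where
  "test_functions I =
     {\<phi>. smooth_on UNIV \<phi> \<and> (\<exists>K. compact K \<and> K \<subseteq> I \<and> (\<forall>x. x \<notin> K \<longrightarrow> \<phi> x = 0))}"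

definition locally_integrable :: "real set \<Rightarrow> (real \<Rightarrow> real) \<Rightarrow> bool" where
  "locally_integrable I f \<longleftrightarrow> (\<forall>K. compact K \<and> K \<subseteq> I \<longrightarrow> set_integrable lebesgue K f)"

definition has_weak_deriv :: "real set \<Rightarrow> (real \<Rightarrow> real) \<Rightarrow> (real \<Rightarrow> real) \<Rightarrow> bool" where
  "has_weak_deriv I f g \<longleftrightarrow>
     locally_integrable I f \<and> locally_integrable I g \<and>
     (\<forall>\<phi>\<in>test_functions I.
        (LINT x:I|lebesgue. f x * deriv \<phi> x) = - (LINT x:I|lebesgue. g x * \<phi> x))"

text \<open>Some representative of the weak derivative, which is unique up to null subsets of \<open>I\<close>.\<close>

definition weak_deriv :: "real set \<Rightarrow> (real \<Rightarrow> real) \<Rightarrow> real \<Rightarrow> real" where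
  "weak_deriv I f = (SOME g. has_weak_deriv I f g)"

definition H1_interval :: "real set \<Rightarrow> (real \<Rightarrow> real) set" where
  "H1_interval I =
     {f \<in> L2 (lebesgue_on I). (\<exists>g. has_weak_deriv I f g) \<and> weak_deriv I f \<in> L2 (lebesgue_on I)}"

definition H2_interval :: "real set \<Rightarrow> (real \<Rightarrow> real) set" where
  "H2_interval I = {f \<in> H1_interval I. weak_deriv I f \<in> H1_interval I}"

section \<open>The Neumann Laplacian\<close>

definition edge_restriction ::
  "('v, 'e) metric_graph \<Rightarrow> (('v, 'e) point \<Rightarrow> real) \<Rightarrow> 'e \<Rightarrow> real \<Rightarrow> real" where
  "edge_restriction T f e s = f (edge_point T e s)"

text \<open>Vertices form a null set, so the values of the derivatives there are immaterial.\<close>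

fun tree_deriv ::
  "('v, 'e) metric_graph \<Rightarrow> (('v, 'e) point \<Rightarrow> real) \<Rightarrow> ('v, 'e) point \<Rightarrow> real" where
  "tree_deriv T f (Inner e s) = weak_deriv (open_edge T e) (edge_restriction T f e) s"
| "tree_deriv T f (Vertex v) = 0"

definition H1_tree :: "('v, 'e) metric_graph \<Rightarrow> (('v, 'e) point \<Rightarrow> real) set" where
  "H1_tree T =
     {f \<in> L2 (tree_measure T). continuous_on_tree T f \<and>
        (\<forall>e\<in>edges T. \<exists>g. has_weak_deriv (open_edge T e) (edge_restriction T f e) g) \<and>
        tree_deriv T f \<in> L2 (tree_measure T)}"

definition edge_deriv2 ::
  "('v, 'e) metric_graph \<Rightarrow> (('v, 'e) point \<Rightarrow> real) \<Rightarrow> 'e \<Rightarrow> real \<Rightarrow> real" where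
  "edge_deriv2 T f e =
     weak_deriv (open_edge T e) (weak_deriv (open_edge T e) (edge_restriction T f e))"

text \<open>
  Outer derivative at an end \<open>v\<close> of \<open>e\<close>, as a one-sided classical derivative. It exists for every
  \<open>f\<close> that is continuous on the closed edge and belongs to \<open>H2\<close> of the open edge.
\<close>

definition outer_deriv ::
  "('v, 'e) metric_graph \<Rightarrow> (('v, 'e) point \<Rightarrow> real) \<Rightarrow> 'e \<Rightarrow> 'v \<Rightarrow> real" where
  "outer_deriv T f e v =
     (if v = dst T e
      then vector_derivative (edge_restriction T f e) (at (len T e) within {0..len T e})
      else - vector_derivative (edge_restriction T f e) (at 0 within {0..len T e}))"

definition laplacian_domain :: "('v, 'e) metric_graph \<Rightarrow> (('v, 'e) point \<Rightarrow> real) set" where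
  "laplacian_domain T =
     {f \<in> H1_tree T.
        (\<forall>e\<in>edges T. edge_restriction T f e \<in> H2_interval (open_edge T e)) \<and>
        (\<lambda>e. LINT s:open_edge T e|lebesgue. (edge_deriv2 T f e s)\<^sup>2) summable_on edges T \<and>
        (\<forall>v\<in>verts T. (\<Sum>e | e \<in> edges T \<and> v \<in> {src T e, dst T e}. outer_deriv T f e v) = 0)}"

fun laplacian ::
  "('v, 'e) metric_graph \<Rightarrow> (('v, 'e) point \<Rightarrow> real) \<Rightarrow> ('v, 'e) point \<Rightarrow> real" where
  "laplacian T f (Inner e s) = edge_deriv2 T f e s"
| "laplacian T f (Vertex v) = 0"

section \<open>The semilinear heat equation\<close>

definition is_solution ::
  "('v, 'e) metric_graph \<Rightarrow> (real \<Rightarrow> real) \<Rightarrow> (('v, 'e) point \<Rightarrow> real) \<Rightarrow>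
   (real \<Rightarrow> ('v, 'e) point \<Rightarrow> real) \<Rightarrow> bool" where
  "is_solution T f u0 u \<longleftrightarrow>
     L2_continuous_on (tree_measure T) {0..} u \<and>
     (\<forall>t\<ge>0. AE x in tree_measure T. 0 \<le> u t x \<and> u t x \<le> 1) \<and>
     (\<forall>t>0. u t \<in> laplacian_domain T) \<and>
     L2_continuous_on (tree_measure T) {0<..} (\<lambda>t. laplacian T (u t)) \<and>
     (\<exists>u'. L2_C1_deriv (tree_measure T) {0<..} u u' \<and>
        (\<forall>t>0. AE x in tree_measure T. u' t x = laplacian T (u t) x + f (u t x))) \<and>
     (AE x in tree_measure T. u 0 x = u0 x)"

subsection \<open>The bound on the initial datum\<close>

definition kappa :: "(nat \<Rightarrow> nat) \<Rightarrow> (nat \<Rightarrow> real) \<Rightarrow> nat \<Rightarrow> real" where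
  "kappa b r n =
     (1 / sqrt (\<Prod>i\<le>n-2. real (b i)) - 1 / sqrt (\<Prod>i\<le>n. real (b i))) / (r n - r (n-1))"

definition m_piece :: "(nat \<Rightarrow> nat) \<Rightarrow> (nat \<Rightarrow> real) \<Rightarrow> nat \<Rightarrow> real \<Rightarrow> real" where
  "m_piece b r n \<rho> =
     (if n \<le> 1 then 1
      else 1 / sqrt (\<Prod>i\<le>n-1. real (b i)) *
        (1 / sqrt (\<Prod>i\<le>n-2. real (b i)) - kappa b r n * (\<rho> - r (n-1))))"

text \<open>The sum starts at the piece with index \<open>1\<close>; at most one summand is nonzero.\<close>

definition m_bound :: "(nat \<Rightarrow> nat) \<Rightarrow> (nat \<Rightarrow> real) \<Rightarrow> real \<Rightarrow> real" where
  "m_bound b r \<rho> = (\<Sum>n. m_piece b r (Suc n) \<rho> * indicator {r n<..<r (Suc n)} \<rho>)"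

end

theory Submission
  imports Defs "HOL-Computational_Algebra.Polynomial"
begin

text \<open>
  Put \<open>q = b 1\<close>. The solution is compared with \<open>exp (M * t) * S x\<close>, where \<open>S\<close> is continuous on the
  tree, affine on every edge, equal to \<open>1\<close> at the base and to \<open>q^(1 - n)\<close> at the vertices of generation
  \<open>n \<ge> 1\<close>. Passing a vertex away from the base, the slope of \<open>S\<close> shrinks at most by the factor \<open>q\<close>, since
  the edges do not get longer, while the number of edges grows at least by this factor. Hence
  \<open>S\<close> is superharmonic in the sense of the Kirchhoff condition (\<open>geometric_superharmonic\<close>). As
  \<open>f u \<le> M * u\<close>, the comparison function is a supersolution. It dominates the initial datum
  (\<open>m_bound_le\<close>), and therefore the solution (\<open>solution_bound\<close>). Every edge has length at most
  \<open>r 1\<close>, so that \<open>S x \<le> q\<^sup>2 * exp (- (ln q / r 1) * depth x)\<close> (\<open>geometric_decay\<close>). At distance \<open>c * t\<close> the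
  solution thus decays exponentially in time if \<open>c > M * r 1 / ln q\<close>, and \<open>ln q \<ge> 1 - 1 / q\<close> shows that this
  holds for the speeds in question.

  The comparison principle rests on an energy argument. With \<open>v = exp (- M * t) * u\<close> and a shift of
  \<open>S\<close> by \<open>\<epsilon> > 0\<close>, the integral of \<open>(max 0 (v - S - \<epsilon>))^3\<close> vanishes at time zero, and its time derivative is at
  most \<open>3 \<integral> (max 0 (v - S - \<epsilon>))\<^sup>2 * \<Delta> v\<close>. This is nonpositive (\<open>laplacian_excess_nonpos\<close>): on each edge
  integrate by parts, then collect the boundary terms at the vertices, where the Kirchhoff condition
  for \<open>v\<close> and the superharmonicity of \<open>S\<close> decide the sign. Neither \<open>S\<close> nor its derivative is square
  integrable in general, and the sum over all vertices could diverge. The shift by \<open>\<epsilon>\<close> resolves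
  this: functions in \<open>H1\<close> of a tree of infinite height decay at infinity (\<open>H1_decay\<close>), so the excess is
  supported on finitely many edges at each time.

  Two kinds of preparation are needed. Edgewise \<open>H2\<close> regularity is defined by weak derivatives and has
  to be turned into classical differentiability up to the ends of the edge (\<open>edge_C1\<close>). And the
  description of a regular tree by generations has to be turned into the local picture at a
  vertex, with a unique edge towards the base and equal edges away from it (\<open>joins_gen\<close>,
  \<open>parents_unique\<close>).
\<close>

section \<open>Smooth cut-off functions\<close>

definition deriv_closed :: "(real \<Rightarrow> real) set \<Rightarrow> bool" where
  "deriv_closed S \<longleftrightarrow> (\<forall>g\<in>S. \<exists>g'\<in>S. \<forall>x. (g has_real_derivative g' x) (at x))"

text \<open>
  Iterated derivatives never have to be computed: a class of functions that is stable under
  differentiation consists of smooth functions.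
\<close>

lemma smooth_on_deriv_closed:
  assumes "deriv_closed S" "f \<in> S"
  shows "smooth_on UNIV f"
proof -
  have "(deriv ^^ n) f \<in> S" for n
  proof (induction n)
    case (Suc n)
    then obtain g' where g': "g' \<in> S" "\<forall>x. ((deriv ^^ n) f has_real_derivative g' x) (at x)"
      using assms(1) unfolding deriv_closed_def by blast
    then have "deriv ((deriv ^^ n) f) = g'" by (auto intro!: DERIV_imp_deriv)
    then show ?case using g' by simp
  qed (use assms in simp)
  then show ?thesis unfolding smooth_on_def
    using assms(1) unfolding deriv_closed_def unfolding real_differentiable_def by blast
qed

inductive_set additive_span :: "(real \<Rightarrow> real) set \<Rightarrow> (real \<Rightarrow> real) set" for B where
  additive_span_base: "g \<in> B \<Longrightarrow> g \<in> additive_span B"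
| additive_span_zero: "(\<lambda>x. 0) \<in> additive_span B"
| additive_span_add: "g \<in> additive_span B \<Longrightarrow> h \<in> additive_span B \<Longrightarrow> (\<lambda>x. g x + h x) \<in> additive_span B"

lemma additive_span_sum:
  assumes "\<And>i. i \<in> I \<Longrightarrow> F i \<in> additive_span B"
  shows "(\<lambda>x. \<Sum>i\<in>I. F i x) \<in> additive_span B"
  using assms by (induction I rule: infinite_finite_induct) (auto intro: additive_span.intros)

lemma deriv_closed_additive_span:
  assumes "\<And>g. g \<in> B \<Longrightarrow> \<exists>g'\<in>additive_span B. \<forall>x. (g has_real_derivative g' x) (at x)"
  shows "deriv_closed (additive_span B)"
  unfolding deriv_closed_def
proof
  fix g assume "g \<in> additive_span B"
  then show "\<exists>g'\<in>additive_span B. \<forall>x. (g has_real_derivative g' x) (at x)"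
  proof induction
    case (additive_span_base g) then show ?case using assms by blast
  next
    case additive_span_zero
    show ?case by (rule bexI[of _ "\<lambda>x. 0"]) (auto intro: additive_span.intros)
  next
    case (additive_span_add g h)
    then obtain g' h' where "g' \<in> additive_span B" "h' \<in> additive_span B"
      "\<forall>x. (g has_real_derivative g' x) (at x)" "\<forall>x. (h has_real_derivative h' x) (at x)" by blast
    then show ?case by (intro bexI[of _ "\<lambda>x. g' x + h' x"]) (auto intro: additive_span.intros DERIV_add)
  qed
qed

text \<open>
  The functions that occur among the iterated derivatives of the standard flat function, which
  is \<open>flat 1\<close>.
\<close>

definition flat :: "real poly \<Rightarrow> real \<Rightarrow> real" where
  "flat p x = (if x > 0 then poly p (1 / x) * exp (- (1 / x)) else 0)"

lemma poly_div_exp_tendsto_0: "((\<lambda>y. poly p y / exp y) \<longlongrightarrow> (0::real)) at_top"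
proof -
  have "((\<lambda>y. \<Sum>i\<le>degree p. coeff p i * (y ^ i / exp y)) \<longlongrightarrow> (0::real)) at_top"
    by (intro tendsto_null_sum tendsto_mult_right_zero tendsto_power_div_exp_0)
  then show ?thesis by (simp add: poly_altdef sum_divide_distrib)
qed

text \<open>
  All derivatives vanish at the origin, since with \<open>y = 1 / x\<close> the difference quotient is a
  polynomial in \<open>y\<close> divided by \<open>exp y\<close>.
\<close>

lemma flat_deriv_0: "(flat p has_real_derivative 0) (at 0)"
proof -
  have "((\<lambda>y. poly (pCons 0 p) y / exp y) \<longlongrightarrow> (0::real)) at_top"
    by (rule poly_div_exp_tendsto_0)
  then have "((\<lambda>h. poly (pCons 0 p) (inverse h) / exp (inverse h)) \<longlongrightarrow> (0::real)) (at_right 0)"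
    by (rule filterlim_compose[OF _ filterlim_inverse_at_top_right])
  moreover have "\<forall>\<^sub>F h in at_right (0::real).
      poly (pCons 0 p) (inverse h) / exp (inverse h) = (flat p (0 + h) - flat p 0) / h"
    by (rule eventually_at_right_less[THEN eventually_mono])
      (auto simp: flat_def field_simps exp_minus)
  ultimately have "((\<lambda>h. (flat p (0 + h) - flat p 0) / h) \<longlongrightarrow> 0) (at_right 0)"
    by (blast intro: Lim_transform_eventually)
  moreover have "((\<lambda>h. (flat p (0 + h) - flat p 0) / h) \<longlongrightarrow> 0) (at_left 0)"
    by (rule tendsto_eventually, rule eventually_at_leftI[of "-1"]) (auto simp: flat_def)
  ultimately show ?thesis unfolding DERIV_def by (rule filterlim_split_at[rotated])
qed

lemma flat_deriv: "(flat p has_real_derivative flat (pCons 0 (pCons 0 (p - pderiv p))) x) (at x)"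
proof -
  let ?q = "pCons 0 (pCons 0 (p - pderiv p))"
  consider "x > 0" | "x < 0" | "x = 0" by linarith
  then show ?thesis
  proof cases
    case 1
    have "((\<lambda>x. poly p (1 / x) * exp (- (1 / x))) has_real_derivative flat ?q x) (at x)"
      using 1 by (auto intro!: derivative_eq_intros poly_DERIV DERIV_chain'[where g = "poly p"] simp: flat_def divide_simps power2_eq_square)
         (simp add: algebra_simps)
    then show ?thesis
      by (rule DERIV_cong_ev[OF refl _ refl, THEN iffD1, rotated])
        (rule eventually_mono[OF eventually_nhds_in_open[of "{0<..}"]], use 1 in \<open>auto simp: flat_def\<close>)
  next
    case 2
    have "((\<lambda>x. 0) has_real_derivative flat ?q x) (at x)"
      using 2 by (auto simp: flat_def)
    then show ?thesis
      by (rule DERIV_cong_ev[OF refl _ refl, THEN iffD1, rotated])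
        (rule eventually_mono[OF eventually_nhds_in_open[of "{..<0}"]], use 2 in \<open>auto simp: flat_def\<close>)
  next
    case 3
    then show ?thesis using flat_deriv_0[of p] by (simp add: flat_def)
  qed
qed

lemma antiderivative_from_zero:
  fixes g :: "real \<Rightarrow> real"
  assumes "continuous_on UNIV g" and "\<And>x. x \<le> 0 \<Longrightarrow> g x = 0"
  obtains G where "\<And>x. (G has_real_derivative g x) (at x)" "\<And>x. x \<le> 0 \<Longrightarrow> G x = 0"
proof
  let ?G = "\<lambda>x. integral {-1..x} g"
  show z: "?G x = 0" if "x \<le> 0" for x
  proof -
    have "?G x = integral {-1..x} (\<lambda>x. 0)" by (rule integral_cong) (use assms that in auto)
    then show ?thesis by simp
  qed
  show "(?G has_real_derivative g x) (at x)" for x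
  proof (cases "x < 0")
    case True
    have "((\<lambda>x. 0) has_real_derivative g x) (at x)" using True assms by simp
    then show ?thesis
      by (rule DERIV_cong_ev[OF refl _ refl, THEN iffD1, rotated])
        (rule eventually_mono[OF eventually_nhds_in_open[of "{..<0}"]], use True z in auto)
  next
    case False
    have "(?G has_real_derivative g x) (at x within {-1..x+1})"
      by (rule integral_has_real_derivative) (use False assms in \<open>auto intro: continuous_on_subset\<close>)
    then show ?thesis using False by (subst (asm) at_within_interior) (auto simp: interior_atLeastAtMost_real)
  qed
qed

text \<open>
  A smooth bump \<open>\<eta>\<close> of mass one on the unit interval with its first two primitives. As \<open>k\<close> grows,
  \<open>k * \<eta> (k * x)\<close>, \<open>H (k * x)\<close> and \<open>K (k * x) / k\<close> approximate the Dirac mass, the Heaviside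
  function and the positive part of \<open>x\<close>. Smoothness is needed for the linear combinations of
  translates of \<open>K\<close>, which provide the test functions.
\<close>

locale mollifier =
  fixes \<eta> H K :: "real \<Rightarrow> real"
  assumes smooth_K: "\<And>(\<alpha>::nat \<Rightarrow> real) a k n. smooth_on UNIV (\<lambda>x. \<Sum>i<n. \<alpha> i * K (k * (x - a i)))"
    and DERIV_K: "\<And>x. (K has_real_derivative H x) (at x)"
    and DERIV_H: "\<And>x. (H has_real_derivative \<eta> x) (at x)"
    and cont_\<eta>: "continuous_on UNIV \<eta>"
    and \<eta>_nonneg: "\<And>x. \<eta> x \<ge> 0"
    and \<eta>_zero: "\<And>x. x \<le> 0 \<or> x \<ge> 1 \<Longrightarrow> \<eta> x = 0"
    and H_zero: "\<And>x. x \<le> 0 \<Longrightarrow> H x = 0"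
    and H_one: "\<And>x. x \<ge> 1 \<Longrightarrow> H x = 1"
    and K_zero: "\<And>x. x \<le> 0 \<Longrightarrow> K x = 0"
    and K_affine: "\<And>x. x \<ge> 1 \<Longrightarrow> K x = K 1 + (x - 1)"
    and K_near: "\<And>x. \<bar>K x - max 0 x\<bar> \<le> 1"

text \<open>
  The bump is the product of a flat function and its reflection. The products of this kind are
  stable under differentiation by the Leibniz rule, and so are the combinations of rescaled
  copies once the two primitives are included.
\<close>

lemma mollifier_exists: "\<exists>\<eta> H K. mollifier \<eta> H K"
proof -
  define B where "B = {\<lambda>x. c * flat p x * flat p' (1 - x) |c p p'. True}"
  have Bcl: "deriv_closed (additive_span B)"
  proof (rule deriv_closed_additive_span)
    fix g assume "g \<in> B"
    then obtain c p p' where g: "g = (\<lambda>x. c * flat p x * flat p' (1 - x))" by (auto simp: B_def)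
    let ?d = "\<lambda>p. pCons 0 (pCons 0 (p - pderiv p))"
    have "(\<lambda>x. c * flat (?d p) x * flat p' (1 - x) + (-c) * flat p x * flat (?d p') (1 - x)) \<in> additive_span B"
      by (rule additive_span_add; rule additive_span_base; unfold B_def; blast)
    moreover have "(g has_real_derivative c * flat (?d p) x * flat p' (1 - x) + (-c) * flat p x * flat (?d p') (1 - x)) (at x)" for x
    proof -
      have "((\<lambda>x. flat p' (1 - x)) has_real_derivative flat (?d p') (1 - x) * (-1)) (at x)"
        by (rule DERIV_chain2[OF flat_deriv]) (auto intro!: derivative_eq_intros)
      from DERIV_mult[OF DERIV_cmult[OF flat_deriv[of p x], of c] this]
      show ?thesis unfolding g by (rule DERIV_cong) simp
    qed
    ultimately show "\<exists>g'\<in>additive_span B. \<forall>x. (g has_real_derivative g' x) (at x)" by (intro bexI allI)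
  qed
  define \<eta>0 where "\<eta>0 = (\<lambda>x. 1 * flat 1 x * flat 1 (1 - x))"
  have \<eta>0: "\<eta>0 \<in> additive_span B" unfolding \<eta>0_def B_def by (rule additive_span_base) blast
  have cont0: "continuous_on UNIV \<eta>0"
    using Bcl \<eta>0 unfolding deriv_closed_def by (meson DERIV_continuous_on has_field_derivative_at_within)
  have \<eta>0z: "\<eta>0 x = 0" if "x \<le> 0 \<or> x \<ge> 1" for x using that by (auto simp: \<eta>0_def flat_def)
  have \<eta>0p: "\<eta>0 x > 0" if "0 < x" "x < 1" for x using that by (auto simp: \<eta>0_def flat_def)
  have \<eta>0nn: "\<eta>0 x \<ge> 0" for x by (auto simp: \<eta>0_def flat_def)
  obtain H0 where H0: "\<And>x. (H0 has_real_derivative \<eta>0 x) (at x)" "\<And>x. x \<le> 0 \<Longrightarrow> H0 x = 0"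
    using antiderivative_from_zero[OF cont0] \<eta>0z by metis
  have "H0 0 < H0 1"
    by (rule DERIV_pos_imp_increasing_open[of 0 1])
      (use H0 \<eta>0p in \<open>auto intro: DERIV_continuous_on has_field_derivative_at_within\<close>)
  then have c0: "H0 1 > 0" using H0 by simp
  define \<eta> H where "\<eta> = (\<lambda>x. \<eta>0 x / H0 1)" and "H = (\<lambda>x. H0 x / H0 1)"
  have H: "(H has_real_derivative \<eta> x) (at x)" for x
    unfolding H_def \<eta>_def by (intro DERIV_cdivide H0)
  have Hz: "H x = 0" if "x \<le> 0" for x using that H0 by (simp add: H_def)
  have nn: "\<eta> x \<ge> 0" for x using \<eta>0nn c0 by (simp add: \<eta>_def)
  have \<eta>z: "\<eta> x = 0" if "x \<le> 0 \<or> x \<ge> 1" for x using \<eta>0z[OF that] by (simp add: \<eta>_def)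
  have H1: "H x = 1" if "x \<ge> 1" for x
  proof -
    have "H x = H 1" 
    proof (cases "x = 1")
      case False
      show ?thesis
      proof (rule DERIV_isconst2[of 1 x])
        show "(H has_real_derivative 0) (at y)" if "1 < y" "y < x" for y
          using H[of y] \<eta>z[of y] that by simp
        show "continuous_on {1..x} H"
          using H by (auto intro: DERIV_continuous_on has_field_derivative_at_within)
      qed (use that False in auto)
    qed auto
    then show ?thesis using c0 by (simp add: H_def)
  qed
  have Hmono: "H x \<le> H y" if "x \<le> y" for x y
    by (rule DERIV_nonneg_imp_nondecreasing[OF that]) (use H nn in blast)
  have H01: "0 \<le> H x \<and> H x \<le> 1" for x
    using Hmono[of x "max x 1"] Hmono[of "min x 0" x] Hz[of "min x 0"] H1[of "max x 1"] by simp
  have contH: "continuous_on UNIV H" using H by (auto intro: DERIV_continuous_on has_field_derivative_at_within)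
  obtain K where K: "\<And>x. (K has_real_derivative H x) (at x)" "\<And>x. x \<le> 0 \<Longrightarrow> K x = 0"
    using antiderivative_from_zero[OF contH] Hz by metis
  have K1: "K x = K 1 + (x - 1)" if "x \<ge> 1" for x
  proof (cases "x = 1")
    case False
    have "(\<lambda>x. K x - x) x = (\<lambda>x. K x - x) 1"
    proof (rule DERIV_isconst2[of 1 x])
      show "((\<lambda>x. K x - x) has_real_derivative 0) (at y)" if "1 < y" "y < x" for y
        using H1[of y] that K by (auto intro!: derivative_eq_intros)
      show "continuous_on {1..x} (\<lambda>x. K x - x)"
        using K by (intro continuous_intros) (auto intro: DERIV_continuous_on has_field_derivative_at_within)
    qed (use that False in auto)
    then show ?thesis by simp
  qed auto
  have Kbd: "0 \<le> K x \<and> K x \<le> x" if "0 \<le> x" for x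
  proof
    have "K 0 \<le> K x" by (rule DERIV_nonneg_imp_nondecreasing[OF that]) (use K H01 in blast)
    then show "0 \<le> K x" using K by simp
    have "(\<lambda>x. x - K x) 0 \<le> (\<lambda>x. x - K x) x"
      by (rule DERIV_nonneg_imp_nondecreasing[OF that])
       (use K H01 in \<open>auto intro!: derivative_eq_intros exI[of _ "1 - H _"]\<close>)
    then show "K x \<le> x" using K by simp
  qed
  have Kabs: "\<bar>K x - max 0 x\<bar> \<le> 1" for x
  proof -
    consider "x \<le> 0" | "0 \<le> x" "x \<le> 1" | "x \<ge> 1" by linarith
    then show ?thesis using Kbd[of x] Kbd[of 1] K1[of x] K(2)[of x] by cases auto
  qed
  define C where "C = {\<lambda>x. c * G (k * (x - a)) |c k a G. G \<in> insert K (insert H (additive_span B))}"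
  have Ccl: "deriv_closed (additive_span C)"
  proof (rule deriv_closed_additive_span)
    fix g assume "g \<in> C"
    then obtain c k a G where g: "g = (\<lambda>x. c * G (k * (x - a)))"
      and G: "G \<in> insert K (insert H (additive_span B))" by (auto simp: C_def)
    have "\<exists>m G'. G' \<in> insert K (insert H (additive_span B)) \<and> (\<forall>x. (G has_real_derivative m * G' x) (at x))"
    proof -
      consider "G = K" | "G = H" | "G \<in> additive_span B" using G by blast
      then show ?thesis
      proof cases
        case 1 then show ?thesis using K by (intro exI[of _ 1] exI[of _ H]) auto
      next
        case 2 then show ?thesis using H \<eta>0
          by (intro exI[of _ "1 / H0 1"] exI[of _ \<eta>0]) (auto simp: \<eta>_def)
      next
        case 3 then show ?thesis using Bcl unfolding deriv_closed_def by (metis insert_iff mult_1)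
      qed
    qed
    then obtain m G' where G': "G' \<in> insert K (insert H (additive_span B))"
      and d: "\<And>x. (G has_real_derivative m * G' x) (at x)" by blast
    have "(\<lambda>x. (c * m * k) * G' (k * (x - a))) \<in> additive_span C"
      by (rule additive_span_base) (use G' in \<open>auto simp: C_def\<close>)
    moreover have "(g has_real_derivative (c * m * k) * G' (k * (x - a))) (at x)" for x
    proof -
      have "((\<lambda>x. G (k * (x - a))) has_real_derivative (m * G' (k * (x - a))) * k) (at x)"
        by (rule DERIV_chain2[OF d]) (auto intro!: derivative_eq_intros)
      from DERIV_cmult[OF this, of c] show ?thesis unfolding g by (rule DERIV_cong) simp
    qed
    ultimately show "\<exists>g'\<in>additive_span C. \<forall>x. (g has_real_derivative g' x) (at x)" by (intro bexI allI)
  qed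
  have "mollifier \<eta> H K"
  proof (rule mollifier.intro)
    show "smooth_on UNIV (\<lambda>x. \<Sum>i<n. \<alpha> i * K (k * (x - a i)))"
      for \<alpha> :: "nat \<Rightarrow> real" and a k n
      by (rule smooth_on_deriv_closed[OF Ccl], rule additive_span_sum, rule additive_span_base) (force simp: C_def)
    show "continuous_on UNIV \<eta>" unfolding \<eta>_def using cont0 c0 by (intro continuous_intros) auto
  qed (fact K H Hz H1 nn K1 Kabs | use \<eta>z in blast)+
  then show ?thesis by blast
qed

section \<open>From weak derivatives to point values\<close>

lemma eventually_inverse_less: "h > 0 \<Longrightarrow> \<forall>\<^sub>F k in at_top. 1 / k < (h::real)"
  using order_tendstoD(2)[OF tendsto_divide_0[OF tendsto_const filterlim_at_top_imp_at_infinity[OF filterlim_ident]], of h 1]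
  by simp

context mollifier
begin

text \<open>
  Near the point \<open>c\<close> the integrand lives on an interval of length \<open>1 / k\<close> inside the open edge,
  where \<open>f\<close> is continuous and bounded.
\<close>

lemma mollify_set_integrable:
  assumes f: "continuous_on {0<..<l} f" and c: "0 < c" "c + 1 / k < l" and k: "k > 0"
  shows "set_integrable lebesgue {0<..<l} (\<lambda>x. f x * (k * \<eta> (k * (x - c))))"
    and "(LINT x:{0<..<l}|lebesgue. f x * (k * \<eta> (k * (x - c))))
       = integral {c..c + 1 / k} (\<lambda>x. f x * (k * \<eta> (k * (x - c))))"
proof -
  let ?g = "\<lambda>x. f x * (k * \<eta> (k * (x - c)))"
  have sub: "{c..c + 1 / k} \<subseteq> {0<..<l}" using c k by auto
  have z: "?g x = 0" if "x \<notin> {c..c + 1 / k}" for x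
  proof -
    have "k * (x - c) \<le> 0 \<or> k * (x - c) \<ge> 1" using that k by (auto simp: field_simps mult_le_0_iff)
    then show ?thesis using \<eta>_zero by simp
  qed
  have "continuous_on {c..c + 1 / k} ?g"
    by (intro continuous_intros continuous_on_subset[OF f sub]
        continuous_on_compose2[OF cont_\<eta>]) auto
  then have i: "set_integrable lebesgue {c..c + 1 / k} ?g"
    using absolutely_integrable_continuous_real by blast
  have eq: "indicator {0<..<l} x *\<^sub>R ?g x = indicator {c..c + 1 / k} x *\<^sub>R ?g x" for x
    using z[of x] sub by (auto simp: indicator_def)
  show "set_integrable lebesgue {0<..<l} ?g"
    using i unfolding set_integrable_def eq .
  show "(LINT x:{0<..<l}|lebesgue. ?g x) = integral {c..c + 1 / k} ?g"
    using set_lebesgue_integral_eq_integral(2)[OF i] unfolding set_lebesgue_integral_def eq .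
qed

lemma mollify_tendsto:
  assumes f: "continuous_on {0<..<l} f" and c: "0 < c" "c < l"
  shows "((\<lambda>k. LINT x:{0<..<l}|lebesgue. f x * (k * \<eta> (k * (x - c)))) \<longlongrightarrow> f c) at_top"
proof (rule tendstoI)
  fix e :: real assume e: "e > 0"
  have "isCont f c"
    using f c by (simp add: continuous_on_eq_continuous_at)
  then obtain d where d: "d > 0" "\<And>x. \<bar>x - c\<bar> < d \<Longrightarrow> \<bar>f x - f c\<bar> < e / 2"
    unfolding continuous_at_eps_delta dist_real_def using e by (metis half_gt_zero)
  have "\<forall>\<^sub>F k in at_top. 1 / k < min d (l - c)"
    by (rule eventually_inverse_less) (use d c in auto)
  then show "\<forall>\<^sub>F k in at_top. dist (LINT x:{0<..<l}|lebesgue. f x * (k * \<eta> (k * (x - c)))) (f c) < e"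
    using eventually_gt_at_top[of 0]
  proof eventually_elim
    case (elim k)
    have k: "k > 0" "1 / k < d" "c + 1 / k < l" using elim by auto
    let ?J = "{c..c + 1 / k}"
    let ?p = "\<lambda>x. k * \<eta> (k * (x - c))"
    have le: "c \<le> c + 1 / k" using k by simp
    have sub: "?J \<subseteq> {0<..<l}" using c k by auto
    have contp: "continuous_on ?J ?p"
      by (intro continuous_intros continuous_on_compose2[OF cont_\<eta>]) auto
    have contf: "continuous_on ?J f" by (rule continuous_on_subset[OF f sub])
    have "((\<lambda>x. H (k * (x - c))) has_real_derivative \<eta> (k * (x - c)) * k) (at x)" for x
      by (rule DERIV_chain2[OF DERIV_H]) (auto intro!: derivative_eq_intros)
    then have "(?p has_integral (H (k * (c + 1 / k - c)) - H (k * (c - c)))) ?J"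
      by (intro fundamental_theorem_of_calculus[OF le])
        (auto simp: has_real_derivative_iff_has_vector_derivative[symmetric] mult.commute intro: has_field_derivative_at_within)
    then have hi: "(?p has_integral 1) ?J"
      using k H_zero[of 0] H_one[of 1] by simp
    have I1: "integral ?J ?p = 1" "?p integrable_on ?J"
      by (rule integral_unique[OF hi], rule has_integral_integrable[OF hi])
    have i1: "(\<lambda>x. f x * ?p x) integrable_on ?J" "(\<lambda>x. f c * ?p x) integrable_on ?J"
       "(\<lambda>x. (e / 2) * ?p x) integrable_on ?J"
      by (intro integrable_continuous_real continuous_intros contp contf)+
    have "integral ?J (\<lambda>x. f x * ?p x) - f c = integral ?J (\<lambda>x. f x * ?p x) - integral ?J (\<lambda>x. f c * ?p x)"
      using I1 by simp
    also have "\<dots> = integral ?J (\<lambda>x. f x * ?p x - f c * ?p x)"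
      by (rule integral_diff[symmetric, OF i1(1,2)])
    finally have "\<bar>integral ?J (\<lambda>x. f x * ?p x) - f c\<bar> = norm (integral ?J (\<lambda>x. f x * ?p x - f c * ?p x))"
      by simp
    also have "\<dots> \<le> integral ?J (\<lambda>x. (e / 2) * ?p x)"
    proof (rule integral_norm_bound_integral)
      show "(\<lambda>x. f x * ?p x - f c * ?p x) integrable_on ?J" by (rule integrable_diff[OF i1(1,2)])
      show "norm (f x * ?p x - f c * ?p x) \<le> (e / 2) * ?p x" if "x \<in> ?J" for x
      proof -
        have "\<bar>f x - f c\<bar> \<le> e / 2" using d(2)[of x] that k by auto
        moreover have "?p x \<ge> 0" using k \<eta>_nonneg by simp
        ultimately have "\<bar>f x - f c\<bar> * ?p x \<le> e / 2 * ?p x" by (intro mult_right_mono)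
        moreover have "norm (f x * ?p x - f c * ?p x) = \<bar>f x - f c\<bar> * ?p x"
          using \<open>?p x \<ge> 0\<close> by (metis abs_mult abs_of_nonneg left_diff_distrib real_norm_def)
        ultimately show ?thesis by simp
      qed
    qed (rule i1)
    also have "\<dots> = e / 2" using I1 by simp
    finally have "\<bar>integral ?J (\<lambda>x. f x * ?p x) - f c\<bar> < e" using e by linarith
    then show ?case using mollify_set_integrable(2)[OF f c(1) k(3,1)] by (simp add: dist_real_def)
  qed
qed

end

lemma deriv_test_function:
  assumes "\<phi> \<in> test_functions I"
  shows "deriv \<phi> \<in> test_functions I"
proof -
  obtain K where K: "compact K" "K \<subseteq> I" "\<And>x. x \<notin> K \<Longrightarrow> \<phi> x = 0" and s: "smooth_on UNIV \<phi>"
    using assms by (auto simp: test_functions_def)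
  have "deriv \<phi> x = 0" if x: "x \<notin> K" for x
  proof -
    have "open (- K)" using K(1) by (simp add: compact_imp_closed open_Compl)
    then have ev: "\<forall>\<^sub>F y in nhds x. 0 = \<phi> y" using x K(3) by (auto simp: eventually_nhds)
    have "((\<lambda>x. 0) has_real_derivative 0) (at x)" by simp
    then have "(\<phi> has_real_derivative 0) (at x)"
      by (rule DERIV_cong_ev[OF refl _ refl, THEN iffD1, rotated]) (rule ev)
    then show ?thesis by (rule DERIV_imp_deriv)
  qed
  moreover have "smooth_on UNIV (deriv \<phi>)"
    unfolding smooth_on_def
  proof (intro allI ballI)
    fix n x
    show "(deriv ^^ n) (deriv \<phi>) differentiable (at x)"
    proof -
      have "(deriv ^^ Suc n) \<phi> differentiable (at x)" using s unfolding smooth_on_def by blast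
      then show ?thesis by (simp only: funpow_Suc_right o_apply)
    qed
  qed
  ultimately show ?thesis using K by (auto simp: test_functions_def)
qed

text \<open>
  Dominated convergence for test functions that share a compact support: there \<open>g\<close> is integrable
  and serves as dominating function.
\<close>

lemma test_integral_tendsto:
  fixes \<phi> :: "real \<Rightarrow> real \<Rightarrow> real"
  assumes g: "locally_integrable I g" and J: "{c..d} \<subseteq> I" and I: "I \<in> sets lebesgue"
    and lim: "\<And>x. x \<in> {c..d} \<Longrightarrow> ((\<lambda>k. \<phi> k x) \<longlongrightarrow> \<psi> x) at_top"
    and bd: "\<And>k x. k \<ge> 1 \<Longrightarrow> x \<in> {c..d} \<Longrightarrow> \<bar>\<phi> k x\<bar> \<le> C"
    and out: "\<forall>\<^sub>F k in at_top. \<forall>x. x \<notin> {c..d} \<longrightarrow> \<phi> k x = 0" "\<And>x. x \<notin> {c..d} \<Longrightarrow> \<psi> x = 0"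
    and cont: "\<And>k. continuous_on UNIV (\<phi> k)" and \<psi>: "\<psi> \<in> borel_measurable borel"
  shows "((\<lambda>k. LINT x:I|lebesgue. g x * \<phi> k x) \<longlongrightarrow> (LINT x:I|lebesgue. g x * \<psi> x)) at_top"
proof -
  have gi: "set_integrable lebesgue {c..d} g"
    using g J unfolding locally_integrable_def by (metis compact_Icc)
  have eq: "(LINT x:I|lebesgue. g x * h x) = (\<integral>x. (indicator {c..d} x *\<^sub>R g x) * h x \<partial>lebesgue)"
    if "\<And>x. x \<notin> {c..d} \<Longrightarrow> h x = 0" for h
    unfolding set_lebesgue_integral_def
    by (rule Bochner_Integration.integral_cong) (use that J in \<open>auto simp: indicator_def\<close>)
  have gm: "(\<lambda>x. indicator {c..d} x *\<^sub>R g x) \<in> borel_measurable lebesgue"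
    using gi unfolding set_integrable_def by (rule borel_measurable_integrable)
  have leb: "h \<in> borel_measurable lebesgue" if "h \<in> borel_measurable borel" for h :: "real \<Rightarrow> real"
    using that by (simp add: measurable_completion)
  have "((\<lambda>k. \<integral>x. (indicator {c..d} x *\<^sub>R g x) * \<phi> k x \<partial>lebesgue)
      \<longlongrightarrow> (\<integral>x. (indicator {c..d} x *\<^sub>R g x) * \<psi> x \<partial>lebesgue)) at_top"
  proof (rule integral_dominated_convergence_at_top)
    show "(\<lambda>x. (indicator {c..d} x *\<^sub>R g x) * \<psi> x) \<in> borel_measurable lebesgue"
      using gm leb[OF \<psi>] by (rule borel_measurable_times)
    show "(\<lambda>x. (indicator {c..d} x *\<^sub>R g x) * \<phi> k x) \<in> borel_measurable lebesgue" for k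
      using gm leb[OF borel_measurable_continuous_onI[OF cont]] by (rule borel_measurable_times)
    show "integrable lebesgue (\<lambda>x. norm (indicator {c..d} x *\<^sub>R g x) * C)"
      using gi unfolding set_integrable_def by (intro integrable_mult_left) (rule integrable_norm)
    show "AE x in lebesgue. ((\<lambda>k. (indicator {c..d} x *\<^sub>R g x) * \<phi> k x) \<longlongrightarrow>
        (indicator {c..d} x *\<^sub>R g x) * \<psi> x) at_top"
      using lim by (intro AE_I2) (auto simp: indicator_def intro!: tendsto_intros)
    show "\<forall>\<^sub>F k in at_top. AE x in lebesgue. norm ((indicator {c..d} x *\<^sub>R g x) * \<phi> k x)
        \<le> norm (indicator {c..d} x *\<^sub>R g x) * C"
      using eventually_ge_at_top[of 1]
    proof eventually_elim
      case (elim k)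
      show ?case using bd[OF elim]
        by (intro AE_I2) (auto simp: indicator_def abs_mult intro!: mult_left_mono)
    qed
  qed
  moreover have "\<forall>\<^sub>F k in at_top. (\<integral>x. (indicator {c..d} x *\<^sub>R g x) * \<phi> k x \<partial>lebesgue) =
      (LINT x:I|lebesgue. g x * \<phi> k x)"
    using out(1) by eventually_elim (rule eq[symmetric], blast)
  moreover have "(LINT x:I|lebesgue. g x * \<psi> x) = (\<integral>x. (indicator {c..d} x *\<^sub>R g x) * \<psi> x \<partial>lebesgue)"
    by (rule eq) (rule out)
  ultimately show ?thesis by (simp only: Lim_transform_eventually)
qed

context mollifier
begin

lemma sum_mollify_tendsto:
  fixes \<alpha> a :: "nat \<Rightarrow> real"
  assumes f: "continuous_on {0<..<l} f" and a: "\<And>i. i < n \<Longrightarrow> 0 < a i \<and> a i \<le> d" and d: "d < l"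
  shows "((\<lambda>k. LINT x:{0<..<l}|lebesgue. f x * (\<Sum>i<n. \<alpha> i * (k * \<eta> (k * (x - a i)))))
    \<longlongrightarrow> (\<Sum>i<n. \<alpha> i * f (a i))) at_top"
proof -
  let ?F = "\<lambda>k. \<Sum>i<n. \<alpha> i * (LINT x:{0<..<l}|lebesgue. f x * (k * \<eta> (k * (x - a i))))"
  have "(?F \<longlongrightarrow> (\<Sum>i<n. \<alpha> i * f (a i))) at_top"
    by (intro tendsto_intros mollify_tendsto[OF f]) (use a d in \<open>force\<close>)+
  moreover have "\<forall>\<^sub>F k in at_top. ?F k =
      (LINT x:{0<..<l}|lebesgue. f x * (\<Sum>i<n. \<alpha> i * (k * \<eta> (k * (x - a i)))))"
  proof -
    have "\<forall>\<^sub>F k in at_top. 1 / k < l - d"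
      by (rule eventually_inverse_less) (use d in simp)
    then show ?thesis using eventually_gt_at_top[of 0]
    proof eventually_elim
      case (elim k)
      have "set_integrable lebesgue {0<..<l} (\<lambda>x. f x * (k * \<eta> (k * (x - a i))))" if "i < n" for i
        by (rule mollify_set_integrable(1)[OF f]) (use a[OF that] elim in auto)
      then have "(LINT x:{0<..<l}|lebesgue. (\<Sum>i<n. \<alpha> i * (f x * (k * \<eta> (k * (x - a i)))))) = ?F k"
        unfolding set_lebesgue_integral_def set_integrable_def scaleR_sum_right
        by (subst Bochner_Integration.integral_sum) (auto simp: mult.left_commute)
      then show ?case by (simp add: sum_distrib_left mult.left_commute)
    qed
  qed
  ultimately show ?thesis by (rule Lim_transform_eventually)
qed

lemma H_sum_deriv:
  fixes \<alpha> a :: "nat \<Rightarrow> real"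
  shows "((\<lambda>x. \<Sum>i<n. \<alpha> i * H (k * (x - a i))) has_real_derivative (\<Sum>i<n. \<alpha> i * (k * \<eta> (k * (x - a i))))) (at x)"
proof -
  have "((\<lambda>x. H (k * (x - c))) has_real_derivative \<eta> (k * (x - c)) * k) (at x)" for c
    by (rule DERIV_chain2[OF DERIV_H]) (auto intro!: derivative_eq_intros)
  then have "((\<lambda>x. \<Sum>i<n. \<alpha> i * H (k * (x - a i))) has_real_derivative (\<Sum>i<n. \<alpha> i * (\<eta> (k * (x - a i)) * k))) (at x)"
    by (intro DERIV_sum DERIV_cmult) 
  then show ?thesis by (simp add: mult.commute[of k])
qed

lemma K_sum_deriv:
  fixes \<alpha> a :: "nat \<Rightarrow> real"
  assumes "k > 0"
  shows "((\<lambda>x. \<Sum>i<n. (\<alpha> i / k) * K (k * (x - a i))) has_real_derivative (\<Sum>i<n. \<alpha> i * H (k * (x - a i)))) (at x)"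
proof -
  have "((\<lambda>x. K (k * (x - c))) has_real_derivative H (k * (x - c)) * k) (at x)" for c
    by (rule DERIV_chain2[OF DERIV_K]) (auto intro!: derivative_eq_intros)
  then have "((\<lambda>x. \<Sum>i<n. (\<alpha> i / k) * K (k * (x - a i))) has_real_derivative (\<Sum>i<n. (\<alpha> i / k) * (H (k * (x - a i)) * k))) (at x)"
    by (intro DERIV_sum DERIV_cmult) 
  then show ?thesis using assms by simp
qed

text \<open>
  Outside an interval that exceeds the nodes by \<open>1 / k\<close> on the right, the rescaled argument lies
  where the mollifier and its primitives are known explicitly.
\<close>

lemma mollify_args:
  fixes x :: real assumes "k > 0" "1 / k \<le> h - d" "c \<le> a" "a \<le> d" "x \<notin> {c..h}"
  shows "k * (x - a) \<le> 0 \<and> x < c \<or> k * (x - a) \<ge> 1 \<and> x > h"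
proof (cases "x < c")
  case True then show ?thesis using assms by (auto simp: mult_le_0_iff)
next
  case False
  then have "x - a \<ge> 1 / k" using assms by auto
  then have "k * (x - a) \<ge> 1" using assms(1) by (simp add: field_simps)
  then show ?thesis using False assms by auto
qed

text \<open>
  To the right of all nodes \<open>K\<close> is affine, so the sum vanishes there because the weights annihilate
  affine functions; to the left every summand is zero.
\<close>

lemma K_sum_outside:
  fixes \<alpha> a :: "nat \<Rightarrow> real"
  assumes "k > 0" "1 / k \<le> h - d" "\<And>i. i < n \<Longrightarrow> c \<le> a i \<and> a i \<le> d" "x \<notin> {c..h}"
    and "(\<Sum>i<n. \<alpha> i) = 0" "(\<Sum>i<n. \<alpha> i * a i) = 0"
  shows "(\<Sum>i<n. (\<alpha> i / k) * K (k * (x - a i))) = 0"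
proof (cases "x < c")
  case True
  have "K (k * (x - a i)) = 0" if "i < n" for i
    using True assms(1) assms(3)[OF that] by (intro K_zero) (auto simp: mult_le_0_iff)
  then show ?thesis by simp
next
  case False
  have *: "(\<alpha> i / k) * K (k * (x - a i)) = (\<alpha> i * ((K 1 - 1) / k + x) - \<alpha> i * a i)" if "i < n" for i
  proof -
    have "K (k * (x - a i)) = K 1 + (k * (x - a i) - 1)"
      using mollify_args[OF assms(1,2) _ _ assms(4), of "a i"] assms(3)[OF that] False K_affine by blast
    then have "(\<alpha> i / k) * K (k * (x - a i)) = (\<alpha> i / k) * (K 1 + (k * (x - a i) - 1))" by simp
    also have "\<dots> = \<alpha> i * ((K 1 - 1) / k + x) - \<alpha> i * a i"
      using assms(1) by (simp add: field_simps)
    finally show ?thesis .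
  qed
  have "(\<Sum>i<n. (\<alpha> i / k) * K (k * (x - a i))) = (\<Sum>i<n. \<alpha> i * ((K 1 - 1) / k + x) - \<alpha> i * a i)"
    by (rule sum.cong) (use * in auto)
  also have "\<dots> = (\<Sum>i<n. \<alpha> i) * ((K 1 - 1) / k + x) - (\<Sum>i<n. \<alpha> i * a i)"
    by (simp add: sum_subtractf sum_distrib_right)
  finally show ?thesis using assms(5,6) by simp
qed

lemma cont_K: "continuous_on UNIV K"
  using DERIV_K by (auto intro: DERIV_continuous_on has_field_derivative_at_within)

lemma K_sum_test:
  fixes \<alpha> a :: "nat \<Rightarrow> real"
  assumes "k > 0" "1 / k \<le> h - d" "\<And>i. i < n \<Longrightarrow> c \<le> a i \<and> a i \<le> d" "(\<Sum>i<n. \<alpha> i) = 0"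
   "(\<Sum>i<n. \<alpha> i * a i) = 0" "0 < c" "h < l"
  shows "(\<lambda>x. \<Sum>i<n. (\<alpha> i / k) * K (k * (x - a i))) \<in> test_functions {0<..<l}"
  unfolding test_functions_def
proof (intro CollectI conjI exI[of _ "{c..h}"] allI impI)
  show "{c..h} \<subseteq> {0<..<l}" using assms by auto
  show "(\<Sum>i<n. (\<alpha> i / k) * K (k * (x - a i))) = 0" if "x \<notin> {c..h}" for x
    by (rule K_sum_outside[OF assms(1-3) that assms(4,5)])
qed (use smooth_K[of "\<lambda>i. \<alpha> i / k"] in auto)

text \<open>
  A weak second derivative is tested against \<open>\<Sum>i<n. \<alpha> i * max 0 (x - a i)\<close>, a piecewise affine function of
  compact support with distributional second derivative \<open>\<Sum>i<n. \<alpha> i * \<delta>(a i)\<close>. This turns the weak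
  equation into a statement on point values of \<open>f\<close>. Smooth test functions are obtained by replacing
  the positive part by \<open>K (k * x) / k\<close>.
\<close>

lemma weak_deriv2_hat:
  fixes \<alpha> a :: "nat \<Rightarrow> real"
  assumes w: "has_weak_deriv {0<..<l} f p" "has_weak_deriv {0<..<l} p q" and f: "continuous_on {0<..<l} f"
    and a: "\<And>i. i < n \<Longrightarrow> c \<le> a i \<and> a i \<le> d" and cd: "0 < c" "d < l"
    and s: "(\<Sum>i<n. \<alpha> i) = 0" "(\<Sum>i<n. \<alpha> i * a i) = 0"
  shows "(\<Sum>i<n. \<alpha> i * f (a i)) = (LINT x:{0<..<l}|lebesgue. q x * (\<Sum>i<n. \<alpha> i * max 0 (x - a i)))"
proof -
  define h where "h = (d + l) / 2"
  have h: "d < h" "h < l" using cd by (auto simp: h_def)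
  let ?\<phi> = "\<lambda>k x. \<Sum>i<n. (\<alpha> i / k) * K (k * (x - a i))"
  let ?\<psi> = "\<lambda>x. \<Sum>i<n. \<alpha> i * max 0 (x - a i)"
  have loc: "locally_integrable {0<..<l} q" using w by (simp add: has_weak_deriv_def)
  have ev: "\<forall>\<^sub>F k in at_top. 1 / k \<le> h - d \<and> k > 0"
    using eventually_inverse_less[of "h - d"] eventually_gt_at_top[of 0] h
    by (intro eventually_conj) (auto elim: eventually_mono)
  have near: "\<bar>K (k * y) / k - max 0 y\<bar> \<le> 1 / k" if "k > 0" for k y
  proof -
    have "max 0 (k * y) = k * max 0 y" using that by (auto simp: max_def mult_le_0_iff zero_le_mult_iff)
    then have "\<bar>K (k * y) / k - max 0 y\<bar> = \<bar>K (k * y) - max 0 (k * y)\<bar> / k"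
      using that by (simp add: field_simps abs_divide[symmetric])
    then show ?thesis using K_near[of "k * y"] that by (simp add: divide_right_mono)
  qed
  have lim1: "((\<lambda>k. LINT x:{0<..<l}|lebesgue. q x * ?\<phi> k x) \<longlongrightarrow> (LINT x:{0<..<l}|lebesgue. q x * ?\<psi> x)) at_top"
  proof (rule test_integral_tendsto[where c = c and d = h and C = "\<Sum>i<n. \<bar>\<alpha> i\<bar> * (1 + l)"])
    show "{c..h} \<subseteq> {0<..<l}" using cd h by auto
    show "((\<lambda>k. ?\<phi> k x) \<longlongrightarrow> ?\<psi> x) at_top" for x
    proof (rule tendsto_sum)
      fix i
      have "((\<lambda>k. K (k * (x - a i)) / k - max 0 (x - a i)) \<longlongrightarrow> 0) at_top"
      proof (rule Lim_null_comparison)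
        show "\<forall>\<^sub>F k in at_top. norm (K (k * (x - a i)) / k - max 0 (x - a i)) \<le> 1 / k"
          using eventually_gt_at_top[of 0] by eventually_elim (use near in simp)
        show "((\<lambda>k::real. 1 / k) \<longlongrightarrow> 0) at_top"
          by (intro tendsto_divide_0[OF tendsto_const] filterlim_at_top_imp_at_infinity filterlim_ident)
      qed
      then have "((\<lambda>k. K (k * (x - a i)) / k) \<longlongrightarrow> max 0 (x - a i)) at_top" by (simp add: Lim_null[symmetric])
      from tendsto_mult_left[OF this, of "\<alpha> i"]
      show "((\<lambda>k. (\<alpha> i / k) * K (k * (x - a i))) \<longlongrightarrow> \<alpha> i * max 0 (x - a i)) at_top" by simp
    qed
    show "\<bar>?\<phi> k x\<bar> \<le> (\<Sum>i<n. \<bar>\<alpha> i\<bar> * (1 + l))" if k: "k \<ge> 1" and x: "x \<in> {c..h}" for k x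
    proof -
      have "\<bar>(\<alpha> i / k) * K (k * (x - a i))\<bar> \<le> \<bar>\<alpha> i\<bar> * (1 + l)" if "i < n" for i
      proof -
        have "\<bar>K (k * (x - a i)) / k - max 0 (x - a i)\<bar> \<le> 1"
          using near[of k "x - a i"] k by (smt (verit) divide_le_eq_1)
        moreover have "0 \<le> max 0 (x - a i)" "max 0 (x - a i) \<le> l" using a[OF that] x cd h by auto
        ultimately have "\<bar>K (k * (x - a i)) / k\<bar> \<le> 1 + l" by linarith
        then have "\<bar>\<alpha> i\<bar> * \<bar>K (k * (x - a i)) / k\<bar> \<le> \<bar>\<alpha> i\<bar> * (1 + l)" by (rule mult_left_mono) simp
        then show ?thesis by (simp add: abs_mult)
      qed
      then show ?thesis by (intro order_trans[OF sum_abs] sum_mono) auto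
    qed
    show "\<forall>\<^sub>F k in at_top. \<forall>x. x \<notin> {c..h} \<longrightarrow> ?\<phi> k x = 0"
      using ev by eventually_elim (use K_sum_outside[OF _ _ a _ s] in blast)
    show "?\<psi> x = 0" if "x \<notin> {c..h}" for x
    proof (cases "x < c")
      case True
      then have "max 0 (x - a i) = 0" if "i < n" for i using a[OF that] by auto
      then show ?thesis by simp
    next
      case False
      then have "max 0 (x - a i) = x - a i" if "i < n" for i using a[OF that] h \<open>x \<notin> _\<close> by auto
      then have "?\<psi> x = (\<Sum>i<n. \<alpha> i * x - \<alpha> i * a i)" by (intro sum.cong) (simp_all add: right_diff_distrib)
      also have "\<dots> = (\<Sum>i<n. \<alpha> i) * x - (\<Sum>i<n. \<alpha> i * a i)"
        by (simp add: sum_subtractf sum_distrib_right)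
      finally show ?thesis using s by simp
    qed
    show "continuous_on UNIV (?\<phi> k)" for k
      by (intro continuous_intros continuous_on_compose2[OF cont_K]) auto
    show "?\<psi> \<in> borel_measurable borel" by measurable
  qed (use loc in auto)
  have "((\<lambda>k. LINT x:{0<..<l}|lebesgue. f x * (\<Sum>i<n. \<alpha> i * (k * \<eta> (k * (x - a i))))) \<longlongrightarrow> (\<Sum>i<n. \<alpha> i * f (a i))) at_top"
    by (intro sum_mollify_tendsto[OF f]) (use a cd in force)+
  moreover have "\<forall>\<^sub>F k in at_top. (LINT x:{0<..<l}|lebesgue. f x * (\<Sum>i<n. \<alpha> i * (k * \<eta> (k * (x - a i)))))
      = (LINT x:{0<..<l}|lebesgue. q x * ?\<phi> k x)"
    using ev
  proof eventually_elim
    case (elim k)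
    let ?\<chi> = "\<lambda>x. \<Sum>i<n. \<alpha> i * H (k * (x - a i))"
    have \<phi>: "?\<phi> k \<in> test_functions {0<..<l}" by (rule K_sum_test[where h=h and d=d and c=c]) (use elim a s cd h in auto)
    have \<chi>: "deriv (?\<phi> k) = ?\<chi>" "deriv ?\<chi> = (\<lambda>x. \<Sum>i<n. \<alpha> i * (k * \<eta> (k * (x - a i))))"
      using DERIV_imp_deriv[OF H_sum_deriv] DERIV_imp_deriv[OF K_sum_deriv] elim by auto
    have "?\<chi> \<in> test_functions {0<..<l}" using deriv_test_function[OF \<phi>] \<chi>(1) by simp
    then have "(LINT x:{0<..<l}|lebesgue. f x * deriv ?\<chi> x) = - (LINT x:{0<..<l}|lebesgue. p x * ?\<chi> x)"
      using w by (auto simp: has_weak_deriv_def)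
    moreover have "(LINT x:{0<..<l}|lebesgue. p x * ?\<chi> x) = - (LINT x:{0<..<l}|lebesgue. q x * ?\<phi> k x)"
      using w \<phi> \<chi>(1) by (auto simp: has_weak_deriv_def)
    moreover note \<chi>(2)
    ultimately show ?case by simp
  qed
  ultimately have "((\<lambda>k. LINT x:{0<..<l}|lebesgue. q x * ?\<phi> k x) \<longlongrightarrow> (\<Sum>i<n. \<alpha> i * f (a i))) at_top"
    by (blast intro: Lim_transform_eventually)
  then show ?thesis using lim1 by (rule tendsto_unique[OF trivial_limit_at_top_linorder])
qed

end

section \<open>Regularity and integration by parts on an edge\<close>

lemma continuous_times_absolutely_integrable:
  fixes q :: "real \<Rightarrow> real"
  assumes g: "continuous_on {0..l} g" and q: "q absolutely_integrable_on {0..l}"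
  shows "(\<lambda>s. g s * q s) absolutely_integrable_on {0..l}"
proof (rule absolutely_integrable_bounded_measurable_product_real)
  show "g \<in> borel_measurable (lebesgue_on {0..l})"
    using g by (simp add: continuous_imp_measurable_on_sets_lebesgue)
  show "bounded (g ` {0..l})" using g compact_continuous_image compact_Icc compact_imp_bounded by blast
qed (use q in auto)

text \<open>
  Integration by parts when one factor \<open>Z\<close> is only a primitive of an integrable \<open>q\<close>, and thus
  differentiable only almost everywhere. The difference \<open>G Z - \<integral> G q\<close> is nevertheless
  differentiable at every point: its increment differs from \<open>(G y - G x) Z x\<close> by
  \<open>\<integral> (G y - G s) q s\<close> over the interval between \<open>x\<close> and \<open>y\<close>, and this is \<open>o (y - x)\<close> since \<open>G\<close> is Lipschitz and
  the primitive of \<open>\<bar>q\<bar>\<close> is continuous.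
\<close>

lemma AC_product_deriv:
  fixes q :: "real \<Rightarrow> real"
  assumes q: "q absolutely_integrable_on {0..l}"
    and Z: "\<And>x y. 0 \<le> x \<Longrightarrow> x \<le> y \<Longrightarrow> y \<le> l \<Longrightarrow> Z y - Z x = integral {x..y} q"
    and G: "\<And>x. x \<in> {0..l} \<Longrightarrow> (G has_real_derivative G' x) (at x within {0..l})"
    and L: "\<And>x y. x \<in> {0..l} \<Longrightarrow> y \<in> {0..l} \<Longrightarrow> \<bar>G y - G x\<bar> \<le> C * \<bar>y - x\<bar>"
    and x: "x \<in> {0..l}"
  shows "((\<lambda>y. G y * Z y - integral {0..y} (\<lambda>s. G s * q s)) has_real_derivative G' x * Z x) (at x within {0..l})"
proof -
  define N where "N y = integral {0..y} (\<lambda>s. \<bar>q s\<bar>)" for y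
  \<comment> \<open>The remainder after the linear part of the increment.\<close>
  define E where "E y = G y * Z y - integral {0..y} (\<lambda>s. G s * q s) - (G x * Z x - integral {0..x} (\<lambda>s. G s * q s)) - (G y - G x) * Z x" for y
  have qi: "q integrable_on {0..l}" using q by (rule absolutely_integrable_on_def[THEN iffD1, THEN conjunct1])
  have aqi: "(\<lambda>s. \<bar>q s\<bar>) absolutely_integrable_on {0..l}" using absolutely_integrable_norm[OF q] by (simp add: o_def)
  have contG: "continuous_on {0..l} G" using G by (rule DERIV_continuous_on)
  have prod: "(\<lambda>s. H s * q s) absolutely_integrable_on {0..l}" if "continuous_on {0..l} H" for H
    using that q by (rule continuous_times_absolutely_integrable)
  have Gq: "(\<lambda>s. G s * q s) integrable_on {0..l}"
    using prod[OF contG] by (rule absolutely_integrable_on_def[THEN iffD1, THEN conjunct1])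
  have aq: "(\<lambda>s. \<bar>q s\<bar>) integrable_on {0..l}"
    using aqi by (rule absolutely_integrable_on_def[THEN iffD1, THEN conjunct1])
  have split: "integral {0..b} h - integral {0..a} h = integral {a..b} h"
    if "h integrable_on {0..l}" "0 \<le> a" "a \<le> b" "b \<le> l" for h :: "real \<Rightarrow> real" and a b
    using Henstock_Kurzweil_Integration.integral_combine[of 0 a b h] that integrable_on_subinterval[OF that(1), of 0 b] by (auto)
  have core: "\<bar>integral {a..b} (\<lambda>s. (G y - G s) * q s)\<bar> \<le> C * (b - a) * (N b - N a)"
    if ab: "0 \<le> a" "a \<le> b" "b \<le> l" "y \<in> {a..b}" for a b y
  proof -
    have sub: "{a..b} \<subseteq> {0..l}" using ab by auto
    have "norm (integral {a..b} (\<lambda>s. (G y - G s) * q s)) \<le> integral {a..b} (\<lambda>s. C * (b - a) * \<bar>q s\<bar>)"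
    proof (rule integral_norm_bound_integral)
      have "(\<lambda>s. (G y - G s) * q s) absolutely_integrable_on {0..l}"
        by (rule prod) (intro continuous_intros contG)
      then show "(\<lambda>s. (G y - G s) * q s) integrable_on {a..b}"
        using sub by (meson absolutely_integrable_on_def integrable_on_subinterval)
      show "(\<lambda>s. C * (b - a) * \<bar>q s\<bar>) integrable_on {a..b}"
        using integrable_on_subinterval[OF aq sub] by (rule integrable_on_mult_right)
      show "norm ((G y - G s) * q s) \<le> C * (b - a) * \<bar>q s\<bar>" if s: "s \<in> {a..b}" for s
      proof -
        have "\<bar>G y - G s\<bar> \<le> C * \<bar>y - s\<bar>" using L[of s y] s ab by auto
        moreover have "C \<ge> 0 \<or> y = s"
        proof (cases "y = s")
          case False
          then have "0 < \<bar>y - s\<bar>" by simp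
          moreover have "0 \<le> C * \<bar>y - s\<bar>" using \<open>\<bar>G y - G s\<bar> \<le> C * \<bar>y - s\<bar>\<close> by linarith
          ultimately show ?thesis by (auto simp: zero_le_mult_iff)
        qed auto
        moreover have "C \<ge> 0 \<or> a = b"
        proof (cases "a = b")
          case False
          then have "0 \<le> C * \<bar>b - a\<bar>" using L[of a b] ab by force
          then show ?thesis using False by (auto simp: zero_le_mult_iff)
        qed auto
        moreover have "\<bar>y - s\<bar> \<le> b - a" using s ab by auto
        ultimately have "\<bar>G y - G s\<bar> \<le> C * (b - a)"
          by (smt (verit, ccfv_SIG) mult_left_mono atLeastAtMost_iff s)
        then have "\<bar>G y - G s\<bar> * \<bar>q s\<bar> \<le> C * (b - a) * \<bar>q s\<bar>" by (rule mult_right_mono) simp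
        then show ?thesis by (simp add: abs_mult)
      qed
    qed
    then show ?thesis using split[OF aq ab(1-3)] by (simp add: N_def)
  qed
  \<comment> \<open>One identity for both orders of the base point \<open>w\<close> and the moving point \<open>y\<close>.\<close>
  have id: "G b * Z b - integral {0..b} (\<lambda>s. G s * q s) - (G a * Z a - integral {0..a} (\<lambda>s. G s * q s))
     = (G b - G a) * Z w + integral {a..b} (\<lambda>s. (G y - G s) * q s)"
    if ab: "0 \<le> a" "a \<le> b" "b \<le> l" and wy: "w = a \<and> y = b \<or> w = b \<and> y = a" for a b w y
  proof -
    have sub: "{a..b} \<subseteq> {0..l}" using ab by auto
    have "integral {a..b} (\<lambda>s. (G y - G s) * q s) = integral {a..b} (\<lambda>s. G y * q s - G s * q s)"
      by (simp add: left_diff_distrib)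
    also have "\<dots> = integral {a..b} (\<lambda>s. G y * q s) - integral {a..b} (\<lambda>s. G s * q s)"
      by (rule Henstock_Kurzweil_Integration.integral_diff)
        (use integrable_on_subinterval[OF qi sub] integrable_on_subinterval[OF Gq sub] in \<open>auto intro: integrable_on_mult_right\<close>)
    also have "\<dots> = G y * (Z b - Z a) - (integral {0..b} (\<lambda>s. G s * q s) - integral {0..a} (\<lambda>s. G s * q s))"
      using Z[OF ab] split[OF Gq ab] by simp
    finally show ?thesis using wy by (auto simp: algebra_simps)
  qed
  have Ebd: "\<bar>E y\<bar> \<le> C * \<bar>y - x\<bar> * \<bar>N y - N x\<bar>" if y: "y \<in> {0..l}" for y
  proof (cases "x \<le> y")
    case True
    have "E y = integral {x..y} (\<lambda>s. (G y - G s) * q s)"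
      using id[of x y x y] True x y by (auto simp: E_def)
    moreover have "N y - N x \<ge> 0"
      unfolding N_def using split[OF aq, of x y] x y True
      by (auto intro!: integral_nonneg integrable_on_subinterval[OF aq])
    ultimately show ?thesis using core[of x y y] True x y by auto
  next
    case False
    have "E y = - integral {y..x} (\<lambda>s. (G y - G s) * q s)"
      using id[of y x x y] False x y by (auto simp: E_def algebra_simps)
    moreover have "N x - N y \<ge> 0"
      unfolding N_def using split[OF aq, of y x] x y False
      by (auto intro!: integral_nonneg integrable_on_subinterval[OF aq])
    ultimately show ?thesis using core[of y x y] False x y by (auto simp: abs_minus_commute)
  qed
  have contN: "continuous_on {0..l} N" unfolding N_def by (rule indefinite_integral_continuous_1[OF aq])
  have E0: "(E has_real_derivative 0) (at x within {0..l})"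
    unfolding has_field_derivative_iff
  proof (rule Lim_null_comparison)
    have "(N \<longlongrightarrow> N x) (at x within {0..l})" using contN x by (simp add: continuous_on)
    then have "((\<lambda>y. C * \<bar>N y - N x\<bar>) \<longlongrightarrow> C * \<bar>N x - N x\<bar>) (at x within {0..l})" by (intro tendsto_intros)
    then show "((\<lambda>y. C * \<bar>N y - N x\<bar>) \<longlongrightarrow> 0) (at x within {0..l})" by simp
    have "E x = 0" by (simp add: E_def)
    show "\<forall>\<^sub>F y in at x within {0..l}. norm ((E y - E x) / (y - x)) \<le> C * \<bar>N y - N x\<bar>"
      unfolding eventually_at_filter
    proof (intro always_eventually allI impI)
      fix y assume y: "y \<noteq> x" "y \<in> {0..l}"
      have "\<bar>E y\<bar> / \<bar>y - x\<bar> \<le> (C * \<bar>y - x\<bar> * \<bar>N y - N x\<bar>) / \<bar>y - x\<bar>"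
        using Ebd[OF y(2)] by (rule divide_right_mono) simp
      then show "norm ((E y - E x) / (y - x)) \<le> C * \<bar>N y - N x\<bar>" using y \<open>E x = 0\<close> by simp
    qed
  qed
  have "((\<lambda>y. E y + (G x * Z x - integral {0..x} (\<lambda>s. G s * q s)) + (G y - G x) * Z x) has_real_derivative
     0 + 0 + (G' x - 0) * Z x) (at x within {0..l})"
    by (intro DERIV_add E0 DERIV_const DERIV_cmult_right DERIV_diff G x)
  then show ?thesis by (simp add: E_def)
qed

lemma L2_interval_absolutely_integrable:
  assumes "q \<in> L2 (lebesgue_on {0<..<l::real})"
  shows "q absolutely_integrable_on {0..l}"
proof -
  have m: "q \<in> borel_measurable (lebesgue_on {0<..<l})" and i: "integrable (lebesgue_on {0<..<l}) (\<lambda>x. (q x)\<^sup>2)"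
    using assms by (auto simp: L2_def)
  have one: "integrable (lebesgue_on {0<..<l}) (\<lambda>x. 1::real)"
    using emeasure_bounded_finite[of "{0<..<l}"]
    by (subst integrable_restrict_space) (auto intro!: integrable_real_indicator simp: less_top)
  have "integrable (lebesgue_on {0<..<l}) q"
  proof (rule Bochner_Integration.integrable_bound[OF Bochner_Integration.integrable_add[OF one i] m])
    show "AE x in lebesgue_on {0<..<l}. norm (q x) \<le> norm (1 + (q x)\<^sup>2)"
    proof (intro AE_I2)
      fix x show "norm (q x) \<le> norm (1 + (q x)\<^sup>2)"
        using zero_le_power2[of "\<bar>q x\<bar> - 1"] by (auto simp: power2_diff)
    qed
  qed
  then have "q absolutely_integrable_on {0<..<l}"
    unfolding set_integrable_def by (subst (asm) integrable_restrict_space) auto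
  then show ?thesis by (simp add: absolutely_integrable_on_Icc_iff_Ioo)
qed

text \<open>
  The double primitive \<open>\<Phi>\<close> of \<open>q\<close> satisfies the same formula for weighted sums of point values
  as \<open>v\<close> does by \<open>weak_deriv2_hat\<close>, so that \<open>v - \<Phi>\<close> is affine on the open interval, and by
  continuity on the closed one. The derivative of \<open>\<Phi>\<close> is the simple primitive of \<open>q\<close>.
\<close>

lemma edge_C1:
  assumes l: "0 < l" and v: "continuous_on {0..l} v"
    and w: "has_weak_deriv {0<..<l} v p" "has_weak_deriv {0<..<l} p q"
    and q2: "q \<in> L2 (lebesgue_on {0<..<l})"
  obtains P where "\<And>x. x \<in> {0..l} \<Longrightarrow> (v has_real_derivative P x) (at x within {0..l})"
    "\<And>x y. 0 \<le> x \<Longrightarrow> x \<le> y \<Longrightarrow> y \<le> l \<Longrightarrow> P y - P x = integral {x..y} q"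
proof -
  have q: "q absolutely_integrable_on {0..l}" by (rule L2_interval_absolutely_integrable[OF q2])
  have qi: "q integrable_on {0..l}" using q by (rule absolutely_integrable_on_def[THEN iffD1, THEN conjunct1])
  obtain \<eta> H K where "mollifier \<eta> H K" using mollifier_exists by blast
  then interpret mollifier \<eta> H K .
  define Q where "Q y = integral {0..y} q" for y
  have Q: "Q y - Q x = integral {x..y} q" if "0 \<le> x" "x \<le> y" "y \<le> l" for x y
    using Henstock_Kurzweil_Integration.integral_combine[of 0 x y q] that integrable_on_subinterval[OF qi, of 0 y] by (auto simp: Q_def)
  define \<Phi> where "\<Phi> y = y * Q y - integral {0..y} (\<lambda>s. s * q s)" for y
  have \<Phi>': "(\<Phi> has_real_derivative Q x) (at x within {0..l})" if "x \<in> {0..l}" for x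
    using AC_product_deriv[OF q Q, where G = "\<lambda>x. x" and G' = "\<lambda>x. 1" and C = 1] that unfolding \<Phi>_def by auto
  have sq: "(\<lambda>s. g s * q s) absolutely_integrable_on {0..l}" if "continuous_on {0..l} g" for g
    using that q by (rule continuous_times_absolutely_integrable)
  have sqI: "set_integrable lebesgue {0<..<l} (\<lambda>s. q s * g s)" if "continuous_on {0..l} g" for g
    using sq[OF that] by (simp add: absolutely_integrable_on_Icc_iff_Ioo mult.commute)
  have \<Phi>_eq: "\<Phi> a = (LINT x:{0<..<l}|lebesgue. q x * max 0 (a - x))" if a: "0 \<le> a" "a \<le> l" for a
  proof -
    have i: "q integrable_on {0..a}" "(\<lambda>s. s * q s) integrable_on {0..a}"
      using integrable_on_subinterval[OF qi, of 0 a] a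
        integrable_on_subinterval[of "\<lambda>s. s * q s" "{0..l}" 0 a] sq[of "\<lambda>s. s"]
      by (auto simp: absolutely_integrable_on_def)
    have contm: "continuous_on {0..l} (\<lambda>x. max 0 (a - x))" by (intro continuous_intros)
    have "(LINT x:{0<..<l}|lebesgue. q x * max 0 (a - x)) = integral {0<..<l} (\<lambda>x. q x * max 0 (a - x))"
      by (intro set_lebesgue_integral_eq_integral sqI continuous_intros)
    also have "\<dots> = integral {0..l} (\<lambda>x. q x * max 0 (a - x))"
      by (simp add: integral_open_interval_real)
    also have "\<dots> = integral {0..a} (\<lambda>x. q x * max 0 (a - x)) + integral {a..l} (\<lambda>x. q x * max 0 (a - x))"
      by (rule Henstock_Kurzweil_Integration.integral_combine[symmetric])
        (use a contm sq[OF contm] in \<open>auto simp: mult.commute absolutely_integrable_on_def\<close>)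
    also have "integral {a..l} (\<lambda>x. q x * max 0 (a - x)) = integral {a..l} (\<lambda>x. 0)"
      by (rule Henstock_Kurzweil_Integration.integral_cong) auto
    also have "integral {0..a} (\<lambda>x. q x * max 0 (a - x)) = integral {0..a} (\<lambda>x. a * q x - x * q x)"
      by (rule Henstock_Kurzweil_Integration.integral_cong) (auto simp: algebra_simps)
    also have "\<dots> = a * Q a - integral {0..a} (\<lambda>x. x * q x)"
      using i by (subst Henstock_Kurzweil_Integration.integral_diff) (auto simp: Q_def intro: integrable_on_mult_right)
    finally show ?thesis by (simp add: \<Phi>_def)
  qed
  define u where "u x = v x - \<Phi> x" for x
  have contu: "continuous_on {0..l} u" unfolding u_def
    using DERIV_continuous_on[OF \<Phi>'] by (intro continuous_intros v)
  have three: "(\<Sum>i<n. \<alpha> i * u (a i)) = 0"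
    if a: "\<And>i. i < n \<Longrightarrow> c \<le> a i \<and> a i \<le> d" and cd: "0 < c" "d < l"
      and s: "(\<Sum>i<n. \<alpha> i) = 0" "(\<Sum>i<n. \<alpha> i * a i) = 0" for \<alpha> a :: "nat \<Rightarrow> real" and n c d
  proof -
    have al: "0 \<le> a i" "a i \<le> l" if "i < n" for i using a[OF that] cd by auto
    have "(\<Sum>i<n. \<alpha> i * max 0 (x - a i)) = (\<Sum>i<n. \<alpha> i * max 0 (a i - x))" for x
    proof -
      \<comment> \<open>The two positive parts differ by an affine function, which the weights do not see.\<close>
      have "(\<Sum>i<n. \<alpha> i * max 0 (x - a i)) = (\<Sum>i<n. \<alpha> i * max 0 (a i - x) + \<alpha> i * x - \<alpha> i * a i)"
        by (rule sum.cong) (auto simp: max_def algebra_simps)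
      also have "\<dots> = (\<Sum>i<n. \<alpha> i * max 0 (a i - x)) + (\<Sum>i<n. \<alpha> i) * x - (\<Sum>i<n. \<alpha> i * a i)"
        by (simp add: sum_subtractf sum.distrib sum_distrib_right)
      finally show ?thesis using s by simp
    qed
    then have "(\<Sum>i<n. \<alpha> i * v (a i)) = (LINT x:{0<..<l}|lebesgue. q x * (\<Sum>i<n. \<alpha> i * max 0 (a i - x)))"
      using weak_deriv2_hat[OF w continuous_on_subset[OF v greaterThanLessThan_subseteq_atLeastAtMost_iff[THEN iffD2]] a cd s] by auto
    also have "\<dots> = (LINT x:{0<..<l}|lebesgue. (\<Sum>i<n. \<alpha> i * (q x * max 0 (a i - x))))"
      by (simp add: sum_distrib_left mult.left_commute)
    also have "\<dots> = (\<Sum>i<n. \<alpha> i * \<Phi> (a i))"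
    proof -
      have "set_integrable lebesgue {0<..<l} (\<lambda>x. q x * max 0 (a i - x))" for i
        by (intro sqI continuous_intros)
      then show ?thesis
        unfolding set_lebesgue_integral_def set_integrable_def scaleR_sum_right
        by (subst Bochner_Integration.integral_sum)
          (auto simp: mult.left_commute[of _ "\<alpha> _"] \<Phi>_eq al set_lebesgue_integral_def)
    qed
    finally show ?thesis by (simp add: u_def right_diff_distrib sum_subtractf)
  qed
  \<comment> \<open>Any two inner points determine the affine function.\<close>
  define A B where "A = l / 3" and "B = 2 * l / 3"
  have AB: "0 < A" "A < B" "B < l" "B - A \<noteq> 0" using l by (auto simp: A_def B_def)
  define \<beta> \<gamma> where "\<beta> = (u B - u A) / (B - A)" and "\<gamma> = u A - \<beta> * A"
  have aff: "u x = \<gamma> + \<beta> * x" if x: "x \<in> {0<..<l}" for x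
  proof -
    define a :: "nat \<Rightarrow> real" where "a i = (if i = 0 then A else if i = 1 then B else x)" for i
    \<comment> \<open>The weights at the three nodes annihilate all affine functions, whatever the order of the nodes.\<close>
    define \<alpha> :: "nat \<Rightarrow> real" where "\<alpha> i = (if i = 0 then B - x else if i = 1 then x - A else A - B)" for i
    have "(\<Sum>i<3. \<alpha> i * u (a i)) = 0"
      by (rule three[of 3 "min A x" _ "max B x"])
        (use AB x in \<open>auto simp: a_def \<alpha>_def eval_nat_numeral algebra_simps\<close>)
    then have "(B - x) * u A + (x - A) * u B = (B - A) * u x"
      by (simp add: a_def \<alpha>_def eval_nat_numeral algebra_simps)
    then have "u x = ((B - x) * u A + (x - A) * u B) / (B - A)" using AB by (simp add: field_simps)
    also have "\<dots> = \<gamma> + \<beta> * x" using AB by (simp add: \<gamma>_def \<beta>_def divide_simps) (simp add: algebra_simps)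
    finally show ?thesis .
  qed
  have aff': "u x = \<gamma> + \<beta> * x" if x: "x \<in> {0..l}" for x
  proof -
    have cl: "closure {0<..<l} = {0..l}" using l by simp
    have "(\<lambda>x. u x - (\<gamma> + \<beta> * x)) x = 0"
      by (rule continuous_constant_on_closure[of "{0<..<l}"])
        (use aff x cl in \<open>auto intro!: continuous_intros contu\<close>)
    then show ?thesis by simp
  qed
  show thesis
  proof (rule that[of "\<lambda>x. \<beta> + Q x"])
    show "(v has_real_derivative \<beta> + Q x) (at x within {0..l})" if x: "x \<in> {0..l}" for x
    proof -
      have "((\<lambda>x. \<gamma> + \<beta> * x + \<Phi> x) has_real_derivative 0 + \<beta> * 1 + Q x) (at x within {0..l})"
        by (intro DERIV_add DERIV_const DERIV_cmult DERIV_ident \<Phi>' x)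
      moreover have "\<gamma> + \<beta> * y + \<Phi> y = v y" if "y \<in> {0..l}" for y using aff'[OF that] by (simp add: u_def)
      ultimately have "(v has_real_derivative 0 + \<beta> * 1 + Q x) (at x within {0..l})"
        using has_field_derivative_transform_within[OF _ zero_less_one x] by blast
      then show ?thesis by simp
    qed
    show "\<beta> + Q y - (\<beta> + Q x) = integral {x..y} q" if "0 \<le> x" "x \<le> y" "y \<le> l" for x y
      using Q[OF that] by simp
  qed
qed

text \<open>
  This allows statements on second weak derivatives to be used for first ones.
\<close>

lemma primitive_has_weak_deriv:
  assumes l: "0 < l" and v: "continuous_on {0..l} v"
  shows "has_weak_deriv {0<..<l} (\<lambda>x. integral {0..x} v) v"
proof -
  let ?F = "\<lambda>x. integral {0..x} v"
  have F: "(?F has_real_derivative v x) (at x within {0..l})" if "x \<in> {0..l}" for x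
    by (rule integral_has_real_derivative[OF v that])
  have contF: "continuous_on {0..l} ?F" by (rule DERIV_continuous_on[OF F])
  have loc: "locally_integrable {0<..<l} g" if g: "continuous_on {0..l} g" for g :: "real \<Rightarrow> real"
    unfolding locally_integrable_def
  proof (intro allI impI)
    fix K :: "real set" assume K: "compact K \<and> K \<subseteq> {0<..<l}"
    show "set_integrable lebesgue K g"
      by (rule set_integrable_subset[OF absolutely_integrable_continuous_real[OF g]])
        (use K in \<open>auto dest: compact_imp_closed\<close>)
  qed
  have "(LINT x:{0<..<l}|lebesgue. ?F x * deriv \<phi> x) = - (LINT x:{0<..<l}|lebesgue. v x * \<phi> x)"
    if \<phi>: "\<phi> \<in> test_functions {0<..<l}" for \<phi>
  proof -
    have "\<phi> differentiable (at x)" "deriv \<phi> differentiable (at x)" for x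
      using \<phi> spec[of "\<lambda>n. \<forall>x\<in>UNIV. (deriv ^^ n) \<phi> differentiable (at x)" 0]
        spec[of "\<lambda>n. \<forall>x\<in>UNIV. (deriv ^^ n) \<phi> differentiable (at x)" 1]
      by (simp_all add: test_functions_def smooth_on_def)
    then have d: "(\<phi> has_real_derivative deriv \<phi> x) (at x)" "isCont (deriv \<phi>) x" for x
      by (auto simp: DERIV_deriv_iff_real_differentiable intro: differentiable_imp_continuous_within)
    have "isCont \<phi> x" for x using d(1) by (rule DERIV_isCont)
    then have c: "continuous_on {0..l} \<phi>" "continuous_on {0..l} (deriv \<phi>)"
      using d(2) by (simp_all add: continuous_at_imp_continuous_on)
    have z: "\<phi> 0 = 0" "\<phi> l = 0" using \<phi> by (auto simp: test_functions_def)
    have "((\<lambda>x. ?F x * deriv \<phi> x + v x * \<phi> x) has_integral (?F l * \<phi> l - ?F 0 * \<phi> 0)) {0..l}"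
    proof (rule fundamental_theorem_of_calculus)
      fix x assume x: "x \<in> {0..l}"
      show "((\<lambda>x. ?F x * \<phi> x) has_vector_derivative ?F x * deriv \<phi> x + v x * \<phi> x) (at x within {0..l})"
        using DERIV_mult[OF F[OF x] has_field_derivative_at_within[OF d(1)]]
        by (simp add: has_real_derivative_iff_has_vector_derivative mult.commute add.commute)
    qed (use l in simp)
    then have "integral {0..l} (\<lambda>x. ?F x * deriv \<phi> x + v x * \<phi> x) = 0" using z by (simp add: integral_unique)
    moreover have i: "(\<lambda>x. ?F x * deriv \<phi> x) absolutely_integrable_on {0..l}" "(\<lambda>x. v x * \<phi> x) absolutely_integrable_on {0..l}"
      by (intro absolutely_integrable_continuous_real continuous_intros contF v c)+
    ultimately have "integral {0..l} (\<lambda>x. ?F x * deriv \<phi> x) + integral {0..l} (\<lambda>x. v x * \<phi> x) = 0"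
      by (simp add: Henstock_Kurzweil_Integration.integral_add absolutely_integrable_on_def)
    then show ?thesis using i
      by (simp add: set_lebesgue_integral_eq_integral absolutely_integrable_on_Icc_iff_Ioo integral_open_interval_real)
  qed
  then show ?thesis using loc[OF contF] loc[OF v] by (simp add: has_weak_deriv_def)
qed

text \<open>
  Apply \<open>edge_C1\<close> to the primitive of \<open>v\<close>, whose second weak derivative is \<open>p\<close>: its classical
  derivative is \<open>v\<close>, and also a primitive of \<open>p\<close>.
\<close>

lemma weak_deriv_increment:
  assumes l: "0 < l" and v: "continuous_on {0..l} v"
    and w: "has_weak_deriv {0<..<l} v p" and p2: "p \<in> L2 (lebesgue_on {0<..<l})"
    and xy: "0 \<le> x" "x \<le> y" "y \<le> l"
  shows "v y - v x = integral {x..y} p"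
proof -
  let ?F = "\<lambda>x. integral {0..x} v"
  have F: "(?F has_real_derivative v x) (at x within {0..l})" if "x \<in> {0..l}" for x
    by (rule integral_has_real_derivative[OF v that])
  obtain P where P: "\<And>x. x \<in> {0..l} \<Longrightarrow> (?F has_real_derivative P x) (at x within {0..l})"
    "\<And>x y. 0 \<le> x \<Longrightarrow> x \<le> y \<Longrightarrow> y \<le> l \<Longrightarrow> P y - P x = integral {x..y} p"
    using edge_C1[OF l DERIV_continuous_on[OF F] primitive_has_weak_deriv[OF l v] w p2] by blast
  have "P x = v x" if "x \<in> {0..l}" for x
    using vector_derivative_within_closed_interval[OF l that] F[OF that] P(1)[OF that]
    by (metis has_real_derivative_iff_has_vector_derivative)
  then show ?thesis using P(2)[OF xy] xy by simp
qed

lemma edge_oscillation: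
  assumes l: "0 < l" and v: "continuous_on {0..l} v"
    and w: "has_weak_deriv {0<..<l} v p" and p2: "p \<in> L2 (lebesgue_on {0<..<l})"
    and x: "x \<in> {0..l}" and y: "y \<in> {0..l}"
  shows "\<bar>v y - v x\<bar> \<le> (LINT s:{0<..<l}|lebesgue. \<bar>p s\<bar>)"
proof -
  have p: "p absolutely_integrable_on {0..l}" by (rule L2_interval_absolutely_integrable[OF p2])
  then have pi: "p integrable_on {0..l}" "(\<lambda>s. \<bar>p s\<bar>) integrable_on {0..l}"
    by (auto simp: absolutely_integrable_on_def)
  have ord: "\<bar>v y - v x\<bar> \<le> integral {0..l} (\<lambda>s. \<bar>p s\<bar>)" if "0 \<le> x" "x \<le> y" "y \<le> l" for x y
  proof -
    have sub: "{x..y} \<subseteq> {0..l}" using that by auto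
    have "norm (integral {x..y} p) \<le> integral {x..y} (\<lambda>s. \<bar>p s\<bar>)"
      using pi by (intro integral_norm_bound_integral integrable_on_subinterval[OF _ sub]) auto
    also have "\<dots> \<le> integral {0..l} (\<lambda>s. \<bar>p s\<bar>)"
      using pi by (intro integral_subset_le sub integrable_on_subinterval[OF _ sub]) auto
    finally show ?thesis using weak_deriv_increment[OF l v w p2 that] by simp
  qed
  have "\<bar>v y - v x\<bar> \<le> integral {0..l} (\<lambda>s. \<bar>p s\<bar>)"
    using ord[of x y] ord[of y x] x y by (cases "x \<le> y") (auto simp: abs_minus_commute)
  also have "\<dots> = (LINT s:{0<..<l}|lebesgue. \<bar>p s\<bar>)"
    using absolutely_integrable_norm[OF p]
    by (simp add: o_def set_lebesgue_integral_eq_integral absolutely_integrable_on_Icc_iff_Ioo integral_open_interval_real)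
  finally show ?thesis .
qed

lemma positive_part_square_deriv:
  "((\<lambda>z::real. (max 0 z)\<^sup>2) has_real_derivative 2 * max 0 z) (at z)"
proof -
  consider "z > 0" | "z < 0" | "z = 0" by linarith
  then show ?thesis
  proof cases
    case 1
    have "((\<lambda>z. z\<^sup>2) has_real_derivative 2 * max 0 z) (at z)"
      using 1 by (auto intro!: derivative_eq_intros)
    then show ?thesis
      by (rule DERIV_cong_ev[OF refl _ refl, THEN iffD1, rotated])
        (rule eventually_mono[OF eventually_nhds_in_open[of "{0<..}"]], use 1 in auto)
  next
    case 2
    have "((\<lambda>z. 0) has_real_derivative 2 * max 0 z) (at z)" using 2 by auto
    then show ?thesis
      by (rule DERIV_cong_ev[OF refl _ refl, THEN iffD1, rotated])
        (rule eventually_mono[OF eventually_nhds_in_open[of "{..<0}"]], use 2 in auto)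
  next
    case 3
    have "((\<lambda>h. ((max 0 (0 + h))\<^sup>2 - (max 0 0)\<^sup>2) / h) \<longlongrightarrow> 0) (at (0::real))"
    proof (rule Lim_null_comparison)
      show "((\<lambda>h. \<bar>h\<bar>) \<longlongrightarrow> 0) (at (0::real))" by (auto intro!: tendsto_eq_intros)
      show "\<forall>\<^sub>F h in at (0::real). norm (((max 0 (0 + h))\<^sup>2 - (max 0 0)\<^sup>2) / h) \<le> \<bar>h\<bar>"
        by (intro always_eventually) (auto simp: max_def power2_eq_square)
    qed
    then show ?thesis using 3 by (simp add: DERIV_def)
  qed
qed

text \<open>
  The classical form is \<open>\<integral> g(z) z'' = [g(z) z'] - \<integral> g'(z) (z')\<^sup>2\<close> with the increasing function
  \<open>g(z) = (max 0 z)\<^sup>2\<close>. The square instead of the positive part itself makes \<open>g\<close> continuously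
  differentiable, as \<open>AC_product_deriv\<close> demands; the last term appears as the derivative of the
  boundary term minus the integral, which is nonnegative.
\<close>

lemma edge_energy_inequality:
  fixes q :: "real \<Rightarrow> real"
  assumes l: "0 < l" and q: "q absolutely_integrable_on {0..l}"
    and z: "\<And>x. x \<in> {0..l} \<Longrightarrow> (z has_real_derivative Z x) (at x within {0..l})"
    and Z: "\<And>x y. 0 \<le> x \<Longrightarrow> x \<le> y \<Longrightarrow> y \<le> l \<Longrightarrow> Z y - Z x = integral {x..y} q"
  shows "integral {0..l} (\<lambda>s. (max 0 (z s))\<^sup>2 * q s) \<le> (max 0 (z l))\<^sup>2 * Z l - (max 0 (z 0))\<^sup>2 * Z 0"
proof -
  have qi: "q integrable_on {0..l}" using q by (rule absolutely_integrable_on_def[THEN iffD1, THEN conjunct1])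
  have contz: "continuous_on {0..l} z" by (rule DERIV_continuous_on[OF z])
  have contZ: "continuous_on {0..l} Z"
  proof -
    have "continuous_on {0..l} (\<lambda>x. Z 0 + integral {0..x} q)"
      by (intro continuous_intros indefinite_integral_continuous_1 qi)
    then show ?thesis by (rule continuous_on_cong[THEN iffD1, OF refl, rotated]) (use Z[of 0] in force)
  qed
  define G where "G = (\<lambda>x. (max 0 (z x))\<^sup>2)"
  define G' where "G' = (\<lambda>x. 2 * max 0 (z x) * Z x)"
  have G: "(G has_real_derivative G' x) (at x within {0..l})" if "x \<in> {0..l}" for x
    unfolding G_def G'_def by (rule DERIV_chain2[OF positive_part_square_deriv z[OF that]])
  have "continuous_on {0..l} G'" unfolding G'_def by (intro continuous_intros contz contZ)
  then have "bounded (G' ` {0..l})" using compact_continuous_image compact_Icc compact_imp_bounded by blast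
  then obtain C where C: "\<forall>x\<in>{0..l}. \<bar>G' x\<bar> \<le> C" unfolding bounded_iff by auto
  have L: "\<bar>G y - G x\<bar> \<le> C * \<bar>y - x\<bar>" if "x \<in> {0..l}" "y \<in> {0..l}" for x y
    using field_differentiable_bound[OF convex_real_interval(5) G, where B = C and x = y and y = x] C that by auto
  let ?F = "\<lambda>y. G y * Z y - integral {0..y} (\<lambda>s. G s * q s)"
  have F: "(?F has_real_derivative G' x * Z x) (at x within {0..l})" if "x \<in> {0..l}" for x
    by (rule AC_product_deriv[OF q Z G L that])
  have "?F 0 \<le> ?F l"
  proof (rule DERIV_nonneg_imp_increasing_open[where f = ?F and a = 0 and b = l])
    show "\<exists>y. (?F has_real_derivative y) (at x) \<and> 0 \<le> y" if x: "0 < x" "x < l" for x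
    proof (intro exI conjI)
      have "at x within {0..l} = at x" using x by (intro at_within_interior) (auto simp: interior_atLeastAtMost_real)
      then show "(?F has_real_derivative G' x * Z x) (at x)" using F[of x] x by simp
      show "0 \<le> G' x * Z x" by (simp add: G'_def mult.assoc)
    qed
    show "continuous_on {0..l} ?F" by (rule DERIV_continuous_on[OF F])
  qed (use l in simp)
  then show ?thesis by (simp add: G_def)
qed

section \<open>Integration over a tree\<close>

lemma open_edge_lebesgue: "open_edge T e \<in> sets lebesgue"
  by (simp add: open_edge_def)

definition edge_region :: "('v, 'e) metric_graph \<Rightarrow> 'e \<Rightarrow> ('v, 'e) point set" where
  "edge_region T e = Inner e ` open_edge T e"

lemma edge_regions_tree_sets:
  assumes "F \<subseteq> edges T"
  shows "(\<Union>e\<in>F. edge_region T e) \<in> tree_sets T"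
proof -
  have "{s \<in> open_edge T e. Inner e s \<in> (\<Union>e\<in>F. edge_region T e)} = (if e \<in> F then open_edge T e else {})" for e
    by (auto simp: edge_region_def)
  then show ?thesis using assms open_edge_lebesgue[of T]
    unfolding tree_sets_def by (auto simp: edge_region_def points_def open_edge_def)
qed

lemma edge_region_sets:
  assumes "e \<in> edges T"
  shows "edge_region T e \<in> sets (tree_measure T)" "edge_region T e \<inter> space (tree_measure T) \<in> sets (tree_measure T)"
proof -
  show R: "edge_region T e \<in> sets (tree_measure T)"
    using edge_regions_tree_sets[of "{e}" T] assms by (simp add: sets_tree_measure)
  then show "edge_region T e \<inter> space (tree_measure T) \<in> sets (tree_measure T)" by (rule sets.Int) simp
qed

lemma measurable_Inner:
  assumes "e \<in> edges T"
  shows "Inner e \<in> measurable (lebesgue_on (open_edge T e)) (tree_measure T)"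
proof (rule measurableI)
  fix s assume "s \<in> space (lebesgue_on (open_edge T e))"
  then show "Inner e s \<in> space (tree_measure T)"
    using assms by (auto simp: space_tree_measure points_def open_edge_def)
next
  fix A assume "A \<in> sets (tree_measure T)"
  then have "{s \<in> open_edge T e. Inner e s \<in> A} \<in> sets lebesgue"
    using assms by (auto simp: sets_tree_measure tree_sets_def)
  moreover have "Inner e -` A \<inter> space (lebesgue_on (open_edge T e)) = {s \<in> open_edge T e. Inner e s \<in> A}" by auto
  ultimately show "Inner e -` A \<inter> space (lebesgue_on (open_edge T e)) \<in> sets (lebesgue_on (open_edge T e))"
    by (auto simp: sets_restrict_space_iff open_edge_lebesgue)
qed

lemma measurable_Inner_region:
  assumes "e \<in> edges T"
  shows "Inner e \<in> measurable (lebesgue_on (open_edge T e)) (restrict_space (tree_measure T) (edge_region T e))"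
  by (rule measurable_restrict_space2[OF _ measurable_Inner[OF assms]]) (auto simp: edge_region_def)

text \<open>
  The measure of the tree, restricted to an edge, is the image of Lebesgue measure under the
  parametrization. This transfers integrals and null sets between the tree and its edges.
\<close>

lemma restrict_edge_region:
  assumes e: "e \<in> edges T"
  shows "restrict_space (tree_measure T) (edge_region T e) =
    distr (lebesgue_on (open_edge T e)) (restrict_space (tree_measure T) (edge_region T e)) (Inner e)"
proof (rule measure_eqI)
  let ?M = "tree_measure T" and ?R = "edge_region T e" and ?L = "lebesgue_on (open_edge T e)"
  note R = edge_region_sets(2)[OF e]
  note m = measurable_Inner_region[OF e]
  fix A assume A: "A \<in> sets (restrict_space ?M ?R)"
  then have A': "A \<subseteq> ?R" "A \<in> tree_sets T" using R by (auto simp: sets_restrict_space_iff sets_tree_measure)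
  have "emeasure (restrict_space ?M ?R) A = emeasure ?M A"
    by (rule emeasure_restrict_space[OF R A'(1)])
  also have "\<dots> = (\<integral>\<^sup>+ e'. emeasure lebesgue {s \<in> open_edge T e'. Inner e' s \<in> A} \<partial>count_space (edges T))"
    by (rule emeasure_tree_measure[OF A'(2)])
  also have "\<dots> = (\<Sum>e'\<in>{e}. emeasure lebesgue {s \<in> open_edge T e'. Inner e' s \<in> A})"
  proof (rule nn_integral_count_space')
    fix e' assume "e' \<notin> {e}"
    then have "{s \<in> open_edge T e'. Inner e' s \<in> A} = {}" using A'(1) by (auto simp: edge_region_def)
    then show "emeasure lebesgue {s \<in> open_edge T e'. Inner e' s \<in> A} = 0" by (simp only: emeasure_empty)
  qed (use e in auto)
  also have "\<dots> = emeasure ?L {s \<in> open_edge T e. Inner e s \<in> A}"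
    by (simp add: emeasure_restrict_space open_edge_lebesgue)
  also have "\<dots> = emeasure ?L (Inner e -` A \<inter> space ?L)" by (rule arg_cong[where f = "emeasure ?L"]) auto
  finally show "emeasure (restrict_space ?M ?R) A = emeasure (distr ?L (restrict_space ?M ?R) (Inner e)) A"
    by (simp add: emeasure_distr[OF m A])
qed simp

lemma
  fixes G :: "('v, 'e) point \<Rightarrow> real"
  assumes e: "e \<in> edges T" and G: "integrable (tree_measure T) G"
  shows edge_integrable: "integrable (lebesgue_on (open_edge T e)) (\<lambda>s. G (Inner e s))"
    and edge_integral: "(\<integral>x. indicator (edge_region T e) x * G x \<partial>tree_measure T) =
       (LINT s:open_edge T e|lebesgue. G (Inner e s))"
proof -
  let ?M = "tree_measure T" and ?R = "edge_region T e" and ?L = "lebesgue_on (open_edge T e)"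
  note R = edge_region_sets[OF e]
  note m = measurable_Inner_region[OF e]
  have Gm: "G \<in> borel_measurable (restrict_space ?M ?R)"
    using G by (intro measurable_restrict_space1) auto
  have "integrable (restrict_space ?M ?R) G"
    using integrable_mult_indicator[OF R(1) G] by (subst integrable_restrict_space[OF R(2)])
  then have "integrable (distr ?L (restrict_space ?M ?R) (Inner e)) G"
    by (simp only: restrict_edge_region[OF e, symmetric])
  then show "integrable ?L (\<lambda>s. G (Inner e s))"
    using integrable_distr_eq[OF m Gm] by blast
  have "(\<integral>x. indicator ?R x * G x \<partial>?M) = integral\<^sup>L (restrict_space ?M ?R) G"
    by (subst integral_restrict_space[OF R(2)]) simp
  also have "\<dots> = (\<integral>s. G (Inner e s) \<partial>?L)"
    by (subst restrict_edge_region[OF e]) (rule integral_distr[OF m Gm])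
  also have "\<dots> = (LINT s:open_edge T e|lebesgue. G (Inner e s))"
    unfolding set_lebesgue_integral_def by (rule integral_restrict_space) (simp add: open_edge_lebesgue)
  finally show "(\<integral>x. indicator ?R x * G x \<partial>?M) = (LINT s:open_edge T e|lebesgue. G (Inner e s))" .
qed

lemma edge_AE:
  assumes e: "e \<in> edges T" and P: "AE x in tree_measure T. P x"
  shows "AE s in lebesgue_on (open_edge T e). P (Inner e s)"
proof -
  let ?M = "tree_measure T" and ?R = "edge_region T e" and ?L = "lebesgue_on (open_edge T e)"
  note R = edge_region_sets(2)[OF e]
  note m = measurable_Inner_region[OF e]
  have "AE x in restrict_space ?M ?R. P x" unfolding AE_restrict_space_iff[OF R] using P by eventually_elim simp
  then have "AE x in distr ?L (restrict_space ?M ?R) (Inner e). P x" by (simp only: restrict_edge_region[OF e, symmetric])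
  then show ?thesis by (rule AE_distrD[OF m])
qed

lemma edge_L2:
  assumes e: "e \<in> edges T" and G: "G \<in> L2 (tree_measure T)"
  shows "(\<lambda>s. G (Inner e s)) \<in> L2 (lebesgue_on (open_edge T e))"
proof -
  have "(\<lambda>s. G (Inner e s)) \<in> borel_measurable (lebesgue_on (open_edge T e))"
    using G by (intro measurable_compose[OF measurable_Inner[OF e]]) (simp add: L2_def)
  then show ?thesis using G edge_integrable[OF e, of "\<lambda>x. (G x)\<^sup>2"] by (simp add: L2_def)
qed

lemma tree_integral_finite_edges:
  fixes G :: "('v, 'e) point \<Rightarrow> real"
  assumes F: "finite F" "F \<subseteq> edges T" and G: "integrable (tree_measure T) G"
  shows "(\<integral>x. indicator (\<Union>e\<in>F. edge_region T e) x * G x \<partial>tree_measure T) =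
    (\<Sum>e\<in>F. LINT s:open_edge T e|lebesgue. G (Inner e s))"
proof -
  have ind: "indicator (\<Union>e\<in>F. edge_region T e) x * G x = (\<Sum>e\<in>F. indicator (edge_region T e) x * G x)" for x
  proof -
    have "indicator (\<Union>e\<in>F. edge_region T e) x = (\<Sum>e\<in>F. indicator (edge_region T e) x :: real)"
      by (rule indicator_UN_disjoint[OF F(1)]) (auto simp: disjoint_family_on_def edge_region_def)
    then show ?thesis by (simp add: sum_distrib_right)
  qed
  have "integrable (tree_measure T) (\<lambda>x. indicator (edge_region T e) x * G x)" if "e \<in> F" for e
    using integrable_mult_indicator[OF edge_region_sets(1) G] that F by auto
  then have "(\<integral>x. (\<Sum>e\<in>F. indicator (edge_region T e) x * G x) \<partial>tree_measure T) =
     (\<Sum>e\<in>F. \<integral>x. indicator (edge_region T e) x * G x \<partial>tree_measure T)"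
    by (rule Bochner_Integration.integral_sum)
  also have "\<dots> = (\<Sum>e\<in>F. LINT s:open_edge T e|lebesgue. G (Inner e s))"
    by (rule sum.cong) (use F G in \<open>auto intro!: edge_integral\<close>)
  finally show ?thesis by (simp add: ind)
qed

lemma AE_not_vertex: "AE x in tree_measure T. x \<notin> Vertex ` verts T"
proof (rule AE_I')
  have V: "Vertex ` verts T \<in> tree_sets T" by (auto simp: tree_sets_def points_def image_iff)
  have "{s \<in> open_edge T e. Inner e s \<in> Vertex ` verts T} = {}" for e by auto
  then have "emeasure (tree_measure T) (Vertex ` verts T) = 0"
    by (simp only: emeasure_tree_measure[OF V] emeasure_empty nn_integral_const mult_zero_left)
  then show "Vertex ` verts T \<in> null_sets (tree_measure T)" using V by (auto simp: null_sets_def sets_tree_measure)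
qed auto

lemma tree_integral_supported:
  fixes G :: "('v, 'e) point \<Rightarrow> real"
  assumes F: "finite F" "F \<subseteq> edges T" and G: "integrable (tree_measure T) G"
    and z: "\<And>e s. e \<in> edges T - F \<Longrightarrow> s \<in> open_edge T e \<Longrightarrow> G (Inner e s) = 0"
  shows "(\<integral>x. G x \<partial>tree_measure T) = (\<Sum>e\<in>F. LINT s:open_edge T e|lebesgue. G (Inner e s))"
proof -
  have "(\<integral>x. G x \<partial>tree_measure T) = (\<integral>x. indicator (\<Union>e\<in>F. edge_region T e) x * G x \<partial>tree_measure T)"
  proof (rule integral_cong_AE)
    have "(\<Union>e\<in>F. edge_region T e) \<in> sets (tree_measure T)"
      using edge_regions_tree_sets[OF F(2)] by (simp add: sets_tree_measure)
    then show "(\<lambda>x. indicator (\<Union>e\<in>F. edge_region T e) x * G x) \<in> borel_measurable (tree_measure T)"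
      using G by (intro borel_measurable_times borel_measurable_indicator) auto
    have "AE x in tree_measure T. x \<in> points T" using AE_space[of "tree_measure T"] by (simp add: space_tree_measure)
    then show "AE x in tree_measure T. G x = indicator (\<Union>e\<in>F. edge_region T e) x * G x"
      using AE_not_vertex[of T]
    proof eventually_elim
      case (elim x)
      then obtain e s where x: "x = Inner e s" "e \<in> edges T" "s \<in> open_edge T e"
        by (auto simp: points_def open_edge_def)
      show ?case
      proof (cases "e \<in> F")
        case True
        then have "x \<in> (\<Union>e\<in>F. edge_region T e)" using x by (auto simp: edge_region_def)
        then show ?thesis by simp
      next
        case False
        then show ?thesis using z x by simp
      qed
    qed
  qed (rule borel_measurable_integrable[OF G])
  then show ?thesis using tree_integral_finite_edges[OF F G] by simp
qed

section \<open>Combinatorics of regular trees\<close>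

lemma joins_sym: "joins T e v w \<Longrightarrow> joins T e w v" by (auto simp: joins_def)

lemma joins_ends: "joins T e v w \<Longrightarrow> joins T e v' w' \<Longrightarrow> v' = v \<and> w' = w \<or> v' = w \<and> w' = v"
  by (auto simp: joins_def)

locale tree =
  fixes T :: "('v, 'e) metric_graph"
  assumes tree: "metric_tree T"
begin

lemma base_vert: "base T \<in> verts T" using tree by (simp add: metric_tree_def)
lemma joins_verts: "joins T e v w \<Longrightarrow> v \<in> verts T \<and> w \<in> verts T \<and> e \<in> edges T"
  using tree by (auto simp: metric_tree_def joins_def)
lemma len_pos: "e \<in> edges T \<Longrightarrow> 0 < len T e" using tree by (simp add: metric_tree_def)
lemma connected: "v \<in> verts T \<Longrightarrow> w \<in> verts T \<Longrightarrow> \<exists>es. walk T v es w" using tree by (simp add: metric_tree_def)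
lemma acyclic: "walk T v es v \<Longrightarrow> distinct es \<Longrightarrow> es = []" using tree unfolding metric_tree_def by blast

lemma walk_verts: "walk T v es w \<Longrightarrow> v \<in> verts T \<and> w \<in> verts T"
  by (induction rule: walk.induct) (auto dest: joins_verts)

lemma walk_Nil_iff: "walk T v [] w \<longleftrightarrow> v = w \<and> v \<in> verts T"
  by (auto elim: walk.cases intro: walk.intros)

lemma walk_Cons_iff: "walk T u (e # es) w \<longleftrightarrow> (\<exists>v. joins T e u v \<and> walk T v es w)"
  by (auto elim: walk.cases intro: walk.intros)

lemma walk_append_iff: "walk T u (xs @ ys) w \<longleftrightarrow> (\<exists>v. walk T u xs v \<and> walk T v ys w)"
  by (induction xs arbitrary: u) (auto simp: walk_Nil_iff walk_Cons_iff dest: walk_verts)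

lemma walk_single: "joins T e u v \<Longrightarrow> walk T u [e] v"
  by (auto simp: walk_Nil_iff walk_Cons_iff dest: joins_verts)

lemma walk_rev: "walk T v es w \<Longrightarrow> walk T w (rev es) v"
  by (induction rule: walk.induct) (auto simp: walk_Nil_iff walk_append_iff intro: walk_single joins_sym)

text \<open>
  A walk that uses an edge twice can be shortened: a detour is cut out if both passages have the same
  direction, and both passages are removed together with the detour otherwise.
\<close>

lemma walk_distinct:
  assumes "walk T v es w"
  obtains es' where "walk T v es' w" "set es' \<subseteq> set es" "distinct es'"
  using assms
proof (induction "length es" arbitrary: es thesis rule: less_induct)
  case less
  show ?case
  proof (cases "distinct es")
    case True then show ?thesis using less by blast
  next
    case False
    then obtain xs a ys zs where es: "es = xs @ [a] @ ys @ [a] @ zs" using not_distinct_decomp by blast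
    obtain p1 p2 q1 q2 where w: "walk T v xs p1" "joins T a p1 p2" "walk T p2 ys q1" "joins T a q1 q2" "walk T q2 zs w"
      using less.prems(2) unfolding es by (auto simp: walk_append_iff walk_Cons_iff)
    consider "q1 = p1" "q2 = p2" | "q1 = p2" "q2 = p1" using joins_ends[OF w(2,4)] by blast
    then obtain es' where es': "walk T v es' w" "length es' < length es" "set es' \<subseteq> set es"
    proof cases
      case 1
      then have "walk T v (xs @ [a] @ zs) w" using w by (auto simp: walk_append_iff walk_Cons_iff)
      then show ?thesis by (rule that) (auto simp: es)
    next
      case 2
      then have "walk T v (xs @ zs) w" using w by (auto simp: walk_append_iff)
      then show ?thesis by (rule that) (auto simp: es)
    qed
    show ?thesis
    proof (rule less.hyps[OF es'(2) _ es'(1)])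
      fix es'' assume "walk T v es'' w" "set es'' \<subseteq> set es'" "distinct es''"
      then show ?thesis using less.prems(1) es'(3) by blast
    qed
  qed
qed

text \<open>
  Otherwise the edge together with a walk of distinct edges between its ends would be a cycle.
\<close>

lemma walk_uses_edge:
  assumes "joins T e v w" "walk T v es w"
  shows "e \<in> set es"
proof (rule ccontr)
  assume e: "e \<notin> set es"
  obtain es' where es': "walk T v es' w" "set es' \<subseteq> set es" "distinct es'" using walk_distinct[OF assms(2)] .
  have "walk T w (e # es') w" using es' assms(1) by (auto simp: walk_Cons_iff intro: joins_sym)
  then show False using acyclic[of w "e # es'"] es' e by auto
qed

abbreviation "gen \<equiv> generation T"

lemma gen_le: "walk T (base T) es v \<Longrightarrow> gen v \<le> length es"
  unfolding generation_def by (rule Least_le) auto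

lemma geodesic:
  assumes "v \<in> verts T" obtains es where "walk T (base T) es v" "length es = gen v"
proof -
  have "\<exists>n es. walk T (base T) es v \<and> length es = n" using connected[OF base_vert assms] by auto
  from LeastI_ex[OF this] show ?thesis using that unfolding generation_def by blast
qed

text \<open>
  The walk up to the edge bounds the generation of the end where it is entered, and one more step that of
  the other end.
\<close>

lemma geodesic_edge:
  assumes "walk T (base T) es v" "length es = gen v" "e \<in> set es" "joins T e p q"
  shows "gen p < gen v \<and> gen q \<le> gen v \<or> gen q < gen v \<and> gen p \<le> gen v"
proof -
  obtain xs ys where es: "es = xs @ [e] @ ys" using assms(3) by (metis append_Cons append_Nil split_list)
  then obtain a c where w: "walk T (base T) xs a" "joins T e a c" "walk T (base T) (xs @ [e]) c"
    using assms(1) by (auto simp: walk_append_iff walk_Cons_iff walk_Nil_iff) (metis joins_verts)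
  have "gen a < gen v" "gen c \<le> gen v" using gen_le[OF w(1)] gen_le[OF w(3)] assms(2) es by auto
  then show ?thesis using joins_ends[OF w(2) assms(4)] by auto
qed

text \<open>
  If the ends had the same generation, the walk through the base along two shortest walks would avoid the
  edge, contradicting \<open>walk_uses_edge\<close>.
\<close>

lemma joins_gen:
  assumes j: "joins T e v w"
  shows "gen w = Suc (gen v) \<or> gen v = Suc (gen w)"
proof -
  have V: "v \<in> verts T" "w \<in> verts T" using joins_verts[OF j] by auto
  obtain xs where xs: "walk T (base T) xs v" "length xs = gen v" using geodesic[OF V(1)] .
  obtain ys where ys: "walk T (base T) ys w" "length ys = gen w" using geodesic[OF V(2)] .
  have "gen w \<le> Suc (gen v)" using gen_le[of "xs @ [e]" w] xs walk_single[OF j] by (auto simp: walk_append_iff)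
  moreover have "gen v \<le> Suc (gen w)"
    using gen_le[of "ys @ [e]" v] ys walk_single[OF joins_sym[OF j]] by (auto simp: walk_append_iff)
  moreover have "gen v \<noteq> gen w"
  proof
    assume eq: "gen v = gen w"
    have "walk T v (rev xs @ ys) w" using walk_rev[OF xs(1)] ys by (auto simp: walk_append_iff)
    from walk_uses_edge[OF j this] have "e \<in> set xs \<or> e \<in> set ys" by simp
    then show False using geodesic_edge[OF xs _ j] geodesic_edge[OF ys _ j] eq by auto
  qed
  ultimately show ?thesis by linarith
qed

definition parents :: "'v \<Rightarrow> 'e set" where
  "parents v = {e. \<exists>w. joins T e w v \<and> gen v = Suc (gen w)}"

text \<open>
  Two edges to the preceding generation would give a walk between the ends of one of them, through the
  other one and the base, that avoids it.
\<close>

lemma parents_unique: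
  assumes "e \<in> parents v" "e' \<in> parents v" shows "e = e'"
proof (rule ccontr)
  assume ne: "e \<noteq> e'"
  obtain w where w: "joins T e w v" "gen v = Suc (gen w)" using assms by (auto simp: parents_def)
  obtain w' where w': "joins T e' w' v" "gen v = Suc (gen w')" using assms by (auto simp: parents_def)
  have V: "w \<in> verts T" "w' \<in> verts T" using joins_verts w w' by auto
  obtain xs where xs: "walk T (base T) xs w" "length xs = gen w" using geodesic[OF V(1)] .
  obtain ys where ys: "walk T (base T) ys w'" "length ys = gen w'" using geodesic[OF V(2)] .
  have "walk T v (e # rev xs @ ys) w'"
    using walk_rev[OF xs(1)] ys joins_sym[OF w(1)] by (auto simp: walk_append_iff walk_Cons_iff)
  from walk_uses_edge[OF joins_sym[OF w'(1)] this] ne have "e' \<in> set xs \<or> e' \<in> set ys" by simp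
  then show False using geodesic_edge[OF xs _ w'(1)] geodesic_edge[OF ys _ w'(1)] w w' by auto
qed

lemma parents_empty_iff:
  assumes v: "v \<in> verts T" shows "parents v = {} \<longleftrightarrow> gen v = 0"
proof
  assume p: "parents v = {}"
  show "gen v = 0"
  proof (rule ccontr)
    assume "gen v \<noteq> 0"
    obtain xs where xs: "walk T (base T) xs v" "length xs = gen v" using geodesic[OF v] .
    then obtain ys e where es: "xs = ys @ [e]" using \<open>gen v \<noteq> 0\<close> by (metis length_0_conv rev_exhaust)
    then obtain w where w: "walk T (base T) ys w" "joins T e w v" using xs by (auto simp: walk_append_iff walk_Cons_iff walk_Nil_iff)
    have "gen w < gen v" using gen_le[OF w(1)] xs es by auto
    then have "gen v = Suc (gen w)" using joins_gen[OF w(2)] by auto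
    then show False using p w by (auto simp: parents_def)
  qed
qed (auto simp: parents_def)

lemma incident_edges:
  assumes v: "v \<in> verts T"
  shows "{e \<in> edges T. v \<in> {src T e, dst T e}} = emanating T v \<union> parents v" "emanating T v \<inter> parents v = {}"
proof -
  show "{e \<in> edges T. v \<in> {src T e, dst T e}} = emanating T v \<union> parents v"
  proof
    show "{e \<in> edges T. v \<in> {src T e, dst T e}} \<subseteq> emanating T v \<union> parents v"
    proof
      fix e assume "e \<in> {e \<in> edges T. v \<in> {src T e, dst T e}}"
      then obtain w where j: "joins T e v w" by (auto simp: joins_def)
      show "e \<in> emanating T v \<union> parents v"
        using joins_gen[OF j] j joins_sym[OF j] by (auto simp: emanating_def parents_def)
    qed
    show "emanating T v \<union> parents v \<subseteq> {e \<in> edges T. v \<in> {src T e, dst T e}}"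
      by (auto simp: emanating_def parents_def joins_def)
  qed
  show "emanating T v \<inter> parents v = {}"
    by (auto simp: emanating_def parents_def joins_def)
qed

text \<open>
  The generation of the end nearer to the base; the parametrization of the edge may start at either
  end.
\<close>

definition egen :: "'e \<Rightarrow> nat" where "egen e = min (gen (src T e)) (gen (dst T e))"

lemma joins_src_dst: "e \<in> edges T \<Longrightarrow> joins T e (src T e) (dst T e)" by (auto simp: joins_def)

lemma edge_ends:
  assumes e: "e \<in> edges T"
  obtains "gen (src T e) = egen e" "gen (dst T e) = Suc (egen e)" "e \<in> emanating T (src T e)" "e \<in> parents (dst T e)"
  | "gen (dst T e) = egen e" "gen (src T e) = Suc (egen e)" "e \<in> emanating T (dst T e)" "e \<in> parents (src T e)"
proof -
  note j = joins_src_dst[OF e]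
  show ?thesis using joins_gen[OF j]
  proof
    assume "gen (dst T e) = Suc (gen (src T e))"
    then show ?thesis using j by (intro that(1)) (auto simp: egen_def emanating_def parents_def)
  next
    assume "gen (src T e) = Suc (gen (dst T e))"
    then show ?thesis using joins_sym[OF j] by (intro that(2)) (auto simp: egen_def emanating_def parents_def)
  qed
qed

lemma egen_emanating: "e \<in> emanating T v \<Longrightarrow> e \<in> edges T \<and> egen e = gen v"
  using joins_verts by (fastforce simp: emanating_def egen_def joins_def)

end

locale regular_tree =
  fixes T :: "('v, 'e) metric_graph" and b :: "nat \<Rightarrow> nat" and r :: "nat \<Rightarrow> real"
  assumes regular: "regular_metric_tree T b r"

sublocale regular_tree \<subseteq> tree T
  using regular by unfold_locales (simp add: regular_metric_tree_def)

context regular_tree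
begin

lemma b0: "b 0 = 1" and b2: "n \<ge> 1 \<Longrightarrow> b n \<ge> 2" and r0: "r 0 = 0" and r_mono: "strict_mono r"
  and card_emanating: "v \<in> verts T \<Longrightarrow> card (emanating T v) = b (gen v)"
  using regular by (auto simp: regular_metric_tree_def)

lemma b_pos: "b n > 0" using b0 b2[of n] by (cases "n = 0") auto

lemma finite_emanating: "v \<in> verts T \<Longrightarrow> finite (emanating T v)" "v \<in> verts T \<Longrightarrow> emanating T v \<noteq> {}"
  using card_emanating[of v] b_pos[of "gen v"] by (metis card.infinite card.empty less_irrefl)+

lemma len_eq: assumes e: "e \<in> edges T" shows "len T e = r (Suc (egen e)) - r (egen e)"
  by (rule edge_ends[OF e]) (use regular joins_verts[OF joins_src_dst[OF e]] in \<open>auto simp: regular_metric_tree_def\<close>)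

lemma finite_gen: "finite {v \<in> verts T. gen v = n}"
proof (induction n)
  case 0
  have "{v \<in> verts T. gen v = 0} \<subseteq> {base T}" using regular by (auto simp: regular_metric_tree_def)
  then show ?case by (meson finite.simps finite_subset)
next
  case (Suc n)
  have "{v \<in> verts T. gen v = Suc n} \<subseteq>
     (\<Union>u\<in>{v \<in> verts T. gen v = n}. src T ` emanating T u \<union> dst T ` emanating T u)"
  proof
    fix v assume v: "v \<in> {v \<in> verts T. gen v = Suc n}"
    then obtain e where "e \<in> parents v" using parents_empty_iff[of v] by auto
    then obtain w where w: "joins T e w v" "gen v = Suc (gen w)" by (auto simp: parents_def)
    then have "e \<in> emanating T w" by (auto simp: emanating_def)
    then show "v \<in> (\<Union>u\<in>{v \<in> verts T. gen v = n}. src T ` emanating T u \<union> dst T ` emanating T u)"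
      using w v joins_verts[OF w(1)] by (auto simp: joins_def)
  qed
  moreover have "finite (\<Union>u\<in>{v \<in> verts T. gen v = n}. src T ` emanating T u \<union> dst T ` emanating T u)"
    using Suc finite_emanating by auto
  ultimately show ?case by (rule finite_subset)
qed

lemma finite_gen_less: "finite {v \<in> verts T. gen v < n}"
proof -
  have "{v \<in> verts T. gen v < n} = (\<Union>k<n. {v \<in> verts T. gen v = k})" by auto
  then show ?thesis using finite_gen by auto
qed

lemma finite_egen_less: "finite {e \<in> edges T. egen e < n}"
proof -
  have "{e \<in> edges T. egen e < n} \<subseteq> (\<Union>v\<in>{v \<in> verts T. gen v < n}. emanating T v)"
  proof
    fix e assume e: "e \<in> {e \<in> edges T. egen e < n}"
    then have e': "e \<in> edges T" by auto
    show "e \<in> (\<Union>v\<in>{v \<in> verts T. gen v < n}. emanating T v)"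
      by (rule edge_ends[OF e']) (use e joins_verts[OF joins_src_dst[OF e']] in auto)
  qed
  then show ?thesis using finite_gen_less finite_emanating by (auto intro: finite_subset)
qed

lemma parents_singleton:
  assumes "v \<in> verts T" "gen v \<noteq> 0"
  obtains e where "parents v = {e}" "e \<in> edges T" "Suc (egen e) = gen v"
proof -
  obtain e where e: "e \<in> parents v" using parents_empty_iff[OF assms(1)] assms(2) by blast
  then have "parents v = {e}" using parents_unique by auto
  moreover have "e \<in> edges T" "Suc (egen e) = gen v"
    using e by (auto simp: parents_def egen_def joins_def)
  ultimately show ?thesis by (rule that)
qed

end

section \<open>Decay at infinity\<close>

context tree
begin

lemma edge_point_points: "e \<in> edges T \<Longrightarrow> s \<in> {0..len T e} \<Longrightarrow> edge_point T e s \<in> points T"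
  using joins_verts[OF joins_src_dst] by (auto simp: edge_point_def points_def)

lemma edge_point_simps: "edge_point T e 0 = Vertex (src T e)"
   "e \<in> edges T \<Longrightarrow> edge_point T e (len T e) = Vertex (dst T e)"
   "s \<in> open_edge T e \<Longrightarrow> edge_point T e s = Inner e s"
  using len_pos[of e] by (auto simp: edge_point_def open_edge_def)

lemma path_length_nonneg: "path_of_length T x y a \<Longrightarrow> a \<ge> 0"
  by (induction rule: path_of_length.induct) auto

lemma path_dist_edge:
  assumes "e \<in> edges T" "s \<in> {0..len T e}" "t \<in> {0..len T e}"
  shows "path_dist T (edge_point T e s) (edge_point T e t) \<le> \<bar>t - s\<bar>"
  unfolding path_dist_def
proof (rule cInf_lower)
  show "\<bar>t - s\<bar> \<in> {a. path_of_length T (edge_point T e s) (edge_point T e t) a}"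
    using path_segment[OF path_trivial[OF edge_point_points[OF assms(1,2)]] assms] by simp
  show "bdd_below {a. path_of_length T (edge_point T e s) (edge_point T e t) a}"
    by (rule bdd_belowI[of _ 0]) (auto dest: path_length_nonneg)
qed

lemma edge_restriction_continuous:
  assumes h: "continuous_on_tree T h" and e: "e \<in> edges T"
  shows "continuous_on {0..len T e} (edge_restriction T h e)"
  unfolding continuous_on_iff dist_real_def
proof (intro ballI allI impI)
  fix s \<epsilon> :: real assume s: "s \<in> {0..len T e}" and "\<epsilon> > 0"
  then obtain d where d: "d > 0" "\<And>y. y \<in> points T \<Longrightarrow> path_dist T (edge_point T e s) y < d \<Longrightarrow> \<bar>h y - h (edge_point T e s)\<bar> < \<epsilon>"
    using h edge_point_points[OF e s] unfolding continuous_on_tree_def by blast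
  show "\<exists>d>0. \<forall>t\<in>{0..len T e}. \<bar>t - s\<bar> < d \<longrightarrow> \<bar>edge_restriction T h e t - edge_restriction T h e s\<bar> < \<epsilon>"
  proof (intro exI[of _ d] conjI ballI impI d(1))
    fix t assume t: "t \<in> {0..len T e}" "\<bar>t - s\<bar> < d"
    show "\<bar>edge_restriction T h e t - edge_restriction T h e s\<bar> < \<epsilon>"
      unfolding edge_restriction_def
      using d(2)[OF edge_point_points[OF e t(1)]] path_dist_edge[OF e s t(1)] t(2) by auto
  qed
qed

lemma set_integral_nonneg_real:
  fixes F :: "real \<Rightarrow> real"
  assumes "\<And>s. F s \<ge> 0" shows "0 \<le> (LINT s:A|lebesgue. F s)"
  unfolding set_lebesgue_integral_def by (rule integral_nonneg_AE) (use assms in auto)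

definition far_end :: "'e \<Rightarrow> 'v" where
  "far_end e = (if gen (src T e) = egen e then dst T e else src T e)"

lemma far_end_gen: "e \<in> edges T \<Longrightarrow> gen (far_end e) = Suc (egen e) \<and> far_end e \<in> verts T"
  using edge_ends[of e] joins_verts[OF joins_src_dst, of e] by (metis n_not_Suc_n far_end_def)

lemma far_end_point: "e \<in> edges T \<Longrightarrow> \<exists>s\<in>{0..len T e}. edge_point T e s = Vertex (far_end e)"
  using len_pos[of e] edge_point_simps(1)[of e] edge_point_simps(2)[of e] unfolding far_end_def
  by (auto intro: bexI[of _ 0] bexI[of _ "len T e"])

lemma emanating_point:
  assumes "e \<in> emanating T v" shows "\<exists>s\<in>{0..len T e}. edge_point T e s = Vertex v"
proof -
  have e: "e \<in> edges T" using egen_emanating[OF assms] by simp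
  have "v = src T e \<or> v = dst T e" using assms by (auto simp: emanating_def joins_def)
  then show ?thesis using len_pos[OF e] edge_point_simps(1)[of e] edge_point_simps(2)[of e] e
    by (auto intro: bexI[of _ 0] bexI[of _ "len T e"])
qed

lemma H1_weak_deriv:
  assumes h: "h \<in> H1_tree T" and e: "e \<in> edges T"
  shows "has_weak_deriv (open_edge T e) (edge_restriction T h e) (weak_deriv (open_edge T e) (edge_restriction T h e))"
    "weak_deriv (open_edge T e) (edge_restriction T h e) \<in> L2 (lebesgue_on (open_edge T e))"
proof -
  have "\<exists>g. has_weak_deriv (open_edge T e) (edge_restriction T h e) g"
    using h e by (auto simp: H1_tree_def)
  then show "has_weak_deriv (open_edge T e) (edge_restriction T h e) (weak_deriv (open_edge T e) (edge_restriction T h e))"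
    unfolding weak_deriv_def by (rule someI_ex)
  have "tree_deriv T h \<in> L2 (tree_measure T)" using h by (simp add: H1_tree_def)
  from edge_L2[OF e this]
  show "weak_deriv (open_edge T e) (edge_restriction T h e) \<in> L2 (lebesgue_on (open_edge T e))" by simp
qed

text \<open>
  Every point leaves the union of the edges beyond generation \<open>n\<close> once \<open>n\<close> is large.
\<close>

lemma tail_integral_tendsto:
  fixes G :: "('v, 'e) point \<Rightarrow> real"
  assumes G: "integrable (tree_measure T) G"
  shows "(\<lambda>n. \<integral>x. indicator (\<Union>e\<in>{e \<in> edges T. egen e \<ge> n}. edge_region T e) x * G x \<partial>tree_measure T) \<longlonglongrightarrow> 0"
proof -
  let ?U = "\<lambda>n. \<Union>e\<in>{e \<in> edges T. egen e \<ge> n}. edge_region T e"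
  have "(\<lambda>n. \<integral>x. indicator (?U n) x * G x \<partial>tree_measure T) \<longlonglongrightarrow> (\<integral>x. 0 \<partial>tree_measure T)"
  proof (rule integral_dominated_convergence)
    show "integrable (tree_measure T) (\<lambda>x. norm (G x))" using G by (rule integrable_norm)
    show "(\<lambda>x. indicator (?U n) x * G x) \<in> borel_measurable (tree_measure T)" for n
      using G edge_regions_tree_sets[of "{e \<in> edges T. egen e \<ge> n}" T]
      by (intro borel_measurable_times borel_measurable_indicator) (auto simp: sets_tree_measure)
    show "AE x in tree_measure T. (\<lambda>n. indicator (?U n) x * G x) \<longlonglongrightarrow> 0"
    proof (rule AE_I2, rule tendsto_eventually)
      fix x :: "('v, 'e) point"
      obtain N where N: "\<And>n. n \<ge> N \<Longrightarrow> x \<notin> ?U n"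
      proof (cases x)
        case (Inner e s)
        show ?thesis by (rule that[of "Suc (egen e)"]) (auto simp: Inner edge_region_def)
      next
        case (Vertex v)
        show ?thesis by (rule that[of 0]) (auto simp: Vertex edge_region_def)
      qed
      show "\<forall>\<^sub>F n in sequentially. indicator (?U n) x * G x = 0"
        using eventually_ge_at_top[of N] by eventually_elim (use N in simp)
    qed
    show "AE x in tree_measure T. norm (indicator (?U n) x * G x) \<le> norm (G x)" for n
      by (rule AE_I2) (simp add: indicator_def)
  qed simp
  then show ?thesis by simp
qed

end

locale spreading_tree = regular_tree +
  assumes mono_b: "mono b" and antimono_len: "antimono (\<lambda>n. r (Suc n) - r n)"
    and unbounded: "\<And>C. \<exists>n. r n \<ge> C"
begin

lemma len_le: "r (Suc n) - r n \<le> r 1"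
  using antimonoD[OF antimono_len, of 0 n] r0 by simp

lemma r1_pos: "r 1 > 0" using strict_monoD[OF r_mono, of 0 1] r0 by simp

lemma descending_ray:
  assumes e: "e \<in> edges T"
  obtains E where "E 0 = e" "\<And>i. E i \<in> edges T" "\<And>i. egen (E i) = egen e + i"
    "\<And>i. E (Suc i) \<in> emanating T (far_end (E i))"
proof -
  define nx where "nx = (\<lambda>e. SOME e'. e' \<in> emanating T (far_end e))"
  have nx: "nx e \<in> emanating T (far_end e)" if "e \<in> edges T" for e
    unfolding nx_def by (rule someI_ex) (use finite_emanating(2)[of "far_end e"] far_end_gen[OF that] in auto)
  define E where "E i = (nx ^^ i) e" for i
  have E: "E i \<in> edges T" for i
    by (induction i) (use e egen_emanating[OF nx] in \<open>auto simp: E_def\<close>)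
  have em: "E (Suc i) \<in> emanating T (far_end (E i))" for i using nx[OF E[of i]] by (simp add: E_def)
  have "egen (E i) = egen e + i" for i
  proof (induction i)
    case (Suc i) then show ?case using egen_emanating[OF em[of i]] far_end_gen[OF E[of i]] by simp
  qed (simp add: E_def)
  then show ?thesis using that[of E] E em by (simp add: E_def)
qed

text \<open>
  From a point with a large value a ray of edges descends; since the tree has
  infinite height, it can be followed over a length between \<open>1\<close> and \<open>1 + r 1\<close>. Along it the function
  either stays large, or drops and therefore has a derivative with large square integral. Both
  contradict the smallness of the tail of \<open>\<integral> h\<^sup>2 + (h')\<^sup>2\<close>.
\<close>

lemma H1_decay:
  assumes h: "h \<in> H1_tree T" and eps: "\<epsilon> > 0"
  obtains N where "\<And>e s. e \<in> edges T \<Longrightarrow> egen e \<ge> N \<Longrightarrow> s \<in> {0..len T e} \<Longrightarrow> \<bar>h (edge_point T e s)\<bar> \<le> \<epsilon>"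
proof -
  define p where "p e = weak_deriv (open_edge T e) (edge_restriction T h e)" for e
  define G where "G = (\<lambda>x. (h x)\<^sup>2 + (tree_deriv T h x)\<^sup>2)"
  have hL: "h \<in> L2 (tree_measure T)" "tree_deriv T h \<in> L2 (tree_measure T)" and hc: "continuous_on_tree T h"
    using h by (auto simp: H1_tree_def)
  have G: "integrable (tree_measure T) G" "\<And>x. G x \<ge> 0" using hL by (auto simp: G_def L2_def)
  define C where "C = 1 + r 1"
  have C: "C \<ge> 1" using r1_pos by (simp add: C_def)
  let ?U = "\<lambda>n. \<Union>e\<in>{e \<in> edges T. egen e \<ge> n}. edge_region T e"
  let ?\<tau> = "\<lambda>n. \<integral>x. indicator (?U n) x * G x \<partial>tree_measure T"
  have "\<epsilon>\<^sup>2 / (4 * C) > 0" using eps C by simp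
  from order_tendstoD(2)[OF tail_integral_tendsto[OF G(1)] this]
  obtain N where N: "?\<tau> N < \<epsilon>\<^sup>2 / (4 * C)" by (auto simp: eventually_sequentially)
  show thesis
  proof (rule that[of N], rule ccontr)
    fix e0 s0 assume e0: "e0 \<in> edges T" "egen e0 \<ge> N" "s0 \<in> {0..len T e0}" and big: "\<not> \<bar>h (edge_point T e0 s0)\<bar> \<le> \<epsilon>"
    obtain E where E: "E 0 = e0" "\<And>i. E i \<in> edges T" "\<And>i. egen (E i) = egen e0 + i"
      "\<And>i. E (Suc i) \<in> emanating T (far_end (E i))"
      using descending_ray[OF e0(1)] by blast
    define L where "L m = r (egen e0 + Suc m) - r (egen e0)" for m
    have lenE: "len T (E i) = r (egen e0 + Suc i) - r (egen e0 + i)" for i using len_eq[OF E(2), of i] E(3) by simp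
    have sumlen: "(\<Sum>i\<le>m. len T (E i)) = L m" for m by (induction m) (auto simp: L_def lenE)
    have "\<exists>m. L m \<ge> 1"
    proof -
      obtain n where "r n \<ge> 1 + r (egen e0)" using unbounded by blast
      moreover have "r (egen e0 + Suc n) \<ge> r n" by (simp add: strict_mono_less_eq[OF r_mono])
      ultimately show ?thesis by (intro exI[of _ n]) (simp add: L_def)
    qed
    then obtain m where m0: "L m \<ge> 1" "\<forall>k<m. \<not> L k \<ge> 1"
      using exists_least_iff[of "\<lambda>m. L m \<ge> 1"] by blast
    then have m: "L m \<ge> 1" "\<And>k. k < m \<Longrightarrow> L k < 1" by (auto simp: not_le)
    \<comment> \<open>Edges are no longer than \<open>r 1\<close>, so the first length beyond \<open>1\<close> overshoots by at most \<open>r 1\<close>.\<close>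
    have LC: "L m \<le> C"
    proof (cases m)
      case 0 then show ?thesis using len_le[of "egen e0"] by (simp add: L_def C_def)
    next
      case (Suc k) then show ?thesis using m(2)[of k] len_le[of "egen e0 + Suc k"] by (simp add: L_def C_def)
    qed
    let ?I = "\<lambda>e F. LINT s:open_edge T e|lebesgue. F s"
    have inE: "set_integrable lebesgue (open_edge T e) (\<lambda>s. (h (Inner e s))\<^sup>2)"
      "set_integrable lebesgue (open_edge T e) (\<lambda>s. (p e s)\<^sup>2)" if "e \<in> edges T" for e
      using edge_integrable[OF that, of "\<lambda>x. (h x)\<^sup>2"] edge_integrable[OF that, of "\<lambda>x. (tree_deriv T h x)\<^sup>2"] hL
      by (auto simp: L2_def p_def set_integrable_def integrable_restrict_space open_edge_lebesgue)
    have const: "set_integrable lebesgue (open_edge T e) (\<lambda>s. c)" "?I e (\<lambda>s. c) = len T e * c"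
      if "e \<in> edges T" for e and c :: real
      using len_pos[OF that] by (auto simp: open_edge_def set_integrable_def set_lebesgue_integral_def)
    \<comment> \<open>The parameter in \<open>2 * \<bar>p\<bar> \<le> \<delta> + p\<^sup>2 / \<delta>\<close>, chosen such that the oscillation along
      the ray is at most \<open>\<epsilon> / 2\<close>.\<close>
    define \<delta> where "\<delta> = \<epsilon> / (2 * C)"
    have \<delta>: "\<delta> > 0" using eps C by (simp add: \<delta>_def)
    define osc where "osc e = ?I e (\<lambda>s. \<bar>p e s\<bar>)" for e
    have osc_le: "osc e \<le> \<delta> / 2 * len T e + ?I e (\<lambda>s. (p e s)\<^sup>2) / (2 * \<delta>)" if e: "e \<in> edges T" for e
    proof -
      have i2: "set_integrable lebesgue (open_edge T e) (\<lambda>s. (p e s)\<^sup>2 / (2 * \<delta>))"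
        by (rule set_integrable_divide) (rule inE(2)[OF e])
      have "osc e \<le> ?I e (\<lambda>s. \<delta> / 2 + (p e s)\<^sup>2 / (2 * \<delta>))"
        unfolding osc_def
      proof (rule set_integral_mono)
        show "set_integrable lebesgue (open_edge T e) (\<lambda>s. \<bar>p e s\<bar>)"
          using L2_interval_absolutely_integrable[of "p e" "len T e"] H1_weak_deriv(2)[OF h e]
          by (intro set_integrable_abs) (simp add: p_def open_edge_def absolutely_integrable_on_Icc_iff_Ioo)
        show "set_integrable lebesgue (open_edge T e) (\<lambda>s. \<delta> / 2 + (p e s)\<^sup>2 / (2 * \<delta>))"
          by (intro set_integral_add const e i2)
        show "\<bar>p e s\<bar> \<le> \<delta> / 2 + (p e s)\<^sup>2 / (2 * \<delta>)" for s
        proof -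
          have "0 \<le> (\<bar>p e s\<bar> - \<delta>)\<^sup>2" by simp
          then have "2 * \<delta> * \<bar>p e s\<bar> \<le> \<delta>\<^sup>2 + (p e s)\<^sup>2" by (simp add: power2_diff algebra_simps)
          then show ?thesis using \<delta> by (simp add: field_simps power2_eq_square)
        qed
      qed
      also have "\<dots> = \<delta> / 2 * len T e + ?I e (\<lambda>s. (p e s)\<^sup>2) / (2 * \<delta>)"
        using const[OF e, of "\<delta> / 2"] i2 by (subst set_integral_add) auto
      finally show ?thesis .
    qed
    have osc: "\<bar>h (edge_point T e t) - h (edge_point T e s)\<bar> \<le> osc e" if "e \<in> edges T" "s \<in> {0..len T e}" "t \<in> {0..len T e}" for e s t
      using edge_oscillation[OF len_pos[OF that(1)] edge_restriction_continuous[OF hc that(1)] _ _ that(2,3), of "p e"]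
        H1_weak_deriv[OF h that(1)] by (simp add: p_def osc_def open_edge_def edge_restriction_def)
    have ray: "\<bar>h (edge_point T (E k) t) - h (edge_point T e0 s0)\<bar> \<le> (\<Sum>i\<le>k. osc (E i))" if "t \<in> {0..len T (E k)}" for k t
      using that
    proof (induction k arbitrary: t)
      case 0 then show ?case using osc[OF e0(1,3)] E(1) by simp
    next
      case (Suc k)
      obtain s where s: "s \<in> {0..len T (E k)}" "edge_point T (E k) s = Vertex (far_end (E k))" using far_end_point[OF E(2)] by blast
      obtain s' where s': "s' \<in> {0..len T (E (Suc k))}" "edge_point T (E (Suc k)) s' = Vertex (far_end (E k))"
        using emanating_point[OF E(4)] by blast
      show ?case using Suc.IH[OF s(1)] osc[OF E(2) s'(1) Suc.prems] s(2) s'(2) by simp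
    qed
    have total: "(\<Sum>i\<le>m. ?I (E i) (\<lambda>s. (h (Inner (E i) s))\<^sup>2)) + (\<Sum>i\<le>m. ?I (E i) (\<lambda>s. (p (E i) s)\<^sup>2)) \<le> ?\<tau> N"
    proof -
      let ?F = "E ` {..m}"
      have inj: "inj_on E {..m}" by (rule inj_onI) (metis E(3) add_left_cancel)
      have F: "finite ?F" "?F \<subseteq> edges T" using E(2) by auto
      have "(\<Sum>i\<le>m. ?I (E i) (\<lambda>s. (h (Inner (E i) s))\<^sup>2)) + (\<Sum>i\<le>m. ?I (E i) (\<lambda>s. (p (E i) s)\<^sup>2))
         = (\<Sum>i\<le>m. ?I (E i) (\<lambda>s. G (Inner (E i) s)))"
        unfolding sum.distrib[symmetric]
        by (rule sum.cong) (use inE[OF E(2)] in \<open>auto simp: G_def p_def\<close>)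
      also have "\<dots> = (\<Sum>e\<in>?F. ?I e (\<lambda>s. G (Inner e s)))" by (simp add: sum.reindex[OF inj])
      also have "\<dots> = (\<integral>x. indicator (\<Union>e\<in>?F. edge_region T e) x * G x \<partial>tree_measure T)"
        by (rule tree_integral_finite_edges[OF F G(1), symmetric])
      also have "\<dots> \<le> ?\<tau> N"
      proof (rule integral_mono')
        have "?U N \<in> sets (tree_measure T)" using edge_regions_tree_sets[of "{e \<in> edges T. egen e \<ge> N}" T] by (auto simp: sets_tree_measure)
        from integrable_mult_indicator[OF this G(1)]
        show "integrable (tree_measure T) (\<lambda>x. indicator (?U N) x * G x)" by simp
        show "indicator (\<Union>e\<in>?F. edge_region T e) x * G x \<le> indicator (?U N) x * G x" for x
          using E(2,3) e0(2) G(2)[of x] by (fastforce simp: indicator_def)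
        show "0 \<le> indicator (?U N) x * G x" for x using G(2) by simp
      qed
      finally show ?thesis .
    qed
    have nn: "0 \<le> (\<Sum>i\<le>m. ?I (E i) (\<lambda>s. (h (Inner (E i) s))\<^sup>2))" "0 \<le> (\<Sum>i\<le>m. ?I (E i) (\<lambda>s. (p (E i) s)\<^sup>2))"
      by (auto intro!: sum_nonneg set_integral_nonneg_real)
    have "(\<Sum>i\<le>m. osc (E i)) \<le> (\<Sum>i\<le>m. \<delta> / 2 * len T (E i) + ?I (E i) (\<lambda>s. (p (E i) s)\<^sup>2) / (2 * \<delta>))"
      by (rule sum_mono) (rule osc_le[OF E(2)])
    also have "\<dots> = \<delta> / 2 * L m + (\<Sum>i\<le>m. ?I (E i) (\<lambda>s. (p (E i) s)\<^sup>2)) / (2 * \<delta>)"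
      by (simp add: sum.distrib sum_distrib_left[symmetric] sum_divide_distrib[symmetric] sumlen)
    also have "\<dots> \<le> \<delta> / 2 * C + (\<epsilon>\<^sup>2 / (4 * C)) / (2 * \<delta>)"
      using LC \<delta> total nn N by (intro add_mono mult_left_mono divide_right_mono) auto
    also have "\<dots> = \<epsilon> / 2" using eps C by (simp add: \<delta>_def field_simps power2_eq_square)
    finally have osum: "(\<Sum>i\<le>m. osc (E i)) \<le> \<epsilon> / 2" .
    have large: "\<bar>h (edge_point T (E k) t)\<bar> \<ge> \<epsilon> / 2" if "k \<le> m" "t \<in> {0..len T (E k)}" for k t
    proof -
      have "(\<Sum>i\<le>k. osc (E i)) \<le> (\<Sum>i\<le>m. osc (E i))"
        by (rule sum_mono2) (use that in \<open>auto simp: osc_def intro!: set_integral_nonneg_real\<close>)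
      then show ?thesis using ray[OF that(2)] osum big by linarith
    qed
    have "\<epsilon>\<^sup>2 / 4 \<le> \<epsilon>\<^sup>2 / 4 * L m" using mult_left_mono[OF m(1), of "\<epsilon>\<^sup>2 / 4"] by simp
    also have "\<dots> = (\<Sum>i\<le>m. len T (E i) * (\<epsilon>\<^sup>2 / 4))" by (simp add: sumlen[symmetric] sum_distrib_left mult.commute)
    also have "\<dots> \<le> (\<Sum>i\<le>m. ?I (E i) (\<lambda>s. (h (Inner (E i) s))\<^sup>2))"
    proof (rule sum_mono)
      fix i assume i: "i \<in> {..m}"
      have "?I (E i) (\<lambda>s. \<epsilon>\<^sup>2 / 4) \<le> ?I (E i) (\<lambda>s. (h (Inner (E i) s))\<^sup>2)"
      proof (rule set_integral_mono[OF const(1)[OF E(2)] inE(1)[OF E(2)]])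
        fix s assume s: "s \<in> open_edge T (E i)"
        then have "\<bar>h (Inner (E i) s)\<bar> \<ge> \<epsilon> / 2"
          using large[of i s] i edge_point_simps(3)[OF s] by (auto simp: open_edge_def)
        then have "(\<epsilon> / 2)\<^sup>2 \<le> \<bar>h (Inner (E i) s)\<bar>\<^sup>2" using eps by (intro power_mono) auto
        then show "\<epsilon>\<^sup>2 / 4 \<le> (h (Inner (E i) s))\<^sup>2" by (simp add: power_divide)
      qed
      then show "len T (E i) * (\<epsilon>\<^sup>2 / 4) \<le> ?I (E i) (\<lambda>s. (h (Inner (E i) s))\<^sup>2)" using const(2)[OF E(2)] by simp
    qed
    finally have "\<epsilon>\<^sup>2 / 4 < \<epsilon>\<^sup>2 / (4 * C)" using total nn N by linarith
    moreover have "\<epsilon>\<^sup>2 / (4 * C) \<le> \<epsilon>\<^sup>2 / 4" using C eps by (intro divide_left_mono) auto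
    ultimately show False by simp
  qed
qed

end

section \<open>Superharmonic radial functions\<close>

context tree
begin

text \<open>
  The interpolation is affine in the parameter of the edge and independent of its direction. Besides
  the supersolutions, the distance to the base is of this form: it is \<open>radial r\<close>.
\<close>

definition radial :: "(nat \<Rightarrow> real) \<Rightarrow> ('v, 'e) point \<Rightarrow> real" where
  "radial w x = (case x of Vertex v \<Rightarrow> w (gen v)
     | Inner e s \<Rightarrow> (1 - s / len T e) * w (gen (src T e)) + s / len T e * w (gen (dst T e)))"

lemma radial_edge:
  assumes e: "e \<in> edges T"
  shows "radial w (edge_point T e s) =
    w (gen (src T e)) + (w (gen (dst T e)) - w (gen (src T e))) / len T e * s"
  using len_pos[OF e] by (auto simp: edge_point_def radial_def field_simps)

text \<open>
  The outer derivative of \<open>radial w\<close> at the end \<open>v\<close> of \<open>e\<close>. Subtracting the generation of \<open>v\<close> from the sum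
  over both ends gives the generation of the other end.
\<close>

definition radial_flux :: "(nat \<Rightarrow> real) \<Rightarrow> 'e \<Rightarrow> 'v \<Rightarrow> real" where
  "radial_flux w e v = (w (gen v) - w (gen (src T e) + gen (dst T e) - gen v)) / len T e"

lemma outer_deriv_eq:
  assumes e: "e \<in> edges T"
    and P: "\<And>x. x \<in> {0..len T e} \<Longrightarrow> (edge_restriction T h e has_real_derivative P x) (at x within {0..len T e})"
  shows "outer_deriv T h e (dst T e) = P (len T e)" "outer_deriv T h e (src T e) = - P 0"
proof -
  have l: "0 < len T e" by (rule len_pos[OF e])
  have vd: "vector_derivative (edge_restriction T h e) (at x within {0..len T e}) = P x" if "x \<in> {0..len T e}" for x
    using vector_derivative_within_cbox[OF l, of x "edge_restriction T h e" "P x"] P[OF that] that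
    by (simp add: has_real_derivative_iff_has_vector_derivative)
  have "src T e \<noteq> dst T e" using joins_gen[OF joins_src_dst[OF e]] by auto
  then show "outer_deriv T h e (dst T e) = P (len T e)" "outer_deriv T h e (src T e) = - P 0"
    using vd l by (auto simp: outer_deriv_def)
qed

text \<open>
  The affine function \<open>radial w\<close> has no second derivative on the edge, so \<open>edge_energy_inequality\<close> applies to
  the difference \<open>h - radial w\<close>. The boundary terms are the outer derivatives at the two ends.
\<close>

lemma edge_flux_inequality:
  fixes w :: "nat \<Rightarrow> real"
  assumes h: "h \<in> laplacian_domain T" and e: "e \<in> edges T"
  defines "g \<equiv> \<lambda>x. (max 0 (h x - radial w x))\<^sup>2"
  shows "(LINT s:open_edge T e|lebesgue. g (Inner e s) * laplacian T h (Inner e s))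
    \<le> (\<Sum>v\<in>{src T e, dst T e}. g (Vertex v) * (outer_deriv T h e v - radial_flux w e v))"
proof -
  define l where "l = len T e"
  have l: "0 < l" using len_pos[OF e] by (simp add: l_def)
  have I: "open_edge T e = {0<..<l}" by (simp add: open_edge_def l_def)
  define v where "v = edge_restriction T h e"
  define p where "p = weak_deriv (open_edge T e) v"
  define q where "q = edge_deriv2 T h e"
  have hH: "h \<in> H1_tree T" and H2: "v \<in> H2_interval (open_edge T e)"
    using h e by (auto simp: laplacian_domain_def v_def)
  have contv: "continuous_on {0..l} v"
    using edge_restriction_continuous[OF _ e, of h] hH by (simp add: H1_tree_def v_def l_def)
  have wv: "has_weak_deriv {0<..<l} v p" using H1_weak_deriv(1)[OF hH e] by (simp add: I v_def p_def)
  have "p \<in> H1_interval (open_edge T e)" using H2 by (simp add: H2_interval_def p_def)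
  then have exg: "\<exists>g. has_weak_deriv (open_edge T e) p g" and q2: "q \<in> L2 (lebesgue_on {0<..<l})"
    by (auto simp: H1_interval_def q_def edge_deriv2_def p_def v_def I)
  have "has_weak_deriv (open_edge T e) p (weak_deriv (open_edge T e) p)"
    unfolding weak_deriv_def[of _ p] by (rule someI_ex[OF exg])
  then have wp: "has_weak_deriv {0<..<l} p q"
    by (simp add: q_def edge_deriv2_def p_def v_def I)
  have q: "q absolutely_integrable_on {0..l}" by (rule L2_interval_absolutely_integrable[OF q2])
  obtain P where P: "\<And>x. x \<in> {0..l} \<Longrightarrow> (v has_real_derivative P x) (at x within {0..l})"
    "\<And>x y. 0 \<le> x \<Longrightarrow> x \<le> y \<Longrightarrow> y \<le> l \<Longrightarrow> P y - P x = integral {x..y} q"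
    using edge_C1[OF l contv wv wp q2] by blast
  define \<sigma> where "\<sigma> = (w (gen (dst T e)) - w (gen (src T e))) / len T e"
  define z where "z s = v s - (w (gen (src T e)) + \<sigma> * s)" for s
  have z_eq: "z s = h (edge_point T e s) - radial w (edge_point T e s)" for s
    by (simp add: z_def v_def edge_restriction_def radial_edge[OF e] \<sigma>_def)
  have z': "(z has_real_derivative P s - \<sigma>) (at s within {0..l})" if "s \<in> {0..l}" for s
  proof -
    have "(z has_real_derivative P s - (0 + \<sigma> * 1)) (at s within {0..l})"
      unfolding z_def[abs_def] by (intro DERIV_diff DERIV_add DERIV_const DERIV_cmult DERIV_ident P that)
    then show ?thesis by simp
  qed
  have contz: "continuous_on {0..l} z" using z' by (rule DERIV_continuous_on)
  have prod: "(\<lambda>s. (max 0 (z s))\<^sup>2 * q s) absolutely_integrable_on {0..l}"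
    by (intro continuous_times_absolutely_integrable q continuous_intros contz)
  have "(LINT s:open_edge T e|lebesgue. g (Inner e s) * laplacian T h (Inner e s)) =
      (LINT s:{0<..<l}|lebesgue. (max 0 (z s))\<^sup>2 * q s)"
    unfolding I[symmetric]
    by (rule set_lebesgue_integral_cong) (auto simp: open_edge_lebesgue g_def z_eq edge_point_simps q_def)
  also have "\<dots> = integral {0<..<l} (\<lambda>s. (max 0 (z s))\<^sup>2 * q s)"
    by (rule set_lebesgue_integral_eq_integral) (use prod in \<open>simp add: absolutely_integrable_on_Icc_iff_Ioo\<close>)
  also have "\<dots> = integral {0..l} (\<lambda>s. (max 0 (z s))\<^sup>2 * q s)" by (simp add: integral_open_interval_real)
  also have "\<dots> \<le> (max 0 (z l))\<^sup>2 * (P l - \<sigma>) - (max 0 (z 0))\<^sup>2 * (P 0 - \<sigma>)"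
    by (rule edge_energy_inequality[OF l q z']) (use P(2) in auto)
  also have "\<dots> = g (Vertex (dst T e)) * (outer_deriv T h e (dst T e) - radial_flux w e (dst T e))
      + g (Vertex (src T e)) * (outer_deriv T h e (src T e) - radial_flux w e (src T e))"
  proof -
    have "g (Vertex (dst T e)) = (max 0 (z l))\<^sup>2" "g (Vertex (src T e)) = (max 0 (z 0))\<^sup>2"
      using edge_point_simps(1)[of e] edge_point_simps(2)[OF e] by (simp_all add: z_eq l_def g_def)
    moreover have "radial_flux w e (dst T e) = \<sigma>" "radial_flux w e (src T e) = - \<sigma>"
      by (simp_all add: radial_flux_def \<sigma>_def minus_divide_left)
    moreover have "outer_deriv T h e (dst T e) = P l" "outer_deriv T h e (src T e) = - P 0"
      using outer_deriv_eq[OF e, of h P] P(1) by (simp_all add: v_def l_def)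
    ultimately show ?thesis by (simp add: algebra_simps)
  qed
  also have "\<dots> = (\<Sum>v\<in>{src T e, dst T e}. g (Vertex v) * (outer_deriv T h e v - radial_flux w e v))"
  proof -
    have "src T e \<noteq> dst T e" using joins_gen[OF joins_src_dst[OF e]] by auto
    then show ?thesis by simp
  qed
  finally show ?thesis .
qed

end

context regular_tree
begin

text \<open>
  The condition says that the outer derivatives of \<open>radial w\<close> have a nonnegative sum
  at every vertex: one edge comes from the preceding generation and \<open>b n\<close> equal edges lead to the
  next one, while at the base there is a single edge.
\<close>

definition superharmonic :: "(nat \<Rightarrow> real) \<Rightarrow> bool" where
  "superharmonic w \<longleftrightarrow> w 1 \<le> w 0 \<and>
     (\<forall>n\<ge>1. (w (n - 1) - w n) / (r n - r (n - 1)) \<le> b n * ((w n - w (Suc n)) / (r (Suc n) - r n)))"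

lemma superharmonic_flux:
  assumes w: "superharmonic w" and v: "v \<in> verts T"
  shows "0 \<le> (\<Sum>e | e \<in> edges T \<and> v \<in> {src T e, dst T e}. radial_flux w e v)"
proof -
  have em: "radial_flux w e v = (w (gen v) - w (Suc (gen v))) / (r (Suc (gen v)) - r (gen v))"
    if e: "e \<in> emanating T v" for e
  proof -
    have "e \<in> edges T" "egen e = gen v" using egen_emanating[OF e] by auto
    moreover have "gen (src T e) + gen (dst T e) - gen v = Suc (gen v)" using e by (auto simp: emanating_def joins_def)
    ultimately show ?thesis using len_eq[of e] by (simp add: radial_flux_def)
  qed
  have "(\<Sum>e | e \<in> edges T \<and> v \<in> {src T e, dst T e}. radial_flux w e v) =
      (\<Sum>e\<in>emanating T v. radial_flux w e v) + (\<Sum>e\<in>parents v. radial_flux w e v)"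
    unfolding incident_edges(1)[OF v]
  proof (rule sum.union_disjoint)
    show "finite (parents v)"
      using parents_unique by (metis finite.emptyI finite_insert finite_subset insertCI subsetI equals0I)
  qed (use finite_emanating[OF v] incident_edges(2)[OF v] in auto)
  also have "(\<Sum>e\<in>emanating T v. radial_flux w e v) = b (gen v) * ((w (gen v) - w (Suc (gen v))) / (r (Suc (gen v)) - r (gen v)))"
    using em card_emanating[OF v] by simp
  finally have sum: "(\<Sum>e | e \<in> edges T \<and> v \<in> {src T e, dst T e}. radial_flux w e v) =
     b (gen v) * ((w (gen v) - w (Suc (gen v))) / (r (Suc (gen v)) - r (gen v))) + (\<Sum>e\<in>parents v. radial_flux w e v)" .
  show ?thesis
  proof (cases "gen v = 0")
    case True
    then have "parents v = {}" using parents_empty_iff[OF v] by simp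
    moreover have "w 1 \<le> w 0" using w by (simp add: superharmonic_def)
    moreover have "r 0 < r 1" using strict_monoD[OF r_mono, of 0 1] by simp
    ultimately show ?thesis using sum True by simp
  next
    case False
    obtain e where e: "parents v = {e}" "e \<in> edges T" "Suc (egen e) = gen v" using parents_singleton[OF v False] .
    have "gen (src T e) + gen (dst T e) - gen v = gen v - 1"
    proof -
      have "e \<in> parents v" using e by simp
      then show ?thesis by (auto simp: parents_def joins_def)
    qed
    then have "radial_flux w e v = - ((w (gen v - 1) - w (gen v)) / (r (gen v) - r (gen v - 1)))"
      using len_eq[OF e(2)] e(3)[symmetric] by (simp add: radial_flux_def minus_divide_left)
    then show ?thesis using sum e(1) w False by (simp add: superharmonic_def)
  qed
qed

end

context spreading_tree
begin

text \<open>
  An integrated form of Kato's inequality. The lower bound \<open>\<epsilon>\<close> of the weights together with \<open>H1_decay\<close> confines the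
  excess to finitely many edges. There the edge inequalities are summed, and the terms at each
  vertex are collected: the Kirchhoff condition removes the derivatives of \<open>h\<close>, and
  superharmonicity fixes the sign of the rest.
\<close>

lemma laplacian_excess_nonpos:
  assumes h: "h \<in> laplacian_domain T" and w: "superharmonic w" and pos: "\<epsilon> > 0" "\<And>n. w n \<ge> \<epsilon>"
    and int: "integrable (tree_measure T) (\<lambda>x. (max 0 (h x - radial w x))\<^sup>2 * laplacian T h x)"
  shows "(\<integral>x. (max 0 (h x - radial w x))\<^sup>2 * laplacian T h x \<partial>tree_measure T) \<le> 0"
proof -
  let ?g = "\<lambda>x. (max 0 (h x - radial w x))\<^sup>2"
  have hH: "h \<in> H1_tree T" using h by (simp add: laplacian_domain_def)
  obtain N where N: "\<And>e s. e \<in> edges T \<Longrightarrow> egen e \<ge> N \<Longrightarrow> s \<in> {0..len T e} \<Longrightarrow> \<bar>h (edge_point T e s)\<bar> \<le> \<epsilon>"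
    using H1_decay[OF hH pos(1)] by blast
  have rad: "radial w (edge_point T e s) \<ge> \<epsilon>" if e: "e \<in> edges T" and s: "s \<in> {0..len T e}" for e s
  proof -
    define t where "t = s / len T e"
    have t: "0 \<le> t" "t \<le> 1" using s len_pos[OF e] by (auto simp: t_def field_simps)
    have "radial w (edge_point T e s) = (1 - t) * w (gen (src T e)) + t * w (gen (dst T e))"
      using len_pos[OF e] by (simp add: radial_edge[OF e] t_def field_simps)
    moreover have "(1 - t) * \<epsilon> + t * \<epsilon> \<le> (1 - t) * w (gen (src T e)) + t * w (gen (dst T e))"
      using t pos(2) by (intro add_mono mult_left_mono) auto
    ultimately show ?thesis by (simp add: algebra_simps)
  qed
  have far: "?g (edge_point T e s) = 0" if "e \<in> edges T" "egen e \<ge> N" "s \<in> {0..len T e}" for e s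
    using N[OF that] rad[OF that(1,3)] by simp
  have farv: "?g (Vertex v) = 0" if v: "v \<in> verts T" "gen v \<ge> N" for v
  proof -
    obtain e where e: "e \<in> emanating T v" using finite_emanating(2)[OF v(1)] by blast
    obtain s where "s \<in> {0..len T e}" "edge_point T e s = Vertex v" using emanating_point[OF e] by blast
    then show ?thesis using far[of e s] egen_emanating[OF e] v by simp
  qed
  let ?F = "{e \<in> edges T. egen e < N}"
  let ?V = "{v \<in> verts T. gen v < Suc N}"
  have "(\<integral>x. ?g x * laplacian T h x \<partial>tree_measure T) =
      (\<Sum>e\<in>?F. LINT s:open_edge T e|lebesgue. ?g (Inner e s) * laplacian T h (Inner e s))"
  proof (rule tree_integral_supported[OF finite_egen_less _ int])
    fix e s assume e: "e \<in> edges T - ?F" and s: "s \<in> open_edge T e"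
    then have "?g (edge_point T e s) = 0" using far[of e s] by (auto simp: open_edge_def)
    then show "?g (Inner e s) * laplacian T h (Inner e s) = 0" using edge_point_simps(3)[OF s] by simp
  qed auto
  also have "\<dots> \<le> (\<Sum>e\<in>?F. \<Sum>v\<in>{src T e, dst T e}. ?g (Vertex v) * (outer_deriv T h e v - radial_flux w e v))"
    by (rule sum_mono) (use edge_flux_inequality[OF h] in auto)
  also have "\<dots> = (\<Sum>e\<in>?F. \<Sum>v\<in>{v \<in> ?V. v \<in> {src T e, dst T e}}. ?g (Vertex v) * (outer_deriv T h e v - radial_flux w e v))"
  proof (rule sum.cong[OF refl])
    fix e assume e: "e \<in> ?F"
    then have "e \<in> edges T" by simp
    then have "{v \<in> ?V. v \<in> {src T e, dst T e}} = {src T e, dst T e}"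
      using joins_verts[OF joins_src_dst, of e] e by (auto intro: edge_ends[of e])
    then show "(\<Sum>v\<in>{src T e, dst T e}. ?g (Vertex v) * (outer_deriv T h e v - radial_flux w e v)) =
      (\<Sum>v\<in>{v \<in> ?V. v \<in> {src T e, dst T e}}. ?g (Vertex v) * (outer_deriv T h e v - radial_flux w e v))" by (simp only:)
  qed
  also have "\<dots> = (\<Sum>v\<in>?V. \<Sum>e\<in>{e \<in> ?F. v \<in> {src T e, dst T e}}. ?g (Vertex v) * (outer_deriv T h e v - radial_flux w e v))"
    by (rule sum.swap_restrict[OF finite_egen_less finite_gen_less])
  also have "\<dots> \<le> 0"
  proof (rule sum_nonpos)
    fix v assume "v \<in> ?V"
    then have v: "v \<in> verts T" by simp
    show "(\<Sum>e\<in>{e \<in> ?F. v \<in> {src T e, dst T e}}. ?g (Vertex v) * (outer_deriv T h e v - radial_flux w e v)) \<le> 0"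
    proof (cases "gen v < N")
      case True
      let ?E = "{e. e \<in> edges T \<and> v \<in> {src T e, dst T e}}"
      \<comment> \<open>All edges at such a vertex belong to the finite part of the tree.\<close>
      have "{e \<in> ?F. v \<in> {src T e, dst T e}} = ?E" using True by (auto simp: egen_def)
      then have "(\<Sum>e\<in>{e \<in> ?F. v \<in> {src T e, dst T e}}. ?g (Vertex v) * (outer_deriv T h e v - radial_flux w e v))
         = ?g (Vertex v) * ((\<Sum>e\<in>?E. outer_deriv T h e v) - (\<Sum>e\<in>?E. radial_flux w e v))"
        by (simp only: sum_distrib_left sum_subtractf right_diff_distrib)
      also have "(\<Sum>e\<in>?E. outer_deriv T h e v) = 0" using h v unfolding laplacian_domain_def by blast
      finally show ?thesis using superharmonic_flux[OF w v] by (simp add: mult_nonneg_nonneg)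
    next
      case False
      then show ?thesis using farv[OF v] by (intro sum_nonpos) (auto simp del: power2_eq_iff)
    qed
  qed
  finally show ?thesis .
qed

end

section \<open>An energy along curves in the space of square integrable functions\<close>

lemma L2_measurable: "g \<in> L2 M \<Longrightarrow> g \<in> borel_measurable M"
  and L2_square: "g \<in> L2 M \<Longrightarrow> integrable M (\<lambda>x. (g x)\<^sup>2)"
  by (auto simp: L2_def)

lemma L2_product_integrable:
  assumes "g \<in> L2 M" "h \<in> L2 M" shows "integrable M (\<lambda>x. g x * h x)"
proof (rule Bochner_Integration.integrable_bound)
  show "integrable M (\<lambda>x. (g x)\<^sup>2 + (h x)\<^sup>2)" using assms by (auto simp: L2_def)
  show "(\<lambda>x. g x * h x) \<in> borel_measurable M" using assms by (auto simp: L2_def)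
  show "AE x in M. norm (g x * h x) \<le> norm ((g x)\<^sup>2 + (h x)\<^sup>2)"
  proof (rule AE_I2)
    fix x
    have "0 \<le> (\<bar>g x\<bar> - \<bar>h x\<bar>)\<^sup>2" by simp
    then have "2 * (\<bar>g x\<bar> * \<bar>h x\<bar>) \<le> (g x)\<^sup>2 + (h x)\<^sup>2" by (simp add: power2_diff)
    moreover have "0 \<le> \<bar>g x\<bar> * \<bar>h x\<bar>" by simp
    ultimately have "\<bar>g x\<bar> * \<bar>h x\<bar> \<le> (g x)\<^sup>2 + (h x)\<^sup>2" by linarith
    then show "norm (g x * h x) \<le> norm ((g x)\<^sup>2 + (h x)\<^sup>2)" by (simp add: abs_mult)
  qed
qed

lemma L2_add:
  assumes "g \<in> L2 M" "h \<in> L2 M" shows "(\<lambda>x. g x + h x) \<in> L2 M"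
  using assms L2_product_integrable[OF assms] by (auto simp: L2_def power2_sum mult.assoc)

lemma L2_cmult: "g \<in> L2 M \<Longrightarrow> (\<lambda>x. c * g x) \<in> L2 M"
  by (auto simp: L2_def power_mult_distrib)

lemma L2_diff:
  assumes "g \<in> L2 M" "h \<in> L2 M" shows "(\<lambda>x. g x - h x) \<in> L2 M"
  using L2_add[OF assms(1) L2_cmult[OF assms(2), of "-1"]] by simp

lemma L2_dominated:
  assumes "g \<in> L2 M" "h \<in> borel_measurable M" "AE x in M. \<bar>h x\<bar> \<le> \<bar>g x\<bar>"
  shows "h \<in> L2 M"
proof -
  have "integrable M (\<lambda>x. (h x)\<^sup>2)"
  proof (rule Bochner_Integration.integrable_bound[OF L2_square[OF assms(1)]])
    show "AE x in M. norm ((h x)\<^sup>2) \<le> norm ((g x)\<^sup>2)"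
      using assms(3) by eventually_elim (simp add: abs_le_square_iff)
  qed (use assms in measurable)
  then show ?thesis using assms by (simp add: L2_def)
qed

lemma L2_norm_tendsto_0_iff:
  "((\<lambda>s. L2_norm M (g s)) \<longlongrightarrow> 0) F \<longleftrightarrow> ((\<lambda>s. \<integral>x. (g s x)\<^sup>2 \<partial>M) \<longlongrightarrow> 0) F"
proof
  assume "((\<lambda>s. L2_norm M (g s)) \<longlongrightarrow> 0) F"
  then have "((\<lambda>s. (L2_norm M (g s))\<^sup>2) \<longlongrightarrow> 0\<^sup>2) F" by (rule tendsto_power)
  then show "((\<lambda>s. \<integral>x. (g s x)\<^sup>2 \<partial>M) \<longlongrightarrow> 0) F" by (simp add: L2_norm_def)
next
  assume "((\<lambda>s. \<integral>x. (g s x)\<^sup>2 \<partial>M) \<longlongrightarrow> 0) F"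
  then have "((\<lambda>s. sqrt (\<integral>x. (g s x)\<^sup>2 \<partial>M)) \<longlongrightarrow> sqrt 0) F" by (rule tendsto_real_sqrt)
  then show "((\<lambda>s. L2_norm M (g s)) \<longlongrightarrow> 0) F" by (simp add: L2_norm_def)
qed

text \<open>
  Weighted arithmetic-geometric mean in place of the Cauchy-Schwarz inequality.
\<close>

lemma L2_product_tendsto_0:
  assumes A: "A \<in> L2 M" and B: "\<forall>\<^sub>F s in F. B s \<in> L2 M" and lim: "((\<lambda>s. \<integral>x. (B s x)\<^sup>2 \<partial>M) \<longlongrightarrow> 0) F"
  shows "((\<lambda>s. \<integral>x. A x * B s x \<partial>M) \<longlongrightarrow> 0) F"
proof (rule tendstoI)
  fix e :: real assume e: "e > 0"
  define a where "a = (\<integral>x. (A x)\<^sup>2 \<partial>M) + 1"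
  have a: "a > 0" "(\<integral>x. (A x)\<^sup>2 \<partial>M) < a" by (auto simp: a_def add_nonneg_pos)
  define \<eta> where "\<eta> = e / a"
  have \<eta>: "\<eta> > 0" using e a by (simp add: \<eta>_def)
  have "\<forall>\<^sub>F s in F. (\<integral>x. (B s x)\<^sup>2 \<partial>M) < \<eta> * e" using order_tendstoD(2)[OF lim] e \<eta> by simp
  then show "\<forall>\<^sub>F s in F. dist (\<integral>x. A x * B s x \<partial>M) 0 < e"
    using B
  proof eventually_elim
    case (elim s)
    have "\<bar>\<integral>x. A x * B s x \<partial>M\<bar> \<le> (\<integral>x. \<bar>A x * B s x\<bar> \<partial>M)" by (rule integral_abs_bound)
    also have "\<dots> \<le> (\<integral>x. \<eta> / 2 * (A x)\<^sup>2 + 1 / (2 * \<eta>) * (B s x)\<^sup>2 \<partial>M)"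
    proof (rule integral_mono)
      show "integrable M (\<lambda>x. \<bar>A x * B s x\<bar>)" using L2_product_integrable[OF A elim(2)] by (rule integrable_abs)
      show "integrable M (\<lambda>x. \<eta> / 2 * (A x)\<^sup>2 + 1 / (2 * \<eta>) * (B s x)\<^sup>2)"
        by (intro Bochner_Integration.integrable_add integrable_mult_right L2_square A elim)
      fix x
      have "0 \<le> (\<eta> * \<bar>A x\<bar> - \<bar>B s x\<bar>)\<^sup>2" by simp
      then have "2 * \<eta> * (\<bar>A x\<bar> * \<bar>B s x\<bar>) \<le> \<eta>\<^sup>2 * (A x)\<^sup>2 + (B s x)\<^sup>2"
        by (simp add: power2_diff power_mult_distrib algebra_simps)
      then show "\<bar>A x * B s x\<bar> \<le> \<eta> / 2 * (A x)\<^sup>2 + 1 / (2 * \<eta>) * (B s x)\<^sup>2"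
        using \<eta> by (simp add: abs_mult field_simps power2_eq_square)
    qed
    also have "\<dots> = \<eta> / 2 * (\<integral>x. (A x)\<^sup>2 \<partial>M) + 1 / (2 * \<eta>) * (\<integral>x. (B s x)\<^sup>2 \<partial>M)"
      using L2_square[OF A] L2_square[OF elim(2)] by (subst Bochner_Integration.integral_add) auto
    also have "\<dots> < \<eta> / 2 * a + 1 / (2 * \<eta>) * (\<eta> * e)"
      using elim(1) a \<eta> by (intro add_strict_mono mult_strict_left_mono) auto
    also have "\<dots> = e" using \<eta> a by (simp add: \<eta>_def)
    finally show ?case by simp
  qed
qed

text \<open>
  The second derivative \<open>6 * max 0 z\<close> of the cube is at most \<open>6\<close> for \<open>z \<le> 1\<close>.
\<close>

lemma cubic_taylor:
  fixes a b :: real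
  assumes "a \<le> 1" "b \<le> 1"
  shows "\<bar>(max 0 a)^3 - (max 0 b)^3 - 3 * (max 0 b)\<^sup>2 * (a - b)\<bar> \<le> 3 * (a - b)\<^sup>2"
proof -
  consider "a \<ge> 0" "b \<ge> 0" | "a < 0" "b \<ge> 0" | "a \<ge> 0" "b < 0" | "a < 0" "b < 0" by linarith
  then show ?thesis
  proof cases
    case 1
    have "a^3 - b^3 - 3 * b\<^sup>2 * (a - b) = (a - b)\<^sup>2 * (a + 2 * b)"
      by (simp add: power2_eq_square power3_eq_cube algebra_simps)
    moreover have "(a - b)\<^sup>2 * (a + 2 * b) \<le> (a - b)\<^sup>2 * 3" using assms by (intro mult_left_mono) auto
    moreover have "0 \<le> (a - b)\<^sup>2 * (a + 2 * b)" using 1 by simp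
    ultimately show ?thesis using 1 by simp
  next
    case 2
    define c where "c = - a"
    have c: "c > 0" using 2 by (simp add: c_def)
    have "b\<^sup>2 * (2 * b + 3 * c) \<le> b * 1 * (2 * b + 3 * c)"
      unfolding power2_eq_square using 2 c assms by (intro mult_right_mono mult_left_mono) auto
    also have "\<dots> \<le> 3 * (c + b)\<^sup>2" using 2 c by (simp add: power2_eq_square algebra_simps)
    finally have "b\<^sup>2 * (2 * b + 3 * c) \<le> 3 * (a - b)\<^sup>2" by (simp add: c_def power2_eq_square algebra_simps)
    moreover have "0 \<le> b\<^sup>2 * (2 * b + 3 * c)" using 2 c by simp
    moreover have "(max 0 a)^3 - (max 0 b)^3 - 3 * (max 0 b)\<^sup>2 * (a - b) = b\<^sup>2 * (2 * b + 3 * c)"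
      using 2 by (simp add: c_def power2_eq_square power3_eq_cube algebra_simps)
    ultimately show ?thesis by simp
  next
    case 3
    have "a^3 \<le> a\<^sup>2" using 3 assms by (intro power_decreasing) auto
    also have "\<dots> \<le> (a - b)\<^sup>2" using 3 by (intro power_mono) auto
    also have "\<dots> \<le> 3 * (a - b)\<^sup>2" by simp
    finally show ?thesis using 3 by simp
  qed simp
qed

lemma cube_positive_part_bounds:
  fixes v s :: real
  assumes "v \<le> 1" "0 \<le> s"
  shows "0 \<le> (max 0 (v - s))^3" "(max 0 (v - s))^3 \<le> (max 0 (v - s))\<^sup>2" "(max 0 (v - s))\<^sup>2 \<le> max 0 (v - s)"
    "max 0 (v - s) \<le> \<bar>v\<bar>"
proof -
  have m: "0 \<le> max 0 (v - s)" "max 0 (v - s) \<le> 1" using assms by auto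
  show "0 \<le> (max 0 (v - s))^3" "(max 0 (v - s))^3 \<le> (max 0 (v - s))\<^sup>2" "max 0 (v - s) \<le> \<bar>v\<bar>"
    using m assms by (auto intro: power_decreasing)
  show "(max 0 (v - s))\<^sup>2 \<le> max 0 (v - s)" using power_decreasing[OF _ m, of 1 2] by simp
qed

lemma L2_excess:
  assumes v: "v \<in> L2 M" "AE x in M. v x \<le> 1" and S: "S \<in> borel_measurable M" "\<And>x. S x \<ge> 0"
  shows "integrable M (\<lambda>x. (max 0 (v x - S x))^3)" "(\<lambda>x. (max 0 (v x - S x))\<^sup>2) \<in> L2 M"
proof -
  have m: "(\<lambda>x. max 0 (v x - S x)) \<in> borel_measurable M" using L2_measurable[OF v(1)] S by measurable
  have L: "(\<lambda>x. max 0 (v x - S x)) \<in> L2 M"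
    by (rule L2_dominated[OF v(1) m], use v(2) in eventually_elim) (use cube_positive_part_bounds S in auto)
  show "(\<lambda>x. (max 0 (v x - S x))\<^sup>2) \<in> L2 M"
  proof (rule L2_dominated[OF L])
    show "AE x in M. \<bar>(max 0 (v x - S x))\<^sup>2\<bar> \<le> \<bar>max 0 (v x - S x)\<bar>"
      using v(2) by eventually_elim (use cube_positive_part_bounds S in auto)
  qed (use m in measurable)
  show "integrable M (\<lambda>x. (max 0 (v x - S x))^3)"
  proof (rule Bochner_Integration.integrable_bound[OF L2_square[OF L]])
    show "AE x in M. norm ((max 0 (v x - S x))^3) \<le> norm ((max 0 (v x - S x))\<^sup>2)"
      using v(2) by eventually_elim (use cube_positive_part_bounds S in auto)
  qed (use m in measurable)
qed

text \<open>
  The chain rule for the energy \<open>\<integral> (max 0 (v - S))^3\<close> along a curve \<open>v\<close> that is differentiable in \<open>L2\<close>.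
  By \<open>cubic_taylor\<close> the error of the linearization is at most \<open>3 \<integral> (v s - v t)\<^sup>2 = O((s - t)\<^sup>2)\<close>. The function
  \<open>S\<close> may fail to be square integrable, as do the supersolutions; only the excess, which is bounded by
  \<open>\<bar>v\<bar>\<close>, is integrated.
\<close>

lemma excess_energy_deriv:
  assumes v: "\<And>s. s > 0 \<Longrightarrow> v s \<in> L2 M" "\<And>s. s > 0 \<Longrightarrow> AE x in M. v s x \<le> 1"
    and v': "v' \<in> L2 M" and S: "S \<in> borel_measurable M" "\<And>x. S x \<ge> 0" and t: "t > 0"
    and lim: "((\<lambda>s. \<integral>x. ((v s x - v t x) / (s - t) - v' x)\<^sup>2 \<partial>M) \<longlongrightarrow> 0) (at t)"
  shows "((\<lambda>s. \<integral>x. (max 0 (v s x - S x))^3 \<partial>M) has_real_derivative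
     (\<integral>x. 3 * (max 0 (v t x - S x))\<^sup>2 * v' x \<partial>M)) (at t)"
proof -
  define A where "A x = 3 * (max 0 (v t x - S x))\<^sup>2" for x
  define D where "D s x = (v s x - v t x) / (s - t) - v' x" for s x
  define \<phi> where "\<phi> s = (\<integral>x. (max 0 (v s x - S x))^3 \<partial>M)" for s
  have A: "A \<in> L2 M" unfolding A_def[abs_def] by (rule L2_cmult[OF L2_excess(2)[OF v(1)[OF t] v(2)[OF t] S]])
  have D: "D s \<in> L2 M" if "s > 0" for s
    unfolding D_def[abs_def] divide_inverse mult.commute[of _ "inverse _"]
    by (intro L2_diff L2_cmult v that t v')
  have pos: "\<forall>\<^sub>F s in at t. s > 0" using t by (intro order_tendstoD(1)[OF tendsto_ident_at]) 
  have lim': "((\<lambda>s. \<integral>x. (D s x)\<^sup>2 \<partial>M) \<longlongrightarrow> 0) (at t)" using lim by (simp add: D_def)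
  define R where "R s = 3 * \<bar>s - t\<bar> * (2 * (\<integral>x. (D s x)\<^sup>2 \<partial>M) + 2 * (\<integral>x. (v' x)\<^sup>2 \<partial>M))" for s
  have key: "\<bar>(\<phi> s - \<phi> t) / (s - t) - (\<integral>x. A x * v' x \<partial>M) - (\<integral>x. A x * D s x \<partial>M)\<bar> \<le> R s" if s: "s > 0" "s \<noteq> t" for s
  proof -
    have dv: "(\<lambda>x. v s x - v t x) \<in> L2 M" by (intro L2_diff v s t)
    have J: "integrable M (\<lambda>x. (max 0 (v s x - S x))^3)" "integrable M (\<lambda>x. (max 0 (v t x - S x))^3)"
      by (intro L2_excess v s t S)+
    have Adv: "integrable M (\<lambda>x. A x * (v s x - v t x))" by (rule L2_product_integrable[OF A dv])
    have "\<phi> s - \<phi> t - (\<integral>x. A x * (v s x - v t x) \<partial>M) =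
      (\<integral>x. (max 0 (v s x - S x))^3 - (max 0 (v t x - S x))^3 - A x * (v s x - v t x) \<partial>M)"
      using J Adv by (simp add: \<phi>_def)
    then have "\<bar>\<phi> s - \<phi> t - (\<integral>x. A x * (v s x - v t x) \<partial>M)\<bar> \<le>
      (\<integral>x. \<bar>(max 0 (v s x - S x))^3 - (max 0 (v t x - S x))^3 - A x * (v s x - v t x)\<bar> \<partial>M)"
      by (simp only: integral_abs_bound)
    also have "\<dots> \<le> (\<integral>x. 3 * (v s x - v t x)\<^sup>2 \<partial>M)"
    proof (rule integral_mono_AE)
      show "integrable M (\<lambda>x. \<bar>(max 0 (v s x - S x))^3 - (max 0 (v t x - S x))^3 - A x * (v s x - v t x)\<bar>)"
        by (intro integrable_abs Bochner_Integration.integrable_diff J Adv)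
      show "integrable M (\<lambda>x. 3 * (v s x - v t x)\<^sup>2)" by (intro integrable_mult_right L2_square dv)
      show "AE x in M. \<bar>(max 0 (v s x - S x))^3 - (max 0 (v t x - S x))^3 - A x * (v s x - v t x)\<bar> \<le> 3 * (v s x - v t x)\<^sup>2"
        using v(2)[OF s(1)] v(2)[OF t]
      proof eventually_elim
        case (elim x)
        then show ?case using cubic_taylor[of "v s x - S x" "v t x - S x"] S(2)[of x] by (simp add: A_def)
      qed
    qed
    also have "\<dots> \<le> (\<integral>x. 3 * (s - t)\<^sup>2 * (2 * (D s x)\<^sup>2 + 2 * (v' x)\<^sup>2) \<partial>M)"
    proof (rule integral_mono)
      show "integrable M (\<lambda>x. 3 * (v s x - v t x)\<^sup>2)" by (intro integrable_mult_right L2_square dv)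
      show "integrable M (\<lambda>x. 3 * (s - t)\<^sup>2 * (2 * (D s x)\<^sup>2 + 2 * (v' x)\<^sup>2))"
        by (intro integrable_mult_right Bochner_Integration.integrable_add L2_square D s v')
      fix x
      have "v s x - v t x = (s - t) * (D s x + v' x)" using s by (simp add: D_def)
      then have "(v s x - v t x)\<^sup>2 = (s - t)\<^sup>2 * (D s x + v' x)\<^sup>2" by (simp add: power_mult_distrib)
      moreover have "(D s x + v' x)\<^sup>2 \<le> 2 * (D s x)\<^sup>2 + 2 * (v' x)\<^sup>2"
        using zero_le_power2[of "D s x - v' x"] by (simp add: power2_sum power2_diff)
      ultimately show "3 * (v s x - v t x)\<^sup>2 \<le> 3 * (s - t)\<^sup>2 * (2 * (D s x)\<^sup>2 + 2 * (v' x)\<^sup>2)"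
        by (simp add: mult_left_mono)
    qed
    also have "\<dots> = R s * \<bar>s - t\<bar>"
    proof -
      have "(\<integral>x. 2 * (D s x)\<^sup>2 + 2 * (v' x)\<^sup>2 \<partial>M) = 2 * (\<integral>x. (D s x)\<^sup>2 \<partial>M) + 2 * (\<integral>x. (v' x)\<^sup>2 \<partial>M)"
        using L2_square[OF D[OF s(1)]] L2_square[OF v'] by simp
      moreover have "(s - t)\<^sup>2 = \<bar>s - t\<bar> * \<bar>s - t\<bar>" by (simp add: power2_eq_square)
      ultimately show ?thesis by (simp add: R_def)
    qed
    finally have *: "\<bar>\<phi> s - \<phi> t - (\<integral>x. A x * (v s x - v t x) \<partial>M)\<bar> \<le> R s * \<bar>s - t\<bar>" .
    have "(\<integral>x. A x * (v s x - v t x) \<partial>M) = (\<integral>x. (s - t) * (A x * v' x + A x * D s x) \<partial>M)"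
    proof (rule Bochner_Integration.integral_cong[OF refl])
      fix x
      have "v s x - v t x = (s - t) * (D s x + v' x)" using s by (simp add: D_def)
      then have "A x * (v s x - v t x) = A x * ((s - t) * (D s x + v' x))" by simp
      then show "A x * (v s x - v t x) = (s - t) * (A x * v' x + A x * D s x)"
        by (simp only: distrib_left mult.left_commute add.commute)
    qed
    also have "\<dots> = (s - t) * ((\<integral>x. A x * v' x \<partial>M) + (\<integral>x. A x * D s x \<partial>M))"
      using L2_product_integrable[OF A v'] L2_product_integrable[OF A D[OF s(1)]] by simp
    finally have Ieq: "(\<integral>x. A x * (v s x - v t x) \<partial>M) = (s - t) * ((\<integral>x. A x * v' x \<partial>M) + (\<integral>x. A x * D s x \<partial>M))" .
    have e: "\<phi> s - \<phi> t - (\<integral>x. A x * (v s x - v t x) \<partial>M) =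
        (s - t) * ((\<phi> s - \<phi> t) / (s - t) - (\<integral>x. A x * v' x \<partial>M) - (\<integral>x. A x * D s x \<partial>M))"
    proof -
      have "F - I = d * (F / d - P - Q)" if "d \<noteq> 0" "I = d * (P + Q)" for d F I P Q :: real
        using that by (simp add: right_diff_distrib distrib_left)
      from this[OF _ Ieq] show ?thesis using s by simp
    qed
    show ?thesis using * s unfolding e by (simp add: abs_mult mult.commute)
  qed
  have "((\<lambda>s. (\<phi> s - \<phi> t) / (s - t) - (\<integral>x. A x * v' x \<partial>M) - (\<integral>x. A x * D s x \<partial>M)) \<longlongrightarrow> 0) (at t)"
  proof (rule Lim_null_comparison)
    show "\<forall>\<^sub>F s in at t. norm ((\<phi> s - \<phi> t) / (s - t) - (\<integral>x. A x * v' x \<partial>M) - (\<integral>x. A x * D s x \<partial>M)) \<le> R s"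
      using pos eventually_neq_at_within[of t t UNIV] by eventually_elim (use key in simp)
    have "(R \<longlongrightarrow> 3 * \<bar>t - t\<bar> * (2 * 0 + 2 * (\<integral>x. (v' x)\<^sup>2 \<partial>M))) (at t)"
      unfolding R_def[abs_def] by (intro tendsto_intros lim')
    then show "(R \<longlongrightarrow> 0) (at t)" by simp
  qed
  moreover have "((\<lambda>s. \<integral>x. A x * D s x \<partial>M) \<longlongrightarrow> 0) (at t)"
    by (rule L2_product_tendsto_0[OF A _ lim']) (use pos D in \<open>auto elim: eventually_mono\<close>)
  ultimately have "((\<lambda>s. ((\<phi> s - \<phi> t) / (s - t) - (\<integral>x. A x * v' x \<partial>M) - (\<integral>x. A x * D s x \<partial>M)) + (\<integral>x. A x * D s x \<partial>M) + (\<integral>x. A x * v' x \<partial>M)) \<longlongrightarrow> 0 + 0 + (\<integral>x. A x * v' x \<partial>M)) (at t)"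
    by (intro tendsto_intros)
  then have "(\<phi> has_real_derivative (\<integral>x. A x * v' x \<partial>M)) (at t)"
    by (simp add: has_field_derivative_iff)
  then show ?thesis by (simp add: \<phi>_def[abs_def] A_def mult.assoc)
qed

text \<open>
  The product rule for a scalar function and a curve in \<open>L2\<close>.
\<close>

lemma discounted_quotient_tendsto:
  assumes u: "\<And>s. s > 0 \<Longrightarrow> u s \<in> L2 M" and u': "u' \<in> L2 M" and t: "t > 0"
    and lim: "((\<lambda>s. \<integral>x. ((u s x - u t x) / (s - t) - u' x)\<^sup>2 \<partial>M) \<longlongrightarrow> 0) (at t)"
    and k: "(k has_real_derivative k') (at t)"
  shows "((\<lambda>s. \<integral>x. ((k s * u s x - k t * u t x) / (s - t) - (k t * u' x + k' * u t x))\<^sup>2 \<partial>M) \<longlongrightarrow> 0) (at t)"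
proof (rule Lim_null_comparison)
  let ?d = "\<lambda>s x. (u s x - u t x) / (s - t) - u' x"
  let ?R = "\<lambda>s. 3 * ((k s)\<^sup>2 * (\<integral>x. (?d s x)\<^sup>2 \<partial>M) + (k s - k t)\<^sup>2 * (\<integral>x. (u' x)\<^sup>2 \<partial>M) + ((k s - k t) / (s - t) - k')\<^sup>2 * (\<integral>x. (u t x)\<^sup>2 \<partial>M))"
  have pos: "\<forall>\<^sub>F s in at t. s > 0" using t by (intro order_tendstoD(1)[OF tendsto_ident_at])
  have ck: "(k \<longlongrightarrow> k t) (at t)" using DERIV_isCont[OF k] by (simp add: isCont_def)
  have qk: "((\<lambda>s. (k s - k t) / (s - t)) \<longlongrightarrow> k') (at t)" using k by (simp add: has_field_derivative_iff)
  have "(?R \<longlongrightarrow> 3 * ((k t)\<^sup>2 * 0 + (k t - k t)\<^sup>2 * (\<integral>x. (u' x)\<^sup>2 \<partial>M) + (k' - k')\<^sup>2 * (\<integral>x. (u t x)\<^sup>2 \<partial>M))) (at t)"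
    by (intro tendsto_intros ck qk lim)
  then show "(?R \<longlongrightarrow> 0) (at t)" by simp
  show "\<forall>\<^sub>F s in at t. norm (\<integral>x. ((k s * u s x - k t * u t x) / (s - t) - (k t * u' x + k' * u t x))\<^sup>2 \<partial>M) \<le> ?R s"
    using pos eventually_neq_at_within[of t t UNIV]
  proof eventually_elim
    case (elim s)
    let ?\<alpha> = "k s - k t" and ?\<beta> = "(k s - k t) / (s - t) - k'"
    have d: "?d s \<in> L2 M"
      unfolding divide_inverse mult.commute[of _ "inverse _"] by (intro L2_diff L2_cmult u u' t elim)
    have eq: "(k s * u s x - k t * u t x) / (s - t) - (k t * u' x + k' * u t x) = k s * ?d s x + ?\<alpha> * u' x + ?\<beta> * u t x" for x
      by (simp add: divide_inverse algebra_simps)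
    have i: "integrable M (\<lambda>x. (?d s x)\<^sup>2)" "integrable M (\<lambda>x. (u' x)\<^sup>2)" "integrable M (\<lambda>x. (u t x)\<^sup>2)"
      by (intro L2_square d u' u t)+
    have "norm (\<integral>x. (k s * ?d s x + ?\<alpha> * u' x + ?\<beta> * u t x)\<^sup>2 \<partial>M) = (\<integral>x. (k s * ?d s x + ?\<alpha> * u' x + ?\<beta> * u t x)\<^sup>2 \<partial>M)"
      by simp
    also have "\<dots> \<le> (\<integral>x. 3 * ((k s)\<^sup>2 * (?d s x)\<^sup>2 + ?\<alpha>\<^sup>2 * (u' x)\<^sup>2 + ?\<beta>\<^sup>2 * (u t x)\<^sup>2) \<partial>M)"
    proof (rule integral_mono)
      show "integrable M (\<lambda>x. (k s * ?d s x + ?\<alpha> * u' x + ?\<beta> * u t x)\<^sup>2)"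
        by (intro L2_square L2_add L2_cmult d u' u t)
      show "integrable M (\<lambda>x. 3 * ((k s)\<^sup>2 * (?d s x)\<^sup>2 + ?\<alpha>\<^sup>2 * (u' x)\<^sup>2 + ?\<beta>\<^sup>2 * (u t x)\<^sup>2))"
        by (intro integrable_mult_right Bochner_Integration.integrable_add i)
      fix x
      have three: "(a + b + c)\<^sup>2 \<le> 3 * (a\<^sup>2 + b\<^sup>2 + c\<^sup>2)" for a b c :: real
        using zero_le_power2[of "a - b"] zero_le_power2[of "a - c"] zero_le_power2[of "b - c"]
        by (simp add: power2_eq_square algebra_simps)
      show "(k s * ?d s x + ?\<alpha> * u' x + ?\<beta> * u t x)\<^sup>2 \<le> 3 * ((k s)\<^sup>2 * (?d s x)\<^sup>2 + ?\<alpha>\<^sup>2 * (u' x)\<^sup>2 + ?\<beta>\<^sup>2 * (u t x)\<^sup>2)"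
        using three[of "k s * ?d s x" "?\<alpha> * u' x" "?\<beta> * u t x"] by (simp only: power_mult_distrib)
    qed
    also have "\<dots> = ?R s" using i by simp
    finally show ?case unfolding eq .
  qed
qed

section \<open>Comparison with superharmonic radial functions\<close>

context tree
begin

lemma radial_measurable: "radial w \<in> borel_measurable (tree_measure T)"
proof (rule measurableI)
  fix A :: "real set" assume A: "A \<in> sets borel"
  have "{s \<in> open_edge T e. Inner e s \<in> radial w -` A \<inter> points T} \<in> sets lebesgue" if e: "e \<in> edges T" for e
  proof -
    let ?g = "\<lambda>s. (1 - s / len T e) * w (gen (src T e)) + s / len T e * w (gen (dst T e))"
    have "?g \<in> borel_measurable borel" by measurable
    from measurable_sets[OF this A] have "?g -` A \<in> sets borel" by simp
    then have "open_edge T e \<inter> ?g -` A \<in> sets lebesgue" using open_edge_lebesgue by (intro sets.Int) auto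
    moreover have "{s \<in> open_edge T e. Inner e s \<in> radial w -` A \<inter> points T} = open_edge T e \<inter> ?g -` A"
      using e by (auto simp: radial_def points_def open_edge_def)
    ultimately show ?thesis by (simp only:)
  qed
  then show "radial w -` A \<inter> space (tree_measure T) \<in> sets (tree_measure T)"
    by (simp add: space_tree_measure sets_tree_measure tree_sets_def)
qed auto

lemma radial_scale: "radial (\<lambda>n. c * w n) x = c * radial w x"
  by (auto simp: radial_def algebra_simps split: point.split)

lemma radial_shift: "radial (\<lambda>n. w n + c) x = radial w x + c"
  by (auto simp: radial_def algebra_simps split: point.split)

lemma radial_convex:
  assumes e: "e \<in> edges T" and s: "s \<in> {0..len T e}"
  obtains \<theta> where "0 \<le> \<theta>" "\<theta> \<le> 1"
    "\<And>w. radial w (edge_point T e s) = (1 - \<theta>) * w (egen e) + \<theta> * w (Suc (egen e))"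
proof -
  define t where "t = s / len T e"
  have t: "0 \<le> t" "t \<le> 1" using s len_pos[OF e] by (auto simp: t_def field_simps)
  have rad: "radial w (edge_point T e s) = (1 - t) * w (gen (src T e)) + t * w (gen (dst T e))" for w
    using len_pos[OF e] by (simp add: radial_edge[OF e] t_def field_simps)
  show ?thesis
  proof (rule edge_ends[OF e])
    assume "gen (src T e) = egen e" "gen (dst T e) = Suc (egen e)"
    then show ?thesis using that[of t] t rad by auto
  next
    assume "gen (dst T e) = egen e" "gen (src T e) = Suc (egen e)"
    then show ?thesis using that[of "1 - t"] t rad by (auto simp: algebra_simps)
  qed
qed

end

lemma (in regular_tree) point_on_edge:
  assumes "x \<in> points T" obtains e s where "e \<in> edges T" "s \<in> {0..len T e}" "x = edge_point T e s"
proof -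
  consider v where "v \<in> verts T" "x = Vertex v" | e s where "e \<in> edges T" "s \<in> open_edge T e" "x = Inner e s"
    using assms by (auto simp: points_def open_edge_def)
  then show ?thesis
  proof cases
    case 1
    then obtain e where e: "e \<in> emanating T v" using finite_emanating(2) by blast
    then show ?thesis using emanating_point[OF e] egen_emanating[OF e] 1 that by metis
  next
    case 2
    then show ?thesis using that[of e s] edge_point_simps(3)[OF 2(2)] by (auto simp: open_edge_def)
  qed
qed

context regular_tree
begin

lemma radial_ge:
  assumes "\<And>n. w n \<ge> c" "x \<in> points T" shows "radial w x \<ge> c"
proof -
  obtain e s where x: "e \<in> edges T" "s \<in> {0..len T e}" "x = edge_point T e s" using point_on_edge[OF assms(2)] .
  obtain \<theta> where t: "0 \<le> \<theta>" "\<theta> \<le> 1" "radial w x = (1 - \<theta>) * w (egen e) + \<theta> * w (Suc (egen e))"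
    using radial_convex[OF x(1,2)] x(3) by metis
  have "(1 - \<theta>) * c + \<theta> * c \<le> (1 - \<theta>) * w (egen e) + \<theta> * w (Suc (egen e))"
    using t assms(1) by (intro add_mono mult_left_mono) auto
  then show ?thesis using t by (simp add: algebra_simps)
qed

text \<open>
  Every point lies on a closed edge, on which a full subset of parameters is dense.
\<close>

lemma AE_nonpos_imp_everywhere:
  fixes g :: "('v, 'e) point \<Rightarrow> real"
  assumes ae: "AE x in tree_measure T. g x \<le> 0"
    and cont: "\<And>e. e \<in> edges T \<Longrightarrow> continuous_on {0..len T e} (\<lambda>s. g (edge_point T e s))"
    and x: "x \<in> points T"
  shows "g x \<le> 0"
proof -
  obtain e s where e: "e \<in> edges T" "s \<in> {0..len T e}" "x = edge_point T e s" using point_on_edge[OF x] .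
  let ?l = "len T e"
  let ?C = "{s \<in> {0..?l}. g (edge_point T e s) \<le> 0}"
  have C: "closed ?C"
    using continuous_closed_preimage[OF cont[OF e(1)] closed_real_atLeastAtMost closed_atMost, of 0]
    by (simp add: vimage_def Int_def)
  have "AE s in lebesgue_on (open_edge T e). g (Inner e s) \<le> 0" by (rule edge_AE[OF e(1) ae])
  then have "AE s in lebesgue. s \<in> open_edge T e \<longrightarrow> g (Inner e s) \<le> 0"
    by (subst (asm) AE_restrict_space_iff) (auto simp: open_edge_lebesgue)
  then have "AE s in lebesgue. s \<in> open_edge T e \<longrightarrow> s \<in> ?C"
  proof eventually_elim
    case (elim s)
    show ?case
    proof
      assume s: "s \<in> open_edge T e"
      then show "s \<in> ?C" using elim edge_point_simps(3)[OF s] by (auto simp: open_edge_def)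
    qed
  qed
  then have sub: "open_edge T e \<subseteq> ?C"
    using mem_closed_if_AE_lebesgue_open[OF _ C, of "open_edge T e"] by (auto simp: open_edge_def)
  have "closure (open_edge T e) \<subseteq> ?C" by (rule closure_minimal[OF sub C])
  moreover have "closure (open_edge T e) = {0..?l}" using len_pos[OF e(1)] by (simp add: open_edge_def)
  ultimately show ?thesis using e by auto
qed

end

context spreading_tree
begin

lemma superharmonic_scale: "c \<ge> 0 \<Longrightarrow> superharmonic w \<Longrightarrow> superharmonic (\<lambda>n. c * w n)"
  unfolding superharmonic_def
proof (intro conjI allI impI)
  fix n :: nat assume c: "c \<ge> 0" and n: "1 \<le> n"
    and w: "w 1 \<le> w 0 \<and> (\<forall>n\<ge>1. (w (n - 1) - w n) / (r n - r (n - 1)) \<le> real (b n) * ((w n - w (Suc n)) / (r (Suc n) - r n)))"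
  have "c * ((w (n - 1) - w n) / (r n - r (n - 1))) \<le> c * (real (b n) * ((w n - w (Suc n)) / (r (Suc n) - r n)))"
    using w n c by (intro mult_left_mono) auto
  then show "(c * w (n - 1) - c * w n) / (r n - r (n - 1)) \<le> real (b n) * ((c * w n - c * w (Suc n)) / (r (Suc n) - r n))"
    by (simp add: right_diff_distrib[symmetric] mult.left_commute)
qed (auto intro: mult_left_mono)

lemma superharmonic_shift: "superharmonic w \<Longrightarrow> superharmonic (\<lambda>n. w n + c)"
  by (simp add: superharmonic_def)

text \<open>
  For the discounted solution \<open>v t = exp (- M * t) * u t\<close> the equation and
  \<open>f u \<le> M * u\<close> give \<open>v' \<le> \<Delta> v\<close>, so by \<open>laplacian_excess_nonpos\<close> the energy \<open>\<phi>\<close> of its excess over the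
  superharmonic function does not increase. It tends to zero at the initial time, and hence vanishes.
\<close>

lemma solution_bound_AE:
  assumes sol: "is_solution T f u0 u" and M: "M \<ge> 0" and f: "\<And>s. s \<in> {0..1} \<Longrightarrow> f s \<le> M * s"
    and w: "superharmonic w" and pos: "\<epsilon> > 0" "\<And>n. w n \<ge> \<epsilon>"
    and init: "AE x in tree_measure T. u0 x \<le> radial w x" and t: "t > 0"
  shows "AE x in tree_measure T. u t x \<le> exp (M * t) * radial w x"
proof -
  let ?\<mu> = "tree_measure T"
  obtain u' where u': "L2_C1_deriv ?\<mu> {0<..} u u'"
    and eq: "\<And>t. t > 0 \<Longrightarrow> AE x in ?\<mu>. u' t x = laplacian T (u t) x + f (u t x)"
    using sol unfolding is_solution_def by blast
  have cont: "L2_continuous_on ?\<mu> {0..} u"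
    and rng: "\<And>t. t \<ge> 0 \<Longrightarrow> AE x in ?\<mu>. 0 \<le> u t x \<and> u t x \<le> 1"
    and dom: "\<And>t. t > 0 \<Longrightarrow> u t \<in> laplacian_domain T"
    and lapc: "L2_continuous_on ?\<mu> {0<..} (\<lambda>t. laplacian T (u t))"
    and u0: "AE x in ?\<mu>. u 0 x = u0 x"
    using sol unfolding is_solution_def by blast+
  have uL: "u t \<in> L2 ?\<mu>" if "t \<ge> 0" for t using cont that by (auto simp: L2_continuous_on_def)
  have u'L: "u' t \<in> L2 ?\<mu>" if "t > 0" for t using u' that by (auto simp: L2_C1_deriv_def L2_continuous_on_def)
  have lapL: "laplacian T (u t) \<in> L2 ?\<mu>" if "t > 0" for t using lapc that by (auto simp: L2_continuous_on_def)
  define k where "k t = exp (- M * t)" for t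
  have k: "k t > 0" "t \<ge> 0 \<Longrightarrow> k t \<le> 1" for t using M by (auto simp: k_def)
  have k': "(k has_real_derivative - M * k t) (at t)" for t
    unfolding k_def[abs_def] by (auto intro!: derivative_eq_intros)
  define v where "v t x = k t * u t x" for t x
  \<comment> \<open>On the tree this is \<open>radial w\<close>. Elsewhere the interpolation formula may be negative, and the
    maximum keeps \<open>S\<close> nonnegative.\<close>
  define S where "S x = max 0 (radial w x)" for x
  have Sm: "S \<in> borel_measurable ?\<mu>" "\<And>x. S x \<ge> 0"
    using radial_measurable by (auto simp: S_def[abs_def])
  have S_eq: "S x = radial w x" if "x \<in> points T" for x
    using radial_ge[of \<epsilon> w x] pos that by (simp add: S_def)
  have pts: "AE x in ?\<mu>. x \<in> points T" using AE_space[of ?\<mu>] by (simp add: space_tree_measure)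
  have vL: "v t \<in> L2 ?\<mu>" if "t \<ge> 0" for t unfolding v_def[abs_def] by (rule L2_cmult[OF uL[OF that]])
  have v1: "AE x in ?\<mu>. v t x \<le> 1" if "t \<ge> 0" for t
    using rng[OF that]
  proof eventually_elim
    case (elim x)
    then have "k t * u t x \<le> 1 * 1" using k[of t] that by (intro mult_mono) auto
    then show ?case by (simp add: v_def)
  qed
  define \<phi> where "\<phi> t = (\<integral>x. (max 0 (v t x - S x))^3 \<partial>?\<mu>)" for t
  have deriv: "\<exists>d. (\<phi> has_real_derivative d) (at t) \<and> d \<le> 0" if t: "t > 0" for t
  proof (intro exI conjI)
    let ?v' = "\<lambda>x. k t * u' t x + - M * k t * u t x"
    have "((\<lambda>s. L2_norm ?\<mu> (\<lambda>x. (u s x - u t x) / (s - t) - u' t x)) \<longlongrightarrow> 0) (at t within {0<..})"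
      using u' t by (auto simp: L2_C1_deriv_def)
    then have lim: "((\<lambda>s. \<integral>x. ((u s x - u t x) / (s - t) - u' t x)\<^sup>2 \<partial>?\<mu>) \<longlongrightarrow> 0) (at t)"
      using t by (simp add: L2_norm_tendsto_0_iff at_within_open[of t "{0<..}"])
    have lim': "((\<lambda>s. \<integral>x. ((v s x - v t x) / (s - t) - ?v' x)\<^sup>2 \<partial>?\<mu>) \<longlongrightarrow> 0) (at t)"
      unfolding v_def by (rule discounted_quotient_tendsto[OF uL u'L[OF t] t lim k']) simp
    have v'L: "?v' \<in> L2 ?\<mu>" by (intro L2_add L2_cmult u'L uL t) (use t in simp)
    show "(\<phi> has_real_derivative (\<integral>x. 3 * (max 0 (v t x - S x))\<^sup>2 * ?v' x \<partial>?\<mu>)) (at t)"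
      unfolding \<phi>_def[abs_def] by (rule excess_energy_deriv[OF vL v1 v'L Sm t lim']) auto
    \<comment> \<open>Dividing by \<open>k t\<close> turns the excess of \<open>v t\<close> into that of \<open>u t\<close>, which lies in the domain of
      the Laplacian.\<close>
    define wk where "wk n = inverse (k t) * w n" for n
    let ?g = "\<lambda>x. (max 0 (u t x - radial wk x))\<^sup>2"
    have ex2: "(\<lambda>x. (max 0 (v t x - S x))\<^sup>2) \<in> L2 ?\<mu>"
      by (rule L2_excess(2)[OF vL v1 Sm]) (use t in auto)
    have scale: "(max 0 (v t x - S x))\<^sup>2 = (k t)\<^sup>2 * ?g x" if "x \<in> points T" for x
    proof -
      have "v t x - S x = k t * (u t x - radial wk x)"
        using k(1)[of t] S_eq[OF that] unfolding wk_def radial_scale by (simp add: v_def right_diff_distrib)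
      then have "max 0 (v t x - S x) = k t * max 0 (u t x - radial wk x)"
        using k(1)[of t] by (simp add: max_def mult_le_0_iff zero_le_mult_iff)
      then show ?thesis by (simp add: power_mult_distrib)
    qed
    have gm: "?g \<in> borel_measurable ?\<mu>"
    proof -
      have um: "u t \<in> borel_measurable ?\<mu>" by (rule L2_measurable[OF uL]) (use t in simp)
      show ?thesis by (intro borel_measurable_power borel_measurable_max borel_measurable_diff um radial_measurable borel_measurable_const)
    qed
    have gL: "?g \<in> L2 ?\<mu>"
    proof (rule L2_dominated[OF L2_cmult[OF ex2, of "inverse ((k t)\<^sup>2)"] gm])
      show "AE x in ?\<mu>. \<bar>?g x\<bar> \<le> \<bar>inverse ((k t)\<^sup>2) * (max 0 (v t x - S x))\<^sup>2\<bar>"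
        using pts
      proof eventually_elim
        case (elim x)
        have "inverse ((k t)\<^sup>2) * (max 0 (v t x - S x))\<^sup>2 = ?g x"
          using k(1)[of t] by (simp add: scale[OF elim] field_simps)
        then show ?case by simp
      qed
    qed
    have int: "integrable ?\<mu> (\<lambda>x. ?g x * laplacian T (u t) x)" by (rule L2_product_integrable[OF gL lapL[OF t]])
    have "(\<integral>x. 3 * (max 0 (v t x - S x))\<^sup>2 * ?v' x \<partial>?\<mu>) \<le> (\<integral>x. (3 * (k t)^3) * (?g x * laplacian T (u t) x) \<partial>?\<mu>)"
    proof (rule integral_mono_AE)
      show "integrable ?\<mu> (\<lambda>x. 3 * (max 0 (v t x - S x))\<^sup>2 * ?v' x)"
        by (rule L2_product_integrable[OF L2_cmult[OF ex2] v'L])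
      show "integrable ?\<mu> (\<lambda>x. (3 * (k t)^3) * (?g x * laplacian T (u t) x))"
        using int by (rule integrable_mult_right)
      show "AE x in ?\<mu>. 3 * (max 0 (v t x - S x))\<^sup>2 * ?v' x \<le> (3 * (k t)^3) * (?g x * laplacian T (u t) x)"
        using pts eq[OF t] rng[OF less_imp_le[OF t]]
      proof eventually_elim
        case (elim x)
        have "f (u t x) \<le> M * u t x" using f elim(3) by auto
        then have "k t * (u' t x - M * u t x) \<le> k t * laplacian T (u t) x"
          using elim(2) k(1)[of t] by (intro mult_left_mono) auto
        then have "?v' x \<le> k t * laplacian T (u t) x" by (simp add: algebra_simps)
        then have "3 * (k t)\<^sup>2 * ?g x * ?v' x \<le> 3 * (k t)\<^sup>2 * ?g x * (k t * laplacian T (u t) x)"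
          by (intro mult_left_mono) auto
        then show ?case unfolding scale[OF elim(1)] by (simp add: power2_eq_square power3_eq_cube mult_ac)
      qed
    qed
    also have "\<dots> = (3 * (k t)^3) * (\<integral>x. ?g x * laplacian T (u t) x \<partial>?\<mu>)" by simp
    also have "\<dots> \<le> 0"
    proof -
      have "superharmonic wk" unfolding wk_def by (rule superharmonic_scale[OF _ w]) (use k(1)[of t] in simp)
      moreover have "wk n \<ge> inverse (k t) * \<epsilon>" for n
        using pos k(1)[of t] by (simp add: wk_def)
      moreover have "inverse (k t) * \<epsilon> > 0" using pos k(1)[of t] by simp
      ultimately have "(\<integral>x. ?g x * laplacian T (u t) x \<partial>?\<mu>) \<le> 0"
        using laplacian_excess_nonpos[OF dom[OF t] _ _ _ int] by blast
      then show ?thesis using k(1)[of t] by (simp add: mult_le_0_iff)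
    qed
    finally show "(\<integral>x. 3 * (max 0 (v t x - S x))\<^sup>2 * ?v' x \<partial>?\<mu>) \<le> 0" .
  qed
  have mono: "\<phi> t \<le> \<phi> s" if "0 < s" "s \<le> t" for s t
    by (rule DERIV_nonpos_imp_nonincreasing[OF that(2)]) (use deriv that in force)
  \<comment> \<open>Initially \<open>v\<close> lies below \<open>S\<close>, so that the excess at time \<open>s\<close> is at most \<open>\<bar>v s - v 0\<bar>\<close>.\<close>
  have lim0: "(\<phi> \<longlongrightarrow> 0) (at_right 0)"
  proof (rule Lim_null_comparison)
    let ?R = "\<lambda>s. 2 * (k s)\<^sup>2 * (\<integral>x. (u s x - u 0 x)\<^sup>2 \<partial>?\<mu>) + 2 * (k s - k 0)\<^sup>2 * (\<integral>x. (u 0 x)\<^sup>2 \<partial>?\<mu>)"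
    have "((\<lambda>s. L2_norm ?\<mu> (\<lambda>x. u s x - u 0 x)) \<longlongrightarrow> 0) (at 0 within {0..})"
      using cont by (auto simp: L2_continuous_on_def)
    then have "((\<lambda>s. L2_norm ?\<mu> (\<lambda>x. u s x - u 0 x)) \<longlongrightarrow> 0) (at_right 0)"
      by (rule tendsto_within_subset) auto
    then have l: "((\<lambda>s. \<integral>x. (u s x - u 0 x)\<^sup>2 \<partial>?\<mu>) \<longlongrightarrow> 0) (at_right 0)"
      by (simp add: L2_norm_tendsto_0_iff)
    have kc: "(k \<longlongrightarrow> k 0) (at_right 0)"
      using DERIV_isCont[OF k', of 0] by (auto simp: isCont_def intro: tendsto_within_subset)
    have "(?R \<longlongrightarrow> 2 * (k 0)\<^sup>2 * 0 + 2 * (k 0 - k 0)\<^sup>2 * (\<integral>x. (u 0 x)\<^sup>2 \<partial>?\<mu>)) (at_right 0)"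
      by (intro tendsto_intros l kc)
    then show "(?R \<longlongrightarrow> 0) (at_right 0)" by simp
    show "\<forall>\<^sub>F s in at_right 0. norm (\<phi> s) \<le> ?R s"
      using eventually_at_right_less[of "0::real"]
    proof eventually_elim
      case (elim s)
      then have s: "s \<ge> 0" by simp
      have d: "(\<lambda>x. u s x - u 0 x) \<in> L2 ?\<mu>" by (intro L2_diff uL s) simp
      have d0: "u 0 \<in> L2 ?\<mu>" by (rule uL) simp
      have "0 \<le> \<phi> s" unfolding \<phi>_def by (rule integral_nonneg_AE) simp
      moreover have "\<phi> s \<le> (\<integral>x. 2 * (k s)\<^sup>2 * (u s x - u 0 x)\<^sup>2 + 2 * (k s - k 0)\<^sup>2 * (u 0 x)\<^sup>2 \<partial>?\<mu>)"
        unfolding \<phi>_def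
      proof (rule integral_mono_AE)
        show "integrable ?\<mu> (\<lambda>x. (max 0 (v s x - S x))^3)" by (rule L2_excess(1)[OF vL[OF s] v1[OF s] Sm])
        show "integrable ?\<mu> (\<lambda>x. 2 * (k s)\<^sup>2 * (u s x - u 0 x)\<^sup>2 + 2 * (k s - k 0)\<^sup>2 * (u 0 x)\<^sup>2)"
          by (intro Bochner_Integration.integrable_add integrable_mult_right L2_square d d0)
        show "AE x in ?\<mu>. (max 0 (v s x - S x))^3 \<le> 2 * (k s)\<^sup>2 * (u s x - u 0 x)\<^sup>2 + 2 * (k s - k 0)\<^sup>2 * (u 0 x)\<^sup>2"
          using v1[OF s] u0 init pts
        proof eventually_elim
          case (elim x)
          have "v 0 x \<le> S x" using elim S_eq by (simp add: v_def k_def)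
          then have "max 0 (v s x - S x) \<le> \<bar>v s x - v 0 x\<bar>" by simp
          then have "(max 0 (v s x - S x))\<^sup>2 \<le> \<bar>v s x - v 0 x\<bar>\<^sup>2" by (intro power_mono) auto
          moreover have "(max 0 (v s x - S x))^3 \<le> (max 0 (v s x - S x))\<^sup>2"
            by (rule cube_positive_part_bounds(2)) (use elim Sm in auto)
          moreover have "v s x - v 0 x = k s * (u s x - u 0 x) + (k s - k 0) * u 0 x" by (simp add: v_def algebra_simps)
          moreover have "(k s * (u s x - u 0 x) + (k s - k 0) * u 0 x)\<^sup>2 \<le> 2 * (k s * (u s x - u 0 x))\<^sup>2 + 2 * ((k s - k 0) * u 0 x)\<^sup>2"
            using zero_le_power2[of "k s * (u s x - u 0 x) - (k s - k 0) * u 0 x"] by (simp only: power2_sum power2_diff)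
          ultimately show ?case by (simp add: power_mult_distrib)
        qed
      qed
      moreover have "\<dots> = ?R s" using L2_square[OF d] L2_square[OF d0] by simp
      ultimately show ?case by simp
    qed
  qed
  have "\<phi> t \<le> 0"
  proof (rule tendsto_lowerbound[OF lim0])
    show "\<forall>\<^sub>F s in at_right 0. \<phi> t \<le> \<phi> s"
      by (rule eventually_at_rightI[of 0 t]) (use mono t in auto)
  qed simp
  moreover have "0 \<le> \<phi> t" unfolding \<phi>_def by (rule integral_nonneg_AE) simp
  ultimately have "\<phi> t = 0" by simp
  moreover have "integrable ?\<mu> (\<lambda>x. (max 0 (v t x - S x))^3)"
    by (rule L2_excess(1)[OF vL v1 Sm]) (use t in auto)
  ultimately have "AE x in ?\<mu>. (max 0 (v t x - S x))^3 = 0"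
    unfolding \<phi>_def by (subst (asm) integral_nonneg_eq_0_iff_AE) auto
  then show ?thesis using pts
  proof eventually_elim
    case (elim x)
    then have "k t * u t x \<le> radial w x" using S_eq[of x] by (simp add: v_def)
    then have "exp (M * t) * (k t * u t x) \<le> exp (M * t) * radial w x" by (intro mult_left_mono) auto
    moreover have "exp (M * t) * k t = 1" by (simp add: k_def exp_add[symmetric])
    ultimately show ?case by (simp only: mult.assoc[symmetric] mult_1)
  qed
qed

text \<open>
  For weights that merely are nonnegative, compare with \<open>w + \<epsilon>\<close> and let \<open>\<epsilon>\<close> tend to zero. Continuity
  of the solution turns the bounds almost everywhere into pointwise ones.
\<close>

lemma solution_bound:
  assumes sol: "is_solution T f u0 u" and M: "M \<ge> 0" and f: "\<And>s. s \<in> {0..1} \<Longrightarrow> f s \<le> M * s"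
    and w: "superharmonic w" "\<And>n. w n \<ge> 0"
    and init: "AE x in tree_measure T. u0 x \<le> radial w x" and t: "t > 0" and x: "x \<in> points T"
  shows "0 \<le> u t x" "u t x \<le> exp (M * t) * radial w x"
proof -
  have "u t \<in> laplacian_domain T" using sol t by (simp add: is_solution_def)
  then have cont: "continuous_on_tree T (u t)" by (simp add: laplacian_domain_def H1_tree_def)
  have cu: "continuous_on {0..len T e} (\<lambda>s. u t (edge_point T e s))" if "e \<in> edges T" for e
    using edge_restriction_continuous[OF cont that] by (simp add: edge_restriction_def)
  have cr: "continuous_on {0..len T e} (\<lambda>s. radial w (edge_point T e s))" if "e \<in> edges T" for e w
    unfolding radial_edge[OF that] by (intro continuous_intros)
  have "- u t x \<le> 0"
  proof (rule AE_nonpos_imp_everywhere[OF _ _ x])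
    have "AE x in tree_measure T. 0 \<le> u t x \<and> u t x \<le> 1" using sol t unfolding is_solution_def by simp
    then show "AE x in tree_measure T. - u t x \<le> 0" by eventually_elim simp
  qed (intro continuous_intros cu)
  then show "0 \<le> u t x" by simp
  have "u t x \<le> exp (M * t) * radial w x + e" if e: "e > 0" for e
  proof -
    define \<epsilon> where "\<epsilon> = e / exp (M * t)"
    have \<epsilon>: "\<epsilon> > 0" using e by (simp add: \<epsilon>_def)
    let ?w = "\<lambda>n. w n + \<epsilon>"
    have "AE x in tree_measure T. u t x \<le> exp (M * t) * radial ?w x"
    proof (rule solution_bound_AE[OF sol M f superharmonic_shift[OF w(1)] \<epsilon> _ _ t])
      show "AE x in tree_measure T. u0 x \<le> radial ?w x"
        using init by eventually_elim (use \<epsilon> in \<open>simp add: radial_shift\<close>)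
    qed (use w(2) in auto)
    then have ae: "AE x in tree_measure T. u t x - exp (M * t) * radial ?w x \<le> 0" by eventually_elim simp
    have "u t x - exp (M * t) * radial ?w x \<le> 0"
      by (rule AE_nonpos_imp_everywhere[OF ae _ x]) (intro continuous_intros cu cr)
    then show ?thesis by (simp add: radial_shift distrib_left \<epsilon>_def)
  qed
  then show "u t x \<le> exp (M * t) * radial w x" by (rule field_le_epsilon)
qed

end

section \<open>The profile and its speed\<close>

context tree
begin

lemma path_trans:
  assumes "path_of_length T x y a" "path_of_length T y z c" shows "path_of_length T x z (a + c)"
  using assms(2,1) by (induction arbitrary: rule: path_of_length.induct) (auto simp: add.assoc[symmetric] intro: path_of_length.intros)

end

context regular_tree
begin

lemma gen_base: "gen (base T) = 0" using regular base_vert by (auto simp: regular_metric_tree_def)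

lemma radial_r_edge:
  assumes e: "e \<in> edges T" and s: "s \<in> {0..len T e}" and t: "t \<in> {0..len T e}"
  shows "\<bar>radial r (edge_point T e t) - radial r (edge_point T e s)\<bar> = \<bar>t - s\<bar>"
proof -
  have "(r (gen (dst T e)) - r (gen (src T e))) / len T e \<in> {1, -1}"
    by (rule edge_ends[OF e]) (use len_eq[OF e] len_pos[OF e] in \<open>auto simp: field_simps\<close>)
  then obtain \<sigma> where \<sigma>: "(r (gen (dst T e)) - r (gen (src T e))) / len T e = \<sigma>" "\<sigma> = 1 \<or> \<sigma> = -1" by blast
  show ?thesis using \<sigma>(2) unfolding radial_edge[OF e] \<sigma>(1) by auto
qed

text \<open>
  Along a segment of an edge \<open>radial r\<close> changes by exactly the length of the segment.
\<close>

lemma path_length_ge: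
  "path_of_length T x y a \<Longrightarrow> \<bar>radial r y - radial r x\<bar> \<le> a"
proof (induction rule: path_of_length.induct)
  case (path_segment x e s a t)
  then show ?case using radial_r_edge[OF path_segment(2-4)] by linarith
qed simp

lemma path_to_lower_end:
  assumes e: "e \<in> edges T" and s: "s \<in> {0..len T e}"
  obtains v where "v \<in> verts T" "gen v = egen e"
    "path_of_length T (edge_point T e s) (Vertex v) (radial r (edge_point T e s) - r (egen e))"
proof -
  have path: "path_of_length T (edge_point T e s) (edge_point T e t) \<bar>t - s\<bar>" if "t \<in> {0..len T e}" for t
    using path_segment[OF path_trivial[OF edge_point_points[OF e s]] e s that] by simp
  have l: "0 < len T e" "len T e = r (Suc (egen e)) - r (egen e)" by (rule len_pos[OF e], rule len_eq[OF e])
  have V: "src T e \<in> verts T" "dst T e \<in> verts T" using joins_verts[OF joins_src_dst[OF e]] by auto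
  show ?thesis
  proof (rule edge_ends[OF e])
    assume g: "gen (src T e) = egen e" "gen (dst T e) = Suc (egen e)"
    have "radial r (edge_point T e s) - r (egen e) = s" using l by (simp add: radial_edge[OF e] g)
    then show ?thesis using that[OF V(1) g(1)] path[of 0] l s edge_point_simps(1)[of e] by auto
  next
    assume g: "gen (dst T e) = egen e" "gen (src T e) = Suc (egen e)"
    have "radial r (edge_point T e s) - r (egen e) = len T e - s"
    proof -
      have "(r (egen e) - r (Suc (egen e))) / len T e = - 1" using l by (simp add: field_simps)
      then show ?thesis using l(2) by (simp add: radial_edge[OF e] g)
    qed
    then have "radial r (edge_point T e s) - r (egen e) = \<bar>len T e - s\<bar>" using s by simp
    moreover have "path_of_length T (edge_point T e s) (Vertex (dst T e)) \<bar>len T e - s\<bar>"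
      using path[of "len T e"] l(1) edge_point_simps(2)[OF e] by simp
    ultimately show ?thesis by (intro that[OF V(2) g(1)]) (simp only:)
  qed
qed

lemma path_vertex_to_base:
  "v \<in> verts T \<Longrightarrow> path_of_length T (Vertex v) (Vertex (base T)) (r (gen v))"
proof (induction "gen v" arbitrary: v)
  case 0
  then have "v = base T" using regular by (auto simp: regular_metric_tree_def)
  then show ?case using path_trivial[of "Vertex v" T] 0 r0 by (auto simp: points_def)
next
  case (Suc n)
  obtain e where e: "parents v = {e}" "e \<in> edges T" "Suc (egen e) = gen v"
    using parents_singleton[OF Suc.prems] Suc.hyps(2) by auto
  then have "v \<in> {src T e, dst T e}" by (auto simp: parents_def joins_def)
  then obtain s where s: "s \<in> {0..len T e}" "edge_point T e s = Vertex v"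
    using edge_point_simps(1)[of e] edge_point_simps(2)[OF e(2)] len_pos[OF e(2)]
    by (metis atLeastAtMost_iff empty_iff insert_iff less_imp_le order_refl)
  obtain p where p: "p \<in> verts T" "gen p = egen e"
    "path_of_length T (edge_point T e s) (Vertex p) (radial r (edge_point T e s) - r (egen e))"
    using path_to_lower_end[OF e(2) s(1)] .
  have "path_of_length T (Vertex p) (Vertex (base T)) (r (gen p))"
    by (rule Suc.hyps(1)) (use p e Suc.hyps(2) in auto)
  from path_trans[OF p(3) this] show ?case using p(2) by (simp add: s(2) radial_def)
qed

lemma depth_eq: assumes x: "x \<in> points T" shows "depth T x = radial r x"
proof -
  obtain e s where e: "e \<in> edges T" "s \<in> {0..len T e}" "x = edge_point T e s" using point_on_edge[OF x] .
  obtain p where p: "p \<in> verts T" "gen p = egen e"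
    "path_of_length T x (Vertex p) (radial r x - r (egen e))"
    using path_to_lower_end[OF e(1,2)] unfolding e(3) by blast
  have path: "path_of_length T x (Vertex (base T)) (radial r x)"
    using path_trans[OF p(3) path_vertex_to_base[OF p(1)]] p(2) by simp
  have low: "radial r x \<le> a" if "path_of_length T x (Vertex (base T)) a" for a
    using path_length_ge[OF that] by (simp add: radial_def gen_base r0)
  show ?thesis unfolding depth_def path_dist_def
    by (rule cInf_eq_minimum) (use path low in auto)
qed

lemma infinite_height_unbounded:
  assumes "infinite_height T" shows "\<exists>n. r n \<ge> C"
proof (rule ccontr)
  assume "\<not> (\<exists>n. r n \<ge> C)"
  then have C: "- r n \<ge> - C" for n by (auto simp: not_le intro: less_imp_le)
  have "depth T x \<le> C" if "x \<in> points T" for x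
  proof -
    have "radial (\<lambda>n. - 1 * r n) x \<ge> - C" by (rule radial_ge[OF _ that]) (use C in auto)
    then have "radial r x \<le> C" unfolding radial_scale by simp
    then show ?thesis using depth_eq[OF that] by simp
  qed
  then show False using assms by (auto simp: infinite_height_def bdd_above_def)
qed

end

text \<open>
  The weights are \<open>q^(1 - n)\<close> with \<open>q = b 1\<close>, except that the truncated subtraction gives the value \<open>1\<close> at
  the base as well. From one generation to the next the slopes of the interpolation shrink at most by the
  factor \<open>q\<close>, because the edges do not get longer. The number of edges grows at least by this factor.
  At generation \<open>1\<close> the slope on the side of the base is zero.
\<close>

lemma (in spreading_tree) geometric_superharmonic:
  "superharmonic (\<lambda>n. (1 / real (b 1)) ^ (n - 1))"
  unfolding superharmonic_def
proof (intro conjI allI impI)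
  fix n :: nat assume n: "n \<ge> 1"
  define q where "q = real (b 1)"
  have q: "q \<ge> 2" using b2[of 1] by (simp add: q_def)
  have r: "0 < r (Suc n) - r n" "0 < r n - r (n - 1)"
    using strict_monoD[OF r_mono, of n "Suc n"] strict_monoD[OF r_mono, of "n - 1" n] n by auto
  have rr: "r (Suc n) - r n \<le> r n - r (n - 1)" using antimonoD[OF antimono_len, of "n - 1" n] n by simp
  have bq: "q \<le> real (b n)" using monoD[OF mono_b n] by (simp add: q_def)
  have w1: "(1 / q) ^ (n - 1) - (1 / q) ^ n = (1 / q) ^ n * (q - 1)"
    using n q by (cases n) (auto simp: field_simps)
  have le: "(1 / q) ^ (n - 1 - 1) - (1 / q) ^ (n - 1) \<le> q * ((1 / q) ^ (n - 1) - (1 / q) ^ n)"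
  proof (cases "n = 1")
    case True then show ?thesis using q by (simp add: field_simps)
  next
    case False
    define m where "m = n - 2"
    have m: "n = Suc (Suc m)" using n False by (simp add: m_def)
    show ?thesis using q by (simp add: m field_simps)
  qed
  have nn: "0 \<le> (1 / q) ^ (n - 1) - (1 / q) ^ n" unfolding w1 using q by simp
  have "((1 / q) ^ (n - 1 - 1) - (1 / q) ^ (n - 1)) / (r n - r (n - 1)) \<le> (q * ((1 / q) ^ (n - 1) - (1 / q) ^ n)) / (r n - r (n - 1))"
    using le r by (intro divide_right_mono) auto
  also have "\<dots> \<le> (real (b n) * ((1 / q) ^ (n - 1) - (1 / q) ^ n)) / (r n - r (n - 1))"
    using bq nn r by (intro divide_right_mono mult_right_mono) auto
  also have "\<dots> \<le> (real (b n) * ((1 / q) ^ (n - 1) - (1 / q) ^ n)) / (r (Suc n) - r n)"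
    using nn r rr by (intro divide_left_mono mult_nonneg_nonneg) auto
  finally show "((1 / real (b 1)) ^ (n - 1 - 1) - (1 / real (b 1)) ^ (n - 1)) / (r n - r (n - 1)) \<le>
     real (b n) * (((1 / real (b 1)) ^ (n - 1) - (1 / real (b 1)) ^ (Suc n - 1)) / (r (Suc n) - r n))"
    by (simp add: q_def)
qed simp

lemma m_bound_eq:
  assumes r: "strict_mono r" and x: "r n < \<rho>" "\<rho> < r (Suc n)"
  shows "m_bound b r \<rho> = m_piece b r (Suc n) \<rho>"
proof -
  have other: "\<rho> \<notin> {r k<..<r (Suc k)}" if "k \<noteq> n" for k
  proof (cases "k < n")
    case True
    then have "r (Suc k) \<le> r n" using r by (simp add: strict_mono_less_eq)
    then show ?thesis using x by auto
  next
    case False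
    then have "r (Suc n) \<le> r k" using r that by (simp add: strict_mono_less_eq)
    then show ?thesis using x by auto
  qed
  have "(\<Sum>k. m_piece b r (Suc k) \<rho> * indicator {r k<..<r (Suc k)} \<rho>) =
    (\<Sum>k\<in>{n}. m_piece b r (Suc k) \<rho> * indicator {r k<..<r (Suc k)} \<rho>)"
    by (rule suminf_finite) (use other in auto)
  then show ?thesis using x by (simp add: m_bound_def)
qed

context spreading_tree
begin

lemma power_le_branching_prod: "real (b 1) ^ n \<le> (\<Prod>i\<le>n. real (b i))"
proof (induction n)
  case 0 then show ?case using b0 by simp
next
  case (Suc n)
  have "real (b 1) \<le> real (b (Suc n))" using monoD[OF mono_b, of 1 "Suc n"] by simp
  then have "real (b 1) ^ n * real (b 1) \<le> (\<Prod>i\<le>n. real (b i)) * real (b (Suc n))"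
    using Suc by (intro mult_mono) (auto intro: prod_nonneg)
  then show ?case by (simp add: mult.commute)
qed

text \<open>
  Each of the two products has at least \<open>k\<close> factors not below \<open>b 1\<close>.
\<close>

lemma sqrt_prod_le:
  assumes "k \<le> i" "k \<le> j"
  shows "1 / (sqrt (\<Prod>i\<le>i. real (b i)) * sqrt (\<Prod>i\<le>j. real (b i))) \<le> (1 / real (b 1)) ^ k"
proof -
  let ?q = "real (b 1)"
  have q: "?q \<ge> 2" using b2[of 1] by simp
  have "sqrt (?q ^ k) \<le> sqrt (\<Prod>i\<le>m. real (b i))" if "k \<le> m" for m
  proof -
    have "?q ^ k \<le> ?q ^ m" using q that by (intro power_increasing) auto
    then show ?thesis using power_le_branching_prod[of m] by (intro real_sqrt_le_mono) linarith
  qed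
  from this[OF assms(1)] this[OF assms(2)]
  have "sqrt (?q ^ k) * sqrt (?q ^ k) \<le> sqrt (\<Prod>i\<le>i. real (b i)) * sqrt (\<Prod>i\<le>j. real (b i))"
    by (rule mult_mono) (use q in \<open>auto intro!: prod_nonneg\<close>)
  then have le: "?q ^ k \<le> sqrt (\<Prod>i\<le>i. real (b i)) * sqrt (\<Prod>i\<le>j. real (b i))" using q by simp
  have "?q ^ k > 0" using q by simp
  then have "1 / (sqrt (\<Prod>i\<le>i. real (b i)) * sqrt (\<Prod>i\<le>j. real (b i))) \<le> 1 / ?q ^ k"
    using le by (intro frac_le) auto
  then show ?thesis by (simp add: power_one_over)
qed

text \<open>
  On an edge of generation \<open>n \<ge> 1\<close> the bound is affine as well, with the end values
  \<open>1 / sqrt (P n * P (n - 1))\<close> and \<open>1 / sqrt (P n * P (n + 1))\<close>, where \<open>P n = b 0 * \<dots> * b n\<close> is at least \<open>(b 1)^n\<close>.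
  So it suffices to compare the end values. The bound jumps from \<open>1\<close> to \<open>1 / sqrt (b 1)\<close> at distance
  \<open>r 1\<close> from the base; the supersolution stays continuous there and only decreases afterwards.
\<close>

lemma m_bound_le:
  assumes e: "e \<in> edges T" and s: "s \<in> open_edge T e"
  shows "m_bound b r (depth T (Inner e s)) \<le> radial (\<lambda>n. (1 / real (b 1)) ^ (n - 1)) (Inner e s)"
proof -
  let ?w = "\<lambda>n. (1 / real (b 1)) ^ (n - 1)"
  define n where "n = egen e"
  have s': "s \<in> {0..len T e}" "edge_point T e s = Inner e s" using s edge_point_simps(3)[OF s] by (auto simp: open_edge_def)
  obtain \<theta> where \<theta>: "0 \<le> \<theta>" "\<theta> \<le> 1" "\<And>w. radial w (Inner e s) = (1 - \<theta>) * w n + \<theta> * w (Suc n)"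
    using radial_convex[OF e s'(1)] unfolding s'(2) n_def by blast
  have D: "depth T (Inner e s) = r n + \<theta> * (r (Suc n) - r n)"
    using depth_eq[of "Inner e s"] e s \<theta>(3)[of r] by (auto simp: points_def open_edge_def algebra_simps)
  have l: "len T e = r (Suc n) - r n" "0 < len T e" using len_eq[OF e] len_pos[OF e] by (auto simp: n_def)
  have "radial r (Inner e s) \<noteq> r n \<and> radial r (Inner e s) \<noteq> r (Suc n)"
    using radial_r_edge[OF e s'(1), of 0] radial_r_edge[OF e s'(1), of "len T e"] s l edge_ends[OF e] s'(2)
      edge_point_simps(1)[of e] edge_point_simps(2)[OF e]
    by (simp add: radial_def open_edge_def n_def) (smt (verit))
  then have th: "0 < \<theta>" "\<theta> < 1" using \<theta> by (auto simp: less_le)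
  have in_n: "r n < depth T (Inner e s)" "depth T (Inner e s) < r (Suc n)"
  proof -
    show "r n < depth T (Inner e s)" unfolding D using th l by simp
    have "\<theta> * (r (Suc n) - r n) < 1 * (r (Suc n) - r n)" using th l by (intro mult_strict_right_mono) auto
    then show "depth T (Inner e s) < r (Suc n)" unfolding D by simp
  qed
  have m: "m_bound b r (depth T (Inner e s)) = m_piece b r (Suc n) (depth T (Inner e s))"
    by (rule m_bound_eq[OF r_mono in_n])
  show ?thesis
  proof (cases n)
    case 0
    then show ?thesis using m \<theta>(3)[of ?w] by (simp add: m_piece_def)
  next
    case (Suc k)
    define P where "P n = sqrt (\<Prod>i\<le>n. real (b i))" for n
    have "m_piece b r (Suc n) (depth T (Inner e s)) =
        1 / P n * (1 / P k - kappa b r (Suc n) * (\<theta> * (r (Suc n) - r n)))"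
      using Suc by (simp add: m_piece_def D P_def)
    also have "kappa b r (Suc n) * (\<theta> * (r (Suc n) - r n)) = \<theta> * (1 / P k - 1 / P (Suc n))"
      using l Suc by (simp add: kappa_def P_def)
    also have "1 / P n * (1 / P k - \<theta> * (1 / P k - 1 / P (Suc n))) =
       (1 - \<theta>) * (1 / (P n * P k)) + \<theta> * (1 / (P n * P (Suc n)))"
      by (simp add: divide_inverse algebra_simps)
    also have "\<dots> \<le> (1 - \<theta>) * ?w n + \<theta> * ?w (Suc n)"
    proof (intro add_mono mult_left_mono)
      show "1 / (P n * P k) \<le> ?w n" unfolding P_def by (rule sqrt_prod_le) (use Suc in auto)
      show "1 / (P n * P (Suc n)) \<le> ?w (Suc n)" unfolding P_def by (rule sqrt_prod_le) auto
    qed (use th in auto)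
    finally show ?thesis using m \<theta>(3)[of ?w] by simp
  qed
qed

lemma r_le: "r n \<le> real n * r 1"
proof (induction n)
  case (Suc n) then show ?case using len_le[of n] by (simp add: algebra_simps)
qed (use r0 in simp)

text \<open>
  Since edges are not longer than \<open>r 1\<close>, a point of depth \<open>d\<close> lies on an edge of generation at least
  \<open>d / r 1 - 1\<close>. The factor \<open>(b 1)\<^sup>2\<close> absorbs the rounding and the shift in the exponent of the weights.
\<close>

lemma geometric_decay:
  assumes x: "x \<in> points T"
  shows "radial (\<lambda>n. (1 / real (b 1)) ^ (n - 1)) x \<le> (real (b 1))\<^sup>2 * exp (- (ln (real (b 1)) / r 1) * depth T x)"
proof -
  let ?q = "real (b 1)" and ?w = "\<lambda>n. (1 / real (b 1)) ^ (n - 1)"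
  have q: "?q \<ge> 2" using b2[of 1] by simp
  obtain e s where e: "e \<in> edges T" "s \<in> {0..len T e}" "x = edge_point T e s" using point_on_edge[OF x] .
  define n where "n = egen e"
  obtain \<theta> where \<theta>: "0 \<le> \<theta>" "\<theta> \<le> 1" "\<And>w. radial w x = (1 - \<theta>) * w n + \<theta> * w (Suc n)"
    using radial_convex[OF e(1,2)] unfolding e(3) n_def by blast
  have "(1 - \<theta>) * ?w n + \<theta> * ?w (Suc n) \<le> (1 - \<theta>) * ?w n + \<theta> * ?w n"
    using \<theta> q by (intro add_left_mono mult_left_mono power_decreasing) auto
  moreover have "(1 - \<theta>) * ?w n + \<theta> * ?w n = ?w n" by (simp only: left_diff_distrib mult_1)
  ultimately have 1: "radial ?w x \<le> ?w n" using \<theta>(3)[of ?w] by linarith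
  have "r n \<le> r (Suc n)" using r_mono by (simp add: strict_mono_less_eq)
  then have "(1 - \<theta>) * r n + \<theta> * r (Suc n) \<le> (1 - \<theta>) * r (Suc n) + \<theta> * r (Suc n)"
    using \<theta> by (intro add_right_mono mult_left_mono) auto
  then have "depth T x \<le> r (Suc n)" using depth_eq[OF x] \<theta>(3) by (simp add: algebra_simps)
  also have "\<dots> \<le> real (Suc n) * r 1" by (rule r_le)
  finally have "depth T x / r 1 \<le> real n + 1" using r1_pos by (simp add: field_simps)
  then have "ln ?q * (depth T x / r 1) \<le> ln ?q * (real n + 1)" using q by (intro mult_left_mono) auto
  moreover have "ln ?q \<ge> 0" using q by simp
  ultimately have 2: "- (real (n - 1) * ln ?q) \<le> 2 * ln ?q + - (ln ?q / r 1) * depth T x"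
    by (cases n) (auto simp: algebra_simps)
  have "?w n = exp (- (real (n - 1) * ln ?q))"
    using q by (simp add: exp_minus exp_of_nat_mult power_one_over inverse_eq_divide)
  also have "\<dots> \<le> exp (2 * ln ?q + - (ln ?q / r 1) * depth T x)" using 2 by simp
  also have "\<dots> = ?q\<^sup>2 * exp (- (ln ?q / r 1) * depth T x)"
  proof -
    have "exp (2 * ln ?q) = ?q\<^sup>2" using q exp_of_nat_mult[of 2 "ln ?q"] by simp
    then show ?thesis by (simp only: exp_add)
  qed
  finally show ?thesis using 1 by simp
qed

end

theorem theorem2p4:
  fixes T :: "('v, 'e) metric_graph"
    and b :: "nat \<Rightarrow> nat"
    and r :: "nat \<Rightarrow> real"
    and f :: "real \<Rightarrow> real"
    and u0 :: "('v, 'e) point \<Rightarrow> real"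
    and u :: "real \<Rightarrow> ('v, 'e) point \<Rightarrow> real"
    and M c :: real
    and y :: "('v, 'e) point"
  assumes "regular_metric_tree T b r"
    and "infinite_height T"
    and "mono b"
    and "antimono (\<lambda>n. r (Suc n) - r n)"
    and "u0 \<in> L2 (tree_measure T)"
    and "AE x in tree_measure T. 0 \<le> u0 x \<and> u0 x \<le> 1"
    and "C1_on {0..1} f"
    and "smooth_on {0<..<1} f"
    and "f 0 = 0" and "f 1 = 0"
    and "\<And>s. s \<in> {0<..<1} \<Longrightarrow> f s > 0"
    and "bdd_above ((\<lambda>s. f s / s) ` {0<..1})"
    and "M = (SUP s\<in>{0<..1}. f s / s)"
    and "AE x in tree_measure T. u0 x \<le> m_bound b r (depth T x)"
    and "is_solution T f u0 u"
    and "y \<in> points T"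
    and "c > M * r 1 * (real (b 1) / (real (b 1) - 1))"
  shows "((\<lambda>t. SUP x\<in>{x \<in> points T. depth T x \<ge> depth T y + c * t}. u t x) \<longlongrightarrow> 0) at_top"
proof -
  interpret regular_tree T b r by unfold_locales (fact assms(1))
  interpret spreading_tree T b r
    using infinite_height_unbounded[OF assms(2)] assms(3,4) by unfold_locales auto
  define q where "q = real (b 1)"
  define \<gamma> where "\<gamma> = ln q / r 1"
  let ?w = "\<lambda>n. (1 / q) ^ (n - 1)"
  have q: "q \<ge> 2" using b2[of 1] by (simp add: q_def)
  have fM: "f s / s \<le> M" if "s \<in> {0<..1}" for s
    unfolding assms(13) by (rule cSUP_upper[OF that assms(12)])
  have M: "M > 0" using fM[of "1/2"] assms(11)[of "1/2"] by simp
  have f_le: "f s \<le> M * s" if "s \<in> {0..1}" for s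
    using fM[of s] that assms(9) by (cases "s = 0") (auto simp: field_simps)
  have \<gamma>: "\<gamma> > 0" using q r1_pos by (simp add: \<gamma>_def)
  \<comment> \<open>The profile decays by the factor \<open>q\<close> over the length \<open>r 1\<close>, so the growth at rate \<open>M\<close>
    is compensated at the speed \<open>M * r 1 / ln q\<close>.\<close>
  have "(q - 1) / q \<le> ln q"
    using ln_le_minus_one[of "1 / q"] q by (simp add: ln_div field_simps)
  then have "1 / ln q \<le> 1 / ((q - 1) / q)" using q by (intro divide_left_mono) auto
  then have "M * r 1 * (1 / ln q) \<le> M * r 1 * (q / (q - 1))"
    using M r1_pos by (intro mult_left_mono) auto
  also have "\<dots> < c" using assms(17) by (simp add: q_def)
  finally have rate: "M < \<gamma> * c" using q r1_pos by (simp add: \<gamma>_def field_simps)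
  have init: "AE x in tree_measure T. u0 x \<le> radial ?w x"
    using assms(14) AE_not_vertex[of T] AE_space[of "tree_measure T"]
  proof eventually_elim
    case (elim x)
    then obtain e s where x: "x = Inner e s" "e \<in> edges T" "s \<in> open_edge T e"
      by (auto simp: space_tree_measure points_def open_edge_def)
    show ?case using elim(1) m_bound_le[OF x(2,3)] by (simp add: x(1) q_def)
  qed
  have upper: "u t x \<le> exp (M * t) * (q\<^sup>2 * exp (- \<gamma> * depth T x))" and lower: "0 \<le> u t x"
    if "t > 0" "x \<in> points T" for t x
  proof -
    note bound = solution_bound[OF assms(15) less_imp_le[OF M] f_le _ _ init that]
    have w: "superharmonic ?w" "\<And>n. ?w n \<ge> 0" using geometric_superharmonic q by (auto simp: q_def)
    show "0 \<le> u t x" by (rule bound(1)[OF _ w])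
    have "u t x \<le> exp (M * t) * radial ?w x" by (rule bound(2)[OF _ w])
    also have "\<dots> \<le> exp (M * t) * (q\<^sup>2 * exp (- \<gamma> * depth T x))"
      using geometric_decay[OF that(2)] by (intro mult_left_mono) (auto simp: q_def \<gamma>_def)
    finally show "u t x \<le> exp (M * t) * (q\<^sup>2 * exp (- \<gamma> * depth T x))" .
  qed
  let ?A = "\<lambda>t. {x \<in> points T. depth T x \<ge> depth T y + c * t}"
  let ?B = "\<lambda>t. q\<^sup>2 * exp (- \<gamma> * depth T y) * exp ((M - \<gamma> * c) * t)"
  have ne: "?A t \<noteq> {}" for t
  proof
    assume "?A t = {}"
    then have "depth T x \<le> depth T y + c * t" if "x \<in> points T" for x using that by force
    then show False using assms(2) by (auto simp: infinite_height_def bdd_above_def)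
  qed
  have le: "u t x \<le> ?B t" if "t > 0" "x \<in> ?A t" for t x
  proof -
    have "- \<gamma> * depth T x \<le> - \<gamma> * (depth T y + c * t)" using that \<gamma> by auto
    then have "exp (M * t) * (q\<^sup>2 * exp (- \<gamma> * depth T x)) \<le> exp (M * t) * (q\<^sup>2 * exp (- \<gamma> * (depth T y + c * t)))"
      by (intro mult_left_mono) auto
    moreover have "u t x \<le> exp (M * t) * (q\<^sup>2 * exp (- \<gamma> * depth T x))" using upper that by blast
    ultimately have "u t x \<le> exp (M * t) * (q\<^sup>2 * exp (- \<gamma> * (depth T y + c * t)))" by (rule order_trans[rotated])
    also have "\<dots> = ?B t" by (simp add: exp_add[symmetric] algebra_simps)
    finally show ?thesis .
  qed
  have SUP: "0 \<le> (SUP x\<in>?A t. u t x) \<and> (SUP x\<in>?A t. u t x) \<le> ?B t" if t: "t > 0" for t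
  proof
    obtain x where x: "x \<in> ?A t" using ne by blast
    have "bdd_above (u t ` ?A t)" using le[OF t] by (auto intro!: bdd_aboveI)
    then have "u t x \<le> (SUP x\<in>?A t. u t x)" by (rule cSUP_upper[OF x])
    then show "0 \<le> (SUP x\<in>?A t. u t x)" using lower[OF t, of x] x by auto
    show "(SUP x\<in>?A t. u t x) \<le> ?B t" by (rule cSUP_least[OF ne]) (rule le[OF t])
  qed
  show ?thesis
  proof (rule Lim_null_comparison)
    show "\<forall>\<^sub>F t in at_top. norm (SUP x\<in>?A t. u t x) \<le> ?B t"
      using eventually_gt_at_top[of 0] by eventually_elim (use SUP in simp)
    have "((\<lambda>t. exp ((M - \<gamma> * c) * t)) \<longlongrightarrow> 0) at_top"
      by (intro filterlim_compose[OF exp_at_bot] filterlim_tendsto_neg_mult_at_bot[OF tendsto_const] filterlim_ident)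
        (use rate in simp)
    from tendsto_mult_left[OF this, of "q\<^sup>2 * exp (- \<gamma> * depth T y)"]
    show "(?B \<longlongrightarrow> 0) at_top" by simp
  qed
qed

end
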